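(* Let $\mathfrak{M}$ be either the free Brownian motion $S$ or the compensated free Poisson process $\hat N$. Let $n,m\ge1$ be natural numbers and let $f\in L^2(\mathbb{R}_+^n)$ and $g\in L^2(\mathbb{R}_+^m)$ be symmetric functions. Then $I_n^{\mathfrak{M}}(f)$ and $I_m^{\mathfrak{M}}(g)$ are free if and only if their squares are uncorrelated, i.e. if and only if $$\mathrm{Cov}\big(I_n^{\mathfrak{M}}(f)^2,I_m^{\mathfrak{M}}(g)^2\big)=0.$$
   Context: $\mathbb{R}_+=[0,\infty)$ with Lebesgue measure; $L^2(\mathbb{R}_+^n)$ is the space of complex-valued square-integrable functions. A function $f\in L^2(\mathbb{R}_+^n)$ is called symmetric if it is real-valued and $f(t_1,\dots,t_n)=f(t_{\sigma(1)},\dots,t_{\sigma(n)})$ for a.e. $(t_1,\dots,t_n)$ and every permutation $\sigma$. Its adjoint is $f^*(t_1,\dots,t_n)=\overline{f(t_n,\dots,t_1)}$. $(\mathscr{A},\varphi)$ is a tracial $W^*$-probability space: $\mathscr{A}$ is a von Neumann algebra and $\varphi:\mathscr{A}\to\mathbb{C}$ is a unital, weakly continuous, positive, faithful, tracial linear functional. $L^2(\mathscr{A},\varphi)$ is the completion of $\mathscr{A}$ for $\|X\|_2=\sqrt{\varphi(XX^* )}$. $\mathrm{Cov}(X,Y)=\varphi(XY)-\varphi(X)\varphi(Y)$. Freeness: $X_1,\dots,X_d$ are free if $\varphi\big([P_1(X_{i_1})-\varphi(P_1(X_{i_1}))]\cdots[P_r(X_{i_r})-\varphi(P_r(X_{i_r}))]\big)=0$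 whenever $r\ge1$, $P_1,\dots,P_r$ are polynomials and $i_1,\dots,i_r\in\{1,\dots,d\}$ have no two adjacent indices equal. Free Brownian motion $S=\{S_t\}_{t\ge0}$: self-adjoint elements of $\mathscr{A}$, adapted to an increasing filtration $(\mathscr{A}_t)_{t\ge 0}$ of von Neumann subalgebras, with $S_0=0$ and such that for $0\le u<t$ the increment $S_t-S_u$ is free from $\mathscr{A}_u$ and has the centered semicircular law of variance $t-u$, with density $(2\pi(t-u))^{-1}\sqrt{4(t-u)-x^2}$ on $[-2\sqrt{t-u},2\sqrt{t-u}]$. Free Poisson process $N=\{N_t\}_{t\ge0}$: positive elements of $\mathscr{A}$ adapted to such a filtration, with $N_0=0$ and $N_t-N_u$ free from $\mathscr{A}_u$ with the free Poisson law of rate $\lambda=t-u$, i.e. $(1-\lambda)\delta_0+\tilde\nu$ if $\lambda\le1$ (with the understanding that $\tilde\nu$ carries mass $\lambda$) and $\tilde\nu$ if $\lambda>1$, where $\tilde\nu(dx)=(2\pi x)^{-1}\sqrt{4\lambda-(x-1-\lambda)^2}\,dx$ on $[(1-\sqrt\lambda)^2,(1+\sqrt\lambda)^2]$. $\hat N_t=N_t-t\mathbf{1}$ is the compensated process. Multiple integrals: for $\mathfrak{M}\in\{S,\hat N\}$, $I_n^{\mathfrak{M}}$ is the linear map $L^2(\mathbb{R}_+^n)\to L^2(\mathscr{A},\varphi)$ determined by $I_n^{\mathfrak{M}}(\mathbf{1}_{[a_1,b_1]\times\cdots\times[a_n,b_n]})=(\mathfrak{M}_{b_1}-\mathfrak{M}_{a_1})\cdots(\mathfrak{M}_{b_n}-\mathfrak{M}_{a_n})$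 for pairwise disjoint intervals and extended by linearity and the isometry $\varphi(I_n^{\mathfrak{M}}(f)I_n^{\mathfrak{M}}(g)^* )=\langle f,g\rangle_{L^2(\mathbb{R}_+^n)}$; $I_0^{\mathfrak M}(c)=c\mathbf 1$. Integrals of different orders are orthogonal, and $I_n^{\mathfrak{M}}(f)^*=I_n^{\mathfrak{M}}(f^* )$. Contractions, for $f\in L^2(\mathbb{R}_+^n)$, $g\in L^2(\mathbb{R}_+^m)$: for $0\le p\le n\wedge m$, $(f\stackrel{p}{\frown}g)(t_1,\dots,t_{n+m-2p})=\int_{\mathbb{R}_+^p}f(t_1,\dots,t_{n-p},s_1,\dots,s_p)\,g(s_p,\dots,s_1,t_{n-p+1},\dots,t_{n+m-2p})\,ds_1\cdots ds_p$; and for $1\le p\le n\wedge m$, $(f\star_p^{p-1}g)(t_1,\dots,t_{n+m-2p+1})=\int_{\mathbb{R}_+^{p-1}}f(t_1,\dots,t_{n-p+1},s_{p-1},\dots,s_1)\,g(s_1,\dots,s_{p-1},t_{n-p+1},\dots,t_{n+m-2p+1})\,ds_1\cdots ds_{p-1}$. Standing convention: the multiple integrals span a unital $*$-algebra, with products (hence moments) computed by $I_n^S(f)I_m^S(g)=\sum_{p=0}^{n\wedge m}I_{n+m-2p}^S(f\stackrel{p}{\frown}g)$ in the Wigner case and $I_n^{\hat N}(f)I_m^{\hat N}(g)=\sum_{p=0}^{n\wedge m}I_{n+m-2p}^{\hat N}(f\stackrel{p}{\frown}g)+\sum_{p=1}^{n\wedge m}I_{n+m-2p+1}^{\hat N}(f\star_p^{p-1}g)$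 in the free Poisson case.
   Formalization: In the free Poisson case it is additionally assumed that every kernel obtained from f and g by iterated contractions of both kinds is square-integrable, and the product formula is required only for pairs whose star contractions are square-integrable. *)

theory Defs
  imports "HOL-Analysis.Analysis" "HOL-Computational_Algebra.Polynomial"
begin

section \<open>Complex Hilbert spaces and von Neumann algebras\<close>

text \<open>The inner product is linear in its first argument.\<close>

class complex_hilbert_space = banach +
  fixes scaleC :: "complex \<Rightarrow> 'a \<Rightarrow> 'a"  (infixr "*\<^sub>C" 75)
    and cinner :: "'a \<Rightarrow> 'a \<Rightarrow> complex"
  assumes scaleC_add_right: "c *\<^sub>C (x + y) = c *\<^sub>C x + c *\<^sub>C y"
    and scaleC_add_left: "(c + d) *\<^sub>C x = c *\<^sub>C x + d *\<^sub>C x"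
    and scaleC_scaleC: "c *\<^sub>C d *\<^sub>C x = (c * d) *\<^sub>C x"
    and scaleC_of_real: "complex_of_real r *\<^sub>C x = r *\<^sub>R x"
    and cinner_add_left: "cinner (x + y) z = cinner x z + cinner y z"
    and cinner_scaleC_left: "cinner (c *\<^sub>C x) y = c * cinner x y"
    and cinner_commute: "cinner y x = cnj (cinner x y)"
    and cinner_self: "cinner x x = complex_of_real ((norm x)\<^sup>2)"

text \<open>Operators are elements of the type of real-linear bounded maps; the complex-linear ones
  among them are singled out by \<open>bounded_ops\<close>. The complex multiple \<open>c T\<close> of an operator
  is written \<open>scaleC_op c o\<^sub>L T\<close>.\<close>

definition bounded_ops :: "('h::complex_hilbert_space \<Rightarrow>\<^sub>L 'h) set" where
  "bounded_ops = {T. \<forall>c x. blinfun_apply T (c *\<^sub>C x) = c *\<^sub>C blinfun_apply T x}"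

definition scaleC_op :: "complex \<Rightarrow> 'h::complex_hilbert_space \<Rightarrow>\<^sub>L 'h" where
  "scaleC_op c = Blinfun (\<lambda>x. c *\<^sub>C x)"

lemma norm_scaleC: "norm (c *\<^sub>C x) = cmod c * norm (x::'a::complex_hilbert_space)"
proof -
  have "cinner (c *\<^sub>C x) (c *\<^sub>C x) = c * cnj c * cinner x x"
    by (metis (no_types, lifting) cinner_commute cinner_scaleC_left complex_cnj_mult mult.assoc mult.left_commute)
  then have "complex_of_real ((norm (c *\<^sub>C x))\<^sup>2) = complex_of_real ((cmod c * norm x)\<^sup>2)"
    by (simp only: cinner_self complex_norm_square[symmetric] power_mult_distrib of_real_mult)
  then show ?thesis
    by (metis mult_nonneg_nonneg norm_ge_zero of_real_eq_iff power2_eq_imp_eq)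
qed

lemma blinfun_apply_scaleC_op: "blinfun_apply (scaleC_op c) x = c *\<^sub>C x"
proof -
  have "bounded_linear (\<lambda>x::'a. c *\<^sub>C x)"
  proof (rule bounded_linear_intro[where K = "cmod c"])
    fix r :: real and x :: 'a
    show "c *\<^sub>C r *\<^sub>R x = r *\<^sub>R c *\<^sub>C x"
      by (metis mult.commute scaleC_of_real scaleC_scaleC)
  qed (simp_all add: scaleC_add_right norm_scaleC mult.commute)
  then show ?thesis by (simp add: scaleC_op_def bounded_linear_Blinfun_apply)
qed

definition is_adjoint ::
    "('h::complex_hilbert_space \<Rightarrow>\<^sub>L 'h) \<Rightarrow> ('h \<Rightarrow>\<^sub>L 'h) \<Rightarrow> bool" where
  "is_adjoint T U \<longleftrightarrow>
     (\<forall>x y. cinner (blinfun_apply T x) y = cinner x (blinfun_apply U y))"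

definition adj :: "('h::complex_hilbert_space \<Rightarrow>\<^sub>L 'h) \<Rightarrow> ('h \<Rightarrow>\<^sub>L 'h)" where
  "adj T = (THE U. is_adjoint T U)"

definition commutant ::
    "('h::complex_hilbert_space \<Rightarrow>\<^sub>L 'h) set \<Rightarrow> ('h \<Rightarrow>\<^sub>L 'h) set" where
  "commutant M = {T \<in> bounded_ops. \<forall>U\<in>M. T o\<^sub>L U = U o\<^sub>L T}"

definition von_neumann_algebra :: "('h::complex_hilbert_space \<Rightarrow>\<^sub>L 'h) set \<Rightarrow> bool" where
  "von_neumann_algebra M \<longleftrightarrow>
     M \<subseteq> bounded_ops \<and> (\<forall>T\<in>M. \<exists>U\<in>M. is_adjoint T U) \<and> commutant (commutant M) = M"

text \<open>The initial topology for the functionals \<open>T \<mapsto> \<Sum>k. \<langle>T x\<^sub>k, y\<^sub>k\<rangle>\<close> with square-summable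
  sequences \<open>x\<close> and \<open>y\<close>. On a von Neumann algebra it is the weak* topology given by the predual.\<close>

definition ultraweak_topology :: "('h::complex_hilbert_space \<Rightarrow>\<^sub>L 'h) topology" where
  "ultraweak_topology = pullback_topology UNIV
     (\<lambda>T (x :: nat \<Rightarrow> 'h, y :: nat \<Rightarrow> 'h).
        if summable (\<lambda>k. (norm (x k))\<^sup>2) \<and> summable (\<lambda>k. (norm (y k))\<^sup>2)
        then \<Sum>k. cinner (blinfun_apply T (x k)) (y k) else 0)
     euclidean"

section \<open>Tracial W*-probability spaces\<close>

definition tracial_W_star_space ::
    "('h::complex_hilbert_space \<Rightarrow>\<^sub>L 'h) set \<Rightarrow> (('h \<Rightarrow>\<^sub>L 'h) \<Rightarrow> complex) \<Rightarrow> bool" where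
  "tracial_W_star_space M \<phi> \<longleftrightarrow>
     von_neumann_algebra M \<and>
     (\<forall>T\<in>M. \<forall>U\<in>M. \<phi> (T + U) = \<phi> T + \<phi> U) \<and>
     (\<forall>c. \<forall>T\<in>M. \<phi> (scaleC_op c o\<^sub>L T) = c * \<phi> T) \<and>
     \<phi> id_blinfun = 1 \<and>
     continuous_map (subtopology ultraweak_topology M) euclidean \<phi> \<and>
     (\<forall>T\<in>M. \<phi> (adj T o\<^sub>L T) \<in> \<real>\<^sub>\<ge>\<^sub>0) \<and>
     (\<forall>T\<in>M. \<phi> (adj T o\<^sub>L T) = 0 \<longrightarrow> T = 0) \<and>
     (\<forall>T\<in>M. \<forall>U\<in>M. \<phi> (T o\<^sub>L U) = \<phi> (U o\<^sub>L T))"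

primrec op_pow :: "('h::complex_hilbert_space \<Rightarrow>\<^sub>L 'h) \<Rightarrow> nat \<Rightarrow> ('h \<Rightarrow>\<^sub>L 'h)" where
  "op_pow T 0 = id_blinfun"
| "op_pow T (Suc k) = T o\<^sub>L op_pow T k"

definition op_poly ::
    "complex poly \<Rightarrow> ('h::complex_hilbert_space \<Rightarrow>\<^sub>L 'h) \<Rightarrow> ('h \<Rightarrow>\<^sub>L 'h)" where
  "op_poly P T = (\<Sum>k\<le>degree P. scaleC_op (coeff P k) o\<^sub>L op_pow T k)"

definition op_prod :: "('h::complex_hilbert_space \<Rightarrow>\<^sub>L 'h) list \<Rightarrow> ('h \<Rightarrow>\<^sub>L 'h)" where
  "op_prod Ts = foldr (o\<^sub>L) Ts id_blinfun"

definition free_subalgebras ::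
    "(('h::complex_hilbert_space \<Rightarrow>\<^sub>L 'h) \<Rightarrow> complex) \<Rightarrow>
     ('h \<Rightarrow>\<^sub>L 'h) set \<Rightarrow> ('h \<Rightarrow>\<^sub>L 'h) set \<Rightarrow> bool" where
  "free_subalgebras \<phi> A B \<longleftrightarrow>
     (\<forall>Ts :: (('h \<Rightarrow>\<^sub>L 'h) \<times> bool) list.
        Ts \<noteq> [] \<and> distinct_adj (map snd Ts) \<and>
        (\<forall>(T, in_A) \<in> set Ts. T \<in> (if in_A then A else B) \<and> \<phi> T = 0)
        \<longrightarrow> \<phi> (op_prod (map fst Ts)) = 0)"

definition free_from ::
    "(('h::complex_hilbert_space \<Rightarrow>\<^sub>L 'h) \<Rightarrow> complex) \<Rightarrow>
     ('h \<Rightarrow>\<^sub>L 'h) \<Rightarrow> ('h \<Rightarrow>\<^sub>L 'h) set \<Rightarrow> bool" where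
  "free_from \<phi> X B \<longleftrightarrow> free_subalgebras \<phi> (range (\<lambda>P. op_poly P X)) B"

text \<open>A bounded self-adjoint element determines its law, a compactly supported probability measure
  on the line, through its moments.\<close>

definition has_law ::
    "(('h::complex_hilbert_space \<Rightarrow>\<^sub>L 'h) \<Rightarrow> complex) \<Rightarrow> ('h \<Rightarrow>\<^sub>L 'h) \<Rightarrow> real measure \<Rightarrow> bool"
  where "has_law \<phi> X \<mu> \<longleftrightarrow>
     is_adjoint X X \<and> (\<forall>k. \<phi> (op_pow X k) = complex_of_real (\<integral>x. x ^ k \<partial>\<mu>))"

definition semicircular_law :: "real \<Rightarrow> real measure" where
  "semicircular_law s = density lborel
     (\<lambda>x. ennreal (indicator {- 2 * sqrt s .. 2 * sqrt s} x * sqrt (4 * s - x\<^sup>2) / (2 * pi * s)))"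

text \<open>For \<open>r > 1\<close> the coefficient \<open>ennreal (1 - r)\<close> of the atom at the origin is zero.\<close>

definition free_poisson_law :: "real \<Rightarrow> real measure" where
  "free_poisson_law r = measure_of UNIV (sets borel)
     (\<lambda>A. ennreal (1 - r) * indicator A 0 +
        emeasure (density lborel
          (\<lambda>x. ennreal (indicator {(1 - sqrt r)\<^sup>2 .. (1 + sqrt r)\<^sup>2} x
                          * sqrt (4 * r - (x - 1 - r)\<^sup>2) / (2 * pi * x)))) A)"

section \<open>Free Brownian motion and the free Poisson process\<close>

definition von_neumann_filtration ::
    "('h::complex_hilbert_space \<Rightarrow>\<^sub>L 'h) set \<Rightarrow> (real \<Rightarrow> ('h \<Rightarrow>\<^sub>L 'h) set) \<Rightarrow> bool" where
  "von_neumann_filtration M \<F> \<longleftrightarrow>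
     (\<forall>t\<ge>0. von_neumann_algebra (\<F> t) \<and> \<F> t \<subseteq> M) \<and>
     (\<forall>u t. 0 \<le> u \<and> u \<le> t \<longrightarrow> \<F> u \<subseteq> \<F> t)"

definition free_brownian_motion ::
    "(('h::complex_hilbert_space \<Rightarrow>\<^sub>L 'h) \<Rightarrow> complex) \<Rightarrow> (real \<Rightarrow> ('h \<Rightarrow>\<^sub>L 'h) set) \<Rightarrow>
     (real \<Rightarrow> ('h \<Rightarrow>\<^sub>L 'h)) \<Rightarrow> bool" where
  "free_brownian_motion \<phi> \<F> S \<longleftrightarrow>
     (\<forall>t\<ge>0. S t \<in> \<F> t \<and> is_adjoint (S t) (S t)) \<and>
     S 0 = 0 \<and>
     (\<forall>u t. 0 \<le> u \<and> u < t \<longrightarrow>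
        free_from \<phi> (S t - S u) (\<F> u) \<and> has_law \<phi> (S t - S u) (semicircular_law (t - u)))"

definition free_poisson_process ::
    "(('h::complex_hilbert_space \<Rightarrow>\<^sub>L 'h) \<Rightarrow> complex) \<Rightarrow> (real \<Rightarrow> ('h \<Rightarrow>\<^sub>L 'h) set) \<Rightarrow>
     (real \<Rightarrow> ('h \<Rightarrow>\<^sub>L 'h)) \<Rightarrow> bool" where
  "free_poisson_process \<phi> \<F> N \<longleftrightarrow>
     (\<forall>t\<ge>0. N t \<in> \<F> t \<and> (\<forall>x. cinner (blinfun_apply (N t) x) x \<in> \<real>\<^sub>\<ge>\<^sub>0)) \<and>
     N 0 = 0 \<and>
     (\<forall>u t. 0 \<le> u \<and> u < t \<longrightarrow>
        free_from \<phi> (N t - N u) (\<F> u) \<and> has_law \<phi> (N t - N u) (free_poisson_law (t - u)))"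

datatype free_process = Free_Brownian | Compensated_Free_Poisson

definition driving_process ::
    "free_process \<Rightarrow> (('h::complex_hilbert_space \<Rightarrow>\<^sub>L 'h) \<Rightarrow> complex) \<Rightarrow>
     (real \<Rightarrow> ('h \<Rightarrow>\<^sub>L 'h) set) \<Rightarrow> (real \<Rightarrow> ('h \<Rightarrow>\<^sub>L 'h)) \<Rightarrow> bool" where
  "driving_process K \<phi> \<F> Z \<longleftrightarrow>
     (case K of
        Free_Brownian \<Rightarrow> free_brownian_motion \<phi> \<F> Z
      | Compensated_Free_Poisson \<Rightarrow>
          \<exists>N. free_poisson_process \<phi> \<F> N \<and> (\<forall>t\<ge>0. Z t = N t - t *\<^sub>R id_blinfun))"

section \<open>The space \<open>L\<^sup>2\<close> of a tracial W*-probability space\<close>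

text \<open>The completion of \<open>M\<close> for \<open>\<parallel>X\<parallel>\<^sub>2 = sqrt (\<phi> (X X*))\<close>: a Hilbert space \<open>'l\<close> together with
  a linear isometric embedding \<open>\<iota>\<close> of \<open>M\<close> with dense range. It is unique up to a unique
  isomorphism.\<close>

definition L2_completion ::
    "('h::complex_hilbert_space \<Rightarrow>\<^sub>L 'h) set \<Rightarrow> (('h \<Rightarrow>\<^sub>L 'h) \<Rightarrow> complex) \<Rightarrow>
     (('h \<Rightarrow>\<^sub>L 'h) \<Rightarrow> 'l::complex_hilbert_space) \<Rightarrow> bool" where
  "L2_completion M \<phi> \<iota> \<longleftrightarrow>
     (\<forall>T\<in>M. \<forall>U\<in>M. \<iota> (T + U) = \<iota> T + \<iota> U) \<and>
     (\<forall>c. \<forall>T\<in>M. \<iota> (scaleC_op c o\<^sub>L T) = c *\<^sub>C \<iota> T) \<and>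
     (\<forall>T\<in>M. \<forall>U\<in>M. cinner (\<iota> T) (\<iota> U) = \<phi> (T o\<^sub>L adj U)) \<and>
     closure (\<iota> ` M) = UNIV"

text \<open>The continuous extension of \<open>\<phi>\<close>, using \<open>\<phi> X = \<langle>X, 1\<rangle>\<close>.\<close>

definition L2_state ::
    "(('h::complex_hilbert_space \<Rightarrow>\<^sub>L 'h) \<Rightarrow> 'l::complex_hilbert_space) \<Rightarrow> 'l \<Rightarrow> complex" where
  "L2_state \<iota> \<xi> = cinner \<xi> (\<iota> id_blinfun)"

text \<open>The continuous extension of the involution of \<open>M\<close>.\<close>

definition L2_star ::
    "('h::complex_hilbert_space \<Rightarrow>\<^sub>L 'h) set \<Rightarrow>
     (('h \<Rightarrow>\<^sub>L 'h) \<Rightarrow> 'l::complex_hilbert_space) \<Rightarrow> 'l \<Rightarrow> 'l" where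
  "L2_star M \<iota> \<xi> = (THE \<eta>. \<forall>x. (\<forall>k. x k \<in> M) \<and> (\<lambda>k. \<iota> (x k)) \<longlonglongrightarrow> \<xi>
                          \<longrightarrow> (\<lambda>k. \<iota> (adj (x k))) \<longlonglongrightarrow> \<eta>)"

text \<open>Multiplication extends from \<open>M\<close> to a continuous map \<open>L\<^sup>2 \<times> L\<^sup>2 \<rightarrow> L\<^sup>1\<close>, so that for
  \<open>x\<^sub>k \<rightarrow> \<xi>\<close>, \<open>y\<^sub>k \<rightarrow> \<eta>\<close> in \<open>L\<^sup>2\<close> and \<open>a\<close> in \<open>M\<close> the numbers
  \<open>\<phi> (x\<^sub>k y\<^sub>k a*) = \<langle>x\<^sub>k y\<^sub>k, a\<rangle>\<close> converge to the pairing of \<open>\<xi> \<eta>\<close> with \<open>a*\<close>. The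
  relation below says that the product \<open>\<xi> \<eta>\<close> lies in \<open>L\<^sup>2\<close> and equals \<open>\<zeta>\<close>; such a \<open>\<zeta>\<close> is
  unique but need not exist, and \<open>L2_mult\<close> is meaningful only where it does.\<close>

definition L2_product ::
    "('h::complex_hilbert_space \<Rightarrow>\<^sub>L 'h) set \<Rightarrow>
     (('h \<Rightarrow>\<^sub>L 'h) \<Rightarrow> 'l::complex_hilbert_space) \<Rightarrow> 'l \<Rightarrow> 'l \<Rightarrow> 'l \<Rightarrow> bool" where
  "L2_product M \<iota> \<xi> \<eta> \<zeta> \<longleftrightarrow>
     (\<forall>x y. (\<forall>k. x k \<in> M) \<and> (\<forall>k. y k \<in> M) \<and>
            (\<lambda>k. \<iota> (x k)) \<longlonglongrightarrow> \<xi> \<and> (\<lambda>k. \<iota> (y k)) \<longlonglongrightarrow> \<eta> \<longrightarrow>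
        (\<forall>a\<in>M. (\<lambda>k. cinner (\<iota> (x k o\<^sub>L y k)) (\<iota> a)) \<longlonglongrightarrow> cinner \<zeta> (\<iota> a)))"

definition L2_mult ::
    "('h::complex_hilbert_space \<Rightarrow>\<^sub>L 'h) set \<Rightarrow>
     (('h \<Rightarrow>\<^sub>L 'h) \<Rightarrow> 'l::complex_hilbert_space) \<Rightarrow> 'l \<Rightarrow> 'l \<Rightarrow> 'l" where
  "L2_mult M \<iota> \<xi> \<eta> = (THE \<zeta>. L2_product M \<iota> \<xi> \<eta> \<zeta>)"

primrec L2_pow ::
    "('h::complex_hilbert_space \<Rightarrow>\<^sub>L 'h) set \<Rightarrow>
     (('h \<Rightarrow>\<^sub>L 'h) \<Rightarrow> 'l::complex_hilbert_space) \<Rightarrow> 'l \<Rightarrow> nat \<Rightarrow> 'l" where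
  "L2_pow M \<iota> \<xi> 0 = \<iota> id_blinfun"
| "L2_pow M \<iota> \<xi> (Suc k) = L2_mult M \<iota> \<xi> (L2_pow M \<iota> \<xi> k)"

definition L2_poly ::
    "('h::complex_hilbert_space \<Rightarrow>\<^sub>L 'h) set \<Rightarrow>
     (('h \<Rightarrow>\<^sub>L 'h) \<Rightarrow> 'l::complex_hilbert_space) \<Rightarrow> complex poly \<Rightarrow> 'l \<Rightarrow> 'l" where
  "L2_poly M \<iota> P \<xi> = (\<Sum>k\<le>degree P. coeff P k *\<^sub>C L2_pow M \<iota> \<xi> k)"

definition L2_centered_poly ::
    "('h::complex_hilbert_space \<Rightarrow>\<^sub>L 'h) set \<Rightarrow>
     (('h \<Rightarrow>\<^sub>L 'h) \<Rightarrow> 'l::complex_hilbert_space) \<Rightarrow> complex poly \<Rightarrow> 'l \<Rightarrow> 'l" where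
  "L2_centered_poly M \<iota> P \<xi> =
     L2_poly M \<iota> P \<xi> - L2_state \<iota> (L2_poly M \<iota> P \<xi>) *\<^sub>C \<iota> id_blinfun"

text \<open>Freeness of a finite family \<open>X\<^sub>0, \<dots>, X\<^sub>d\<^sub>-\<^sub>1\<close>, given as a list.\<close>

definition L2_free ::
    "('h::complex_hilbert_space \<Rightarrow>\<^sub>L 'h) set \<Rightarrow>
     (('h \<Rightarrow>\<^sub>L 'h) \<Rightarrow> 'l::complex_hilbert_space) \<Rightarrow> 'l list \<Rightarrow> bool" where
  "L2_free M \<iota> Xs \<longleftrightarrow>
     (\<forall>ps :: (complex poly \<times> nat) list.
        ps \<noteq> [] \<and> (\<forall>(P, i) \<in> set ps. i < length Xs) \<and> distinct_adj (map snd ps) \<longrightarrow>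
        L2_state \<iota>
          (foldr (L2_mult M \<iota>) (map (\<lambda>(P, i). L2_centered_poly M \<iota> P (Xs ! i)) ps)
             (\<iota> id_blinfun)) = 0)"

definition L2_cov ::
    "('h::complex_hilbert_space \<Rightarrow>\<^sub>L 'h) set \<Rightarrow>
     (('h \<Rightarrow>\<^sub>L 'h) \<Rightarrow> 'l::complex_hilbert_space) \<Rightarrow> 'l \<Rightarrow> 'l \<Rightarrow> complex" where
  "L2_cov M \<iota> X Y = L2_state \<iota> (L2_mult M \<iota> X Y) - L2_state \<iota> X * L2_state \<iota> Y"

section \<open>Square-integrable kernels and their contractions\<close>

text \<open>A point of \<open>\<real>\<^sub>+\<^sup>n\<close> is an extensional function on \<open>{..<n}\<close>, so the coordinates
  \<open>t\<^sub>1, \<dots>, t\<^sub>n\<close> are \<open>t 0, \<dots>, t (n - 1)\<close>. For \<open>n = 0\<close> there is a single point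
  \<open>\<lambda>_. undefined\<close>, of mass 1. Kernels are representatives of classes modulo null sets.\<close>

type_synonym kernel = "(nat \<Rightarrow> real) \<Rightarrow> complex"

definition orthant :: "nat \<Rightarrow> (nat \<Rightarrow> real) measure" where
  "orthant n = (\<Pi>\<^sub>M i\<in>{..<n}. restrict_space lborel {0..})"

definition L2_kernels :: "nat \<Rightarrow> kernel set" where
  "L2_kernels n = {f \<in> borel_measurable (orthant n). integrable (orthant n) (\<lambda>t. (cmod (f t))\<^sup>2)}"

definition kernel_inner :: "nat \<Rightarrow> kernel \<Rightarrow> kernel \<Rightarrow> complex" where
  "kernel_inner n f g = (LINT t|orthant n. f t * cnj (g t))"

definition kernel_adj :: "nat \<Rightarrow> kernel \<Rightarrow> kernel" where
  "kernel_adj n f = (\<lambda>t. cnj (f (\<lambda>i\<in>{..<n}. t (n - 1 - i))))"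

definition symmetric_kernel :: "nat \<Rightarrow> kernel \<Rightarrow> bool" where
  "symmetric_kernel n f \<longleftrightarrow>
     (AE t in orthant n. f t \<in> \<real>) \<and>
     (\<forall>\<sigma>. \<sigma> permutes {..<n} \<longrightarrow> (AE t in orthant n. f t = f (\<lambda>i\<in>{..<n}. t (\<sigma> i))))"

definition contraction :: "nat \<Rightarrow> nat \<Rightarrow> nat \<Rightarrow> kernel \<Rightarrow> kernel \<Rightarrow> kernel" where
  "contraction n m p f g = (\<lambda>t. LINT s|orthant p.
     f (\<lambda>i\<in>{..<n}. if i < n - p then t i else s (i - (n - p))) *
     g (\<lambda>i\<in>{..<m}. if i < p then s (p - 1 - i) else t (n - p + (i - p))))"

text \<open>The contraction of \<open>p - 1\<close> variables in which one further variable, \<open>t\<^sub>n\<^sub>-\<^sub>p\<^sub>+\<^sub>1\<close>, is shared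
  by both kernels without being integrated. It need not be square-integrable.\<close>

definition star_contraction :: "nat \<Rightarrow> nat \<Rightarrow> nat \<Rightarrow> kernel \<Rightarrow> kernel \<Rightarrow> kernel" where
  "star_contraction n m p f g = (\<lambda>t. LINT s|orthant (p - 1).
     f (\<lambda>i\<in>{..<n}. if i < n - p + 1 then t i else s (p - 2 - (i - (n - p + 1)))) *
     g (\<lambda>i\<in>{..<m}. if i < p - 1 then s i else t (n - p + (i - (p - 1)))))"

text \<open>All kernels, with their arities, obtained from those in \<open>F\<close> by iterated contractions.\<close>

inductive_set generated_kernels :: "(nat \<times> kernel) set \<Rightarrow> (nat \<times> kernel) set"
  for F :: "(nat \<times> kernel) set" where
  base: "(n, f) \<in> F \<Longrightarrow> (n, f) \<in> generated_kernels F"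
| contraction: "\<lbrakk>(n, f) \<in> generated_kernels F; (m, g) \<in> generated_kernels F; p \<le> min n m\<rbrakk>
    \<Longrightarrow> (n + m - 2 * p, contraction n m p f g) \<in> generated_kernels F"
| star_contraction:
    "\<lbrakk>(n, f) \<in> generated_kernels F; (m, g) \<in> generated_kernels F; 1 \<le> p; p \<le> min n m\<rbrakk>
    \<Longrightarrow> (n + m - 2 * p + 1, star_contraction n m p f g) \<in> generated_kernels F"

section \<open>Multiple integrals\<close>

definition multiple_integrals ::
    "('h::complex_hilbert_space \<Rightarrow>\<^sub>L 'h) set \<Rightarrow> (('h \<Rightarrow>\<^sub>L 'h) \<Rightarrow> 'l::complex_hilbert_space) \<Rightarrow>
     (real \<Rightarrow> ('h \<Rightarrow>\<^sub>L 'h)) \<Rightarrow> (nat \<Rightarrow> kernel \<Rightarrow> 'l) \<Rightarrow> bool" where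
  "multiple_integrals M \<iota> Z I \<longleftrightarrow>
     (\<forall>n. \<forall>f\<in>L2_kernels n. \<forall>g\<in>L2_kernels n. I n (\<lambda>t. f t + g t) = I n f + I n g) \<and>
     (\<forall>n c. \<forall>f\<in>L2_kernels n. I n (\<lambda>t. c * f t) = c *\<^sub>C I n f) \<and>
     (\<forall>n a b. (\<forall>i<n. 0 \<le> a i \<and> a i \<le> b i) \<and>
              pairwise (\<lambda>i j. {a i..b i} \<inter> {a j..b j} = {}) {..<n} \<longrightarrow>
        I n (indicator {t. \<forall>i<n. t i \<in> {a i..b i}})
          = \<iota> (op_prod (map (\<lambda>i. Z (b i) - Z (a i)) [0..<n]))) \<and>
     (\<forall>n. \<forall>f\<in>L2_kernels n. \<forall>g\<in>L2_kernels n. cinner (I n f) (I n g) = kernel_inner n f g) \<and>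
     (\<forall>f\<in>L2_kernels 0. I 0 f = f (\<lambda>_. undefined) *\<^sub>C \<iota> id_blinfun) \<and>
     (\<forall>n m. \<forall>f\<in>L2_kernels n. \<forall>g\<in>L2_kernels m. n \<noteq> m \<longrightarrow> cinner (I n f) (I m g) = 0) \<and>
     (\<forall>n. \<forall>f\<in>L2_kernels n. L2_star M \<iota> (I n f) = I n (kernel_adj n f))"

text \<open>In the Poisson case the formula is required for those pairs of kernels for which its
  right-hand side is defined. The contractions \<open>contraction n m p f g\<close> are always
  square-integrable by the Cauchy-Schwarz inequality.\<close>

definition product_formula ::
    "free_process \<Rightarrow> ('h::complex_hilbert_space \<Rightarrow>\<^sub>L 'h) set \<Rightarrow>
     (('h \<Rightarrow>\<^sub>L 'h) \<Rightarrow> 'l::complex_hilbert_space) \<Rightarrow> (nat \<Rightarrow> kernel \<Rightarrow> 'l) \<Rightarrow> bool" where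
  "product_formula K M \<iota> I \<longleftrightarrow>
     (\<forall>n m. \<forall>f\<in>L2_kernels n. \<forall>g\<in>L2_kernels m.
        (case K of
           Free_Brownian \<Rightarrow>
             L2_product M \<iota> (I n f) (I m g)
               (\<Sum>p\<le>min n m. I (n + m - 2 * p) (contraction n m p f g))
         | Compensated_Free_Poisson \<Rightarrow>
             (\<forall>p\<in>{1..min n m}. star_contraction n m p f g \<in> L2_kernels (n + m - 2 * p + 1)) \<longrightarrow>
             L2_product M \<iota> (I n f) (I m g)
               ((\<Sum>p\<le>min n m. I (n + m - 2 * p) (contraction n m p f g)) +
                (\<Sum>p=1..min n m. I (n + m - 2 * p + 1) (star_contraction n m p f g)))))"

end

theory Submission
  imports Defs
begin

text \<open>
  Write \<open>F = I n f\<close> and \<open>G = I m g\<close>. The product formula expands \<open>F\<^sup>2\<close> and \<open>G\<^sup>2\<close> into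
  multiple integrals with exactly one kernel \<open>\<phi>\<^sub>j\<close>, respectively \<open>\<gamma>\<^sub>j\<close>, in each order \<open>j\<close>: the
  contraction of \<open>f\<close> with itself that leaves \<open>j\<close> variables. (Odd orders come from the star
  contractions and occur only in the Poisson case.) Since different orders are orthogonal, the state
  of \<open>F\<^sup>2 G\<^sup>2\<close> is the sum over \<open>j\<close> of the pairings of \<open>\<phi>\<^sub>j\<close> with the reversal of \<open>\<gamma>\<^sub>j\<close>. Such a
  pairing is an integral of a product of four kernels, two copies of \<open>f\<close> and two of \<open>g\<close>, arranged in
  a cycle. Integrating first over the variables that an \<open>f\<close> shares with a \<open>g\<close>, instead of those that
  the two \<open>f\<close> share, turns it into the squared norm of a contraction of \<open>f\<close> with \<open>g\<close>, because \<open>f\<close>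
  and \<open>g\<close> are symmetric and real (lemma \<open>contraction_square_pairing\<close>). The order \<open>0\<close> contributes the
  product of the states, so the covariance of the squares is the sum of the squared norms of all
  contractions of \<open>f\<close> with \<open>g\<close> in which at least one variable meets (lemma
  \<open>covariance_of_squares\<close>). It vanishes if and only if all these contractions vanish.

  If \<open>F\<close> and \<open>G\<close> are free, the word made of the centred squares shows that the covariance is zero.

  Conversely let all contractions vanish. Powers of \<open>F\<close> are linear combinations of integrals of
  kernels built from \<open>f\<close> by contractions, and centring removes the terms of order \<open>0\<close>. The point is
  that in the product of such an integral with a word that starts with \<open>G\<close> only the tensor product
  survives. Then, by induction on its length, every alternating centred word is a combination of
  integrals of positive order, whose state is \<open>0\<close> (lemma \<open>free_of_annihilating\<close>). So one has to
  propagate the vanishing of contractions from the pair \<open>f\<close>, \<open>g\<close> to the kernels generated by \<open>f\<close>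
  and by \<open>g\<close>, and to tensor products of the latter with arbitrary kernels.

  \<^item> For the free Brownian motion the property that propagates is \<open>separated\<close>: integrating out any
    nonempty set of shared variables gives zero, wherever these variables sit in the two kernels. If
    one kernel is itself a contraction, some of the shared variables belong to one of its two factors,
    and integrating over these first already gives zero (lemma \<open>contraction_step\<close>). It would not be
    enough to ask for this with a single shared variable: integrating out two of them needs the
    statement for one on a diagonal, which is a null set.
  \<^item> For the free Poisson process the vanishing of the star contraction that multiplies \<open>f\<close> and \<open>g\<close>
    along one shared variable says that \<open>f\<close> and \<open>g\<close> live on disjoint sets: for some \<open>E\<close>, \<open>f\<close> vanishes
    as soon as one of its variables is outside \<open>E\<close>, and \<open>g\<close> as soon as one is inside (lemma
    \<open>disjoint_supports\<close>). Both kinds of contraction preserve this.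

  All computations take place at the level of kernels; they are transferred to \<open>L\<^sup>2\<close> elements, whose
  product is only partially defined, by the uniqueness and the bilinearity of that product.
\<close>

section \<open>Product measures with labelled coordinates\<close>

text \<open>Several kernels with shared, free and integrated variables are handled by giving every variable
  a label. A configuration of all variables is then a point of a product over a finite set of labels,
  of which the orthants are the special case of the labels \<open>0, \<dots>, n - 1\<close>.\<close>

abbreviation half_line :: "real measure" where
  "half_line \<equiv> restrict_space lborel {0..}"

abbreviation coords :: "nat set \<Rightarrow> (nat \<Rightarrow> real) measure" where
  "coords J \<equiv> PiM J (\<lambda>_. half_line)"

lemma orthant_eq_coords: "orthant n = coords {..<n}"
  by (simp add: orthant_def)

lemma sigma_finite_half_line: "sigma_finite_measure half_line"
  by (rule sigma_finite_measure_restrict_space) (auto simp: sigma_finite_lborel)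

interpretation coords: product_sigma_finite "\<lambda>_::nat. half_line"
  by unfold_locales (rule sigma_finite_measure.sigma_finite_countable[OF sigma_finite_half_line])

lemma sigma_finite_coords: "finite J \<Longrightarrow> sigma_finite_measure (coords J)"
  by (rule coords.sigma_finite)

text \<open>The substitution that plugs the variable with label \<open>e i\<close> into the \<open>i\<close>-th argument.\<close>

definition pick :: "nat set \<Rightarrow> (nat \<Rightarrow> nat) \<Rightarrow> (nat \<Rightarrow> real) \<Rightarrow> nat \<Rightarrow> real" where
  "pick I e z = (\<lambda>i\<in>I. z (e i))"

lemma measurable_pick [measurable]: "e ` I \<subseteq> K \<Longrightarrow> pick I e \<in> coords K \<rightarrow>\<^sub>M coords I"
  unfolding pick_def by (rule measurable_restrict) (auto intro!: measurable_component_singleton)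

lemma space_coords: "z \<in> space (coords J) \<longleftrightarrow> z \<in> extensional J \<and> (\<forall>i\<in>J. 0 \<le> z i)"
  by (auto simp: space_PiM PiE_iff space_restrict_space)

lemma pick_id: "z \<in> space (coords J) \<Longrightarrow> (\<And>i. i \<in> J \<Longrightarrow> e i = i) \<Longrightarrow> pick J e z = z"
  by (auto simp: pick_def space_coords extensional_def fun_eq_iff)

lemma distr_pick:
  assumes "finite I" "bij_betw e I J"
  shows "distr (coords J) (coords I) (pick I e) = coords I"
proof (rule coords.PiM_eqI)
  have J: "finite J" using assms bij_betw_finite by blast
  have im: "e ` I = J" using assms by (simp add: bij_betw_def)
  define d where "d = the_inv_into I e"
  have d: "d (e i) = i" if "i \<in> I" for i
    using assms that by (simp add: d_def bij_betw_def the_inv_into_f_f)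
  have m: "pick I e \<in> coords J \<rightarrow>\<^sub>M coords I" by (rule measurable_pick) (simp add: im)
  fix A assume A: "\<And>i. i \<in> I \<Longrightarrow> A i \<in> sets half_line"
  have "pick I e -` Pi\<^sub>E I A \<inter> space (coords J) = Pi\<^sub>E J (\<lambda>j. A (d j))"
  proof (intro set_eqI iffI)
    fix z assume z: "z \<in> pick I e -` Pi\<^sub>E I A \<inter> space (coords J)"
    show "z \<in> Pi\<^sub>E J (\<lambda>j. A (d j))"
    proof (rule PiE_I)
      fix j assume "j \<in> J"
      then obtain i where i: "i \<in> I" "j = e i" using im by auto
      have "pick I e z i \<in> A i" using z i by auto
      then show "z j \<in> A (d j)" using i d by (simp add: pick_def)
    next
      fix j assume "j \<notin> J" then show "z j = undefined" using z by (simp add: space_coords extensional_def)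
    qed
  next
    fix z assume z: "z \<in> Pi\<^sub>E J (\<lambda>j. A (d j))"
    have "pick I e z \<in> Pi\<^sub>E I A"
    proof (rule PiE_I)
      fix i assume i: "i \<in> I"
      have "z (e i) \<in> A (d (e i))" using z i im by blast
      then show "pick I e z i \<in> A i" using i d by (simp add: pick_def)
    qed (simp add: pick_def)
    moreover have "z \<in> space (coords J)"
    proof -
      have "z j \<in> space half_line" if jJ: "j \<in> J" for j
      proof -
        obtain i where i: "i \<in> I" "j = e i" using im jJ by auto
        have "z j \<in> A (d j)" using z jJ by blast
        then show ?thesis using A[OF i(1), THEN sets.sets_into_space] i d by auto
      qed
      then show ?thesis using z by (auto simp: space_PiM PiE_iff)
    qed
    ultimately show "z \<in> pick I e -` Pi\<^sub>E I A \<inter> space (coords J)" by simp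
  qed
  then have "emeasure (distr (coords J) (coords I) (pick I e)) (Pi\<^sub>E I A) = emeasure (coords J) (Pi\<^sub>E J (\<lambda>j. A (d j)))"
    using A assms by (subst emeasure_distr[OF m]) (auto intro!: sets_PiM_I_finite)
  also have "\<dots> = (\<Prod>j\<in>J. emeasure half_line (A (d j)))"
  proof (rule coords.emeasure_PiM[OF J])
    fix j assume "j \<in> J"
    then obtain i where "i \<in> I" "j = e i" using im by auto
    then show "A (d j) \<in> sets half_line" using A d by simp
  qed
  also have "\<dots> = (\<Prod>i\<in>I. emeasure half_line (A i))"
    by (rule prod.reindex_bij_betw[OF assms(2), symmetric, THEN trans]) (simp add: d)
  finally show "emeasure (distr (coords J) (coords I) (pick I e)) (Pi\<^sub>E I A) = (\<Prod>i\<in>I. emeasure half_line (A i))" .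
qed (use assms in auto)

lemma nn_integral_pick:
  assumes "finite I" "bij_betw e I J" "F \<in> borel_measurable (coords I)"
  shows "(\<integral>\<^sup>+z. F (pick I e z) \<partial>coords J) = (\<integral>\<^sup>+t. F t \<partial>coords I)"
  using assms nn_integral_distr[of "pick I e" "coords J" "coords I" F]
  by (simp add: distr_pick measurable_pick bij_betw_def)

lemma integral_pick:
  fixes F :: "_ \<Rightarrow> complex"
  assumes "finite I" "bij_betw e I J" "F \<in> borel_measurable (coords I)"
  shows "(LINT z|coords J. F (pick I e z)) = (LINT t|coords I. F t)"
  using assms integral_distr[of "pick I e" "coords J" "coords I" F]
  by (simp add: distr_pick measurable_pick bij_betw_def)

lemma merge_in_space: "z \<in> space (coords A) \<Longrightarrow> s \<in> space (coords S) \<Longrightarrow> merge A S (z, s) \<in> space (coords (A \<union> S))"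
  by (rule measurable_space[OF measurable_merge]) (auto simp: space_pair_measure)

lemma AE_merge:
  assumes "finite A" "finite S" "A \<inter> S = {}" "AE u in coords (A \<union> S). Pr u"
  shows "AE z in coords A. AE s in coords S. Pr (merge A S (z, s))"
proof -
  interpret A: sigma_finite_measure "coords A" by (rule sigma_finite_coords) fact
  interpret S: sigma_finite_measure "coords S" by (rule sigma_finite_coords) fact
  interpret AS: pair_sigma_finite "coords A" "coords S" ..
  have "AE u in distr (coords A \<Otimes>\<^sub>M coords S) (coords (A \<union> S)) (merge A S). Pr u"
    unfolding coords.distr_merge[OF assms(3,1,2)] by (rule assms(4))
  then have "AE p in coords A \<Otimes>\<^sub>M coords S. Pr (merge A S p)"
    by (rule AE_distrD[rotated]) simp
  then show ?thesis by (rule AS.AE_pair)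
qed

text \<open>Plugging variables with distinct labels into a null set gives a null set: up to renaming, its
  preimage is the product of that null set with the remaining coordinates. Injectivity matters, as
  the diagonal of a product is null. This moves almost everywhere statements about arbitrary predicates
  between the spaces.\<close>

lemma AE_pick:
  assumes "finite K" "inj_on e I" "e ` I \<subseteq> K" "AE t in coords I. Pr t"
  shows "AE z in coords K. Pr (pick I e z)"
proof -
  have I: "finite I" using assms by (meson finite_imageD finite_subset)
  define J where "J = e ` I"
  define J' where "J' = K - J"
  have K: "K = J \<union> J'" "J \<inter> J' = {}" "finite J" "finite J'"
    using assms I by (auto simp: J_def J'_def)
  have bij: "bij_betw e I J" using assms by (simp add: J_def bij_betw_def)
  interpret J: sigma_finite_measure "coords J" by (rule sigma_finite_coords) fact
  interpret J': sigma_finite_measure "coords J'" by (rule sigma_finite_coords) fact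
  have "AE t in distr (coords J) (coords I) (pick I e). Pr t"
    unfolding distr_pick[OF I bij] by (rule assms(4))
  then have "AE z in coords J. Pr (pick I e z)"
    by (rule AE_distrD[rotated]) (simp add: measurable_pick J_def)
  from AE_E[OF this] obtain N where N: "{z \<in> space (coords J). \<not> Pr (pick I e z)} \<subseteq> N" "N \<in> null_sets (coords J)"
    by (metis (no_types) null_setsI)
  have "(\<lambda>z. restrict z J) -` N \<inter> space (coords K) \<in> null_sets (coords K)"
  proof -
    have ms: "(\<lambda>z. restrict z J) \<in> coords K \<rightarrow>\<^sub>M coords J"
      by (rule measurable_restrict_subset) (auto simp: K)
    have [measurable]: "N \<in> sets (coords J)" using N by auto
    have "emeasure (coords K) ((\<lambda>z. restrict z J) -` N \<inter> space (coords K))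
        = emeasure (distr (coords J \<Otimes>\<^sub>M coords J') (coords K) (merge J J')) ((\<lambda>z. restrict z J) -` N \<inter> space (coords K))"
      using K by (simp add: coords.distr_merge)
    also have "\<dots> = emeasure (coords J \<Otimes>\<^sub>M coords J') (merge J J' -` ((\<lambda>z. restrict z J) -` N \<inter> space (coords K)) \<inter> space (coords J \<Otimes>\<^sub>M coords J'))"
      by (rule emeasure_distr) (use ms in \<open>auto simp: K(1)\<close>)
    also have "merge J J' -` ((\<lambda>z. restrict z J) -` N \<inter> space (coords K)) \<inter> space (coords J \<Otimes>\<^sub>M coords J') = N \<times> space (coords J')"
    proof -
      have "N \<subseteq> space (coords J)" using N(2) sets.sets_into_space by blast
      moreover have "restrict (merge J J' (x, y)) J = x" if "x \<in> space (coords J)" for x y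
        using K that by (auto simp: space_coords extensional_restrict)
      ultimately show ?thesis
        by (auto simp: space_pair_measure K(1) simp del: space_PiM dest: subsetD intro!: merge_in_space)
    qed
    also have "emeasure (coords J \<Otimes>\<^sub>M coords J') (N \<times> space (coords J')) = 0"
      using N by (subst J'.emeasure_pair_measure_Times) auto
    finally show ?thesis by (rule null_setsI) (rule measurable_sets[OF ms], measurable)
  qed
  moreover have "{z \<in> space (coords K). \<not> Pr (pick I e z)} \<subseteq> (\<lambda>z. restrict z J) -` N \<inter> space (coords K)"
  proof safe
    fix z assume z: "z \<in> space (coords K)" "\<not> Pr (pick I e z)"
    have "pick I e (restrict z J) = pick I e z" by (auto simp: pick_def J_def fun_eq_iff)
    moreover have "restrict z J \<in> space (coords J)" using z K by (auto simp: space_coords)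
    ultimately show "z \<in> (\<lambda>z. restrict z J) -` N" using z N(1) by auto
  qed
  ultimately show ?thesis by (rule AE_I')
qed

lemma pick_cong: "(\<And>i. i \<in> I \<Longrightarrow> z (e i) = z' (e' i)) \<Longrightarrow> pick I e z = pick I e' z'"
  by (auto simp: pick_def fun_eq_iff)

lemma measurable_merge2 [measurable]: "z \<in> space (coords A) \<Longrightarrow> (\<lambda>s. merge A S (z, s)) \<in> coords S \<rightarrow>\<^sub>M coords (A \<union> S)"
  by (rule measurable_compose[OF measurable_Pair1' measurable_merge])

text \<open>The integral over \<open>S\<close> depends only on those variables in \<open>A\<close> that occur in \<open>F\<close>. On these Tonelli's
  theorem applies; over all of \<open>A\<close>, which may have further coordinates of infinite measure, the
  integral of \<open>F\<close> need not be finite.\<close>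

lemma AE_slice_finite:
  fixes F :: "_ \<Rightarrow> ennreal"
  assumes fin: "finite A" "finite S" "A \<inter> S = {}"
    and e: "inj_on e I" "e ` I \<subseteq> A \<union> S" "S \<subseteq> e ` I" "finite I"
    and F: "F \<in> borel_measurable (coords I)" "(\<integral>\<^sup>+t. F t \<partial>coords I) < \<infinity>"
  shows "AE z in coords A. (\<integral>\<^sup>+s. F (pick I e (merge A S (z, s))) \<partial>coords S) < \<infinity>"
proof -
  define B where "B = e ` I \<inter> A"
  have B: "e ` I = B \<union> S" "B \<inter> S = {}" "finite B" "B \<subseteq> A" using fin e by (auto simp: B_def)
  have m: "pick I e \<in> coords (B \<union> S) \<rightarrow>\<^sub>M coords I" by (rule measurable_pick) (use B in auto)
  have Fm [measurable]: "(\<lambda>u. F (pick I e u)) \<in> borel_measurable (coords (B \<union> S))"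
    by (rule measurable_compose[OF m F(1)])
  interpret S: sigma_finite_measure "coords S" by (rule sigma_finite_coords) fact
  have "(\<integral>\<^sup>+t. F t \<partial>coords I) = (\<integral>\<^sup>+u. F (pick I e u) \<partial>coords (B \<union> S))"
    using e B F by (intro nn_integral_pick[symmetric]) (auto simp: bij_betw_def)
  also have "\<dots> = (\<integral>\<^sup>+z. \<integral>\<^sup>+s. F (pick I e (merge B S (z, s))) \<partial>coords S \<partial>coords B)"
    using fin B by (subst coords.product_nn_integral_fold) auto
  finally have "AE z in coords B. (\<integral>\<^sup>+s. F (pick I e (merge B S (z, s))) \<partial>coords S) \<noteq> \<infinity>"
    using F by (intro nn_integral_PInf_AE) auto
  then have "AE z in coords A. (\<integral>\<^sup>+s. F (pick I e (merge B S (pick B id z, s))) \<partial>coords S) \<noteq> \<infinity>"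
    using fin B by (intro AE_pick[where Pr = "\<lambda>z. (\<integral>\<^sup>+s. F (pick I e (merge B S (z, s))) \<partial>coords S) \<noteq> \<infinity>"]) auto
  moreover have "pick I e (merge B S (pick B id z, s)) = pick I e (merge A S (z, s))" for z s
    using B fin by (intro pick_cong) (auto simp: merge_def pick_def)
  ultimately show ?thesis by (simp add: less_top)
qed

section \<open>Cauchy-Schwarz bounds for contractions\<close>

lemma Cauchy_Schwarz_contraction:
  fixes b c :: "_ \<Rightarrow> ennreal"
  assumes "sigma_finite_measure M1" "sigma_finite_measure M2" "sigma_finite_measure M3"
    and [measurable]: "b \<in> borel_measurable (M1 \<Otimes>\<^sub>M M3)" "c \<in> borel_measurable (M2 \<Otimes>\<^sub>M M3)"
  shows "(\<integral>\<^sup>+x. \<integral>\<^sup>+y. (\<integral>\<^sup>+w. b (x, w) * c (y, w) \<partial>M3)\<^sup>2 \<partial>M2 \<partial>M1)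
    \<le> (\<integral>\<^sup>+x. \<integral>\<^sup>+w. (b (x, w))\<^sup>2 \<partial>M3 \<partial>M1) * (\<integral>\<^sup>+y. \<integral>\<^sup>+w. (c (y, w))\<^sup>2 \<partial>M3 \<partial>M2)"
proof -
  interpret M3: sigma_finite_measure M3 by fact
  have "(\<integral>\<^sup>+x. \<integral>\<^sup>+y. (\<integral>\<^sup>+w. b (x, w) * c (y, w) \<partial>M3)\<^sup>2 \<partial>M2 \<partial>M1)
     \<le> (\<integral>\<^sup>+x. \<integral>\<^sup>+y. (\<integral>\<^sup>+w. (b (x, w))\<^sup>2 \<partial>M3) * (\<integral>\<^sup>+w. (c (y, w))\<^sup>2 \<partial>M3) \<partial>M2 \<partial>M1)"
    by (intro nn_integral_mono Cauchy_Schwarz_nn_integral) measurable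
  also have "\<dots> = (\<integral>\<^sup>+x. \<integral>\<^sup>+w. (b (x, w))\<^sup>2 \<partial>M3 \<partial>M1) * (\<integral>\<^sup>+y. \<integral>\<^sup>+w. (c (y, w))\<^sup>2 \<partial>M3 \<partial>M2)"
    by (simp add: nn_integral_cmult nn_integral_multc)
  finally show ?thesis .
qed

text \<open>Three kernels, any two of which share one variable. Integrating over \<open>w\<close> first gives, by
  \<open>Cauchy_Schwarz_contraction\<close>, a square-integrable function of \<open>(x, y)\<close> to be paired with \<open>a\<close>. This
  is the integrability behind \<open>iterated_contraction_null\<close>.\<close>

lemma Cauchy_Schwarz_triangle:
  fixes a b c :: "_ \<Rightarrow> ennreal"
  assumes sf: "sigma_finite_measure M1" "sigma_finite_measure M2" "sigma_finite_measure M3"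
    and [measurable]: "a \<in> borel_measurable (M1 \<Otimes>\<^sub>M M2)"
      "b \<in> borel_measurable (M1 \<Otimes>\<^sub>M M3)" "c \<in> borel_measurable (M2 \<Otimes>\<^sub>M M3)"
    and fin: "(\<integral>\<^sup>+x. \<integral>\<^sup>+y. (a (x, y))\<^sup>2 \<partial>M2 \<partial>M1) < \<infinity>" "(\<integral>\<^sup>+x. \<integral>\<^sup>+w. (b (x, w))\<^sup>2 \<partial>M3 \<partial>M1) < \<infinity>"
      "(\<integral>\<^sup>+y. \<integral>\<^sup>+w. (c (y, w))\<^sup>2 \<partial>M3 \<partial>M2) < \<infinity>"
  shows "(\<integral>\<^sup>+x. \<integral>\<^sup>+y. \<integral>\<^sup>+w. a (x, y) * (b (x, w) * c (y, w)) \<partial>M3 \<partial>M2 \<partial>M1) < \<infinity>"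
proof -
  interpret M2: sigma_finite_measure M2 by fact
  interpret M3: sigma_finite_measure M3 by fact
  define G where "G = (\<lambda>p. \<integral>\<^sup>+w. b (fst p, w) * c (snd p, w) \<partial>M3)"
  have [measurable]: "G \<in> borel_measurable (M1 \<Otimes>\<^sub>M M2)" unfolding G_def by measurable
  have "(\<integral>\<^sup>+x. \<integral>\<^sup>+y. \<integral>\<^sup>+w. a (x, y) * (b (x, w) * c (y, w)) \<partial>M3 \<partial>M2 \<partial>M1)
     = (\<integral>\<^sup>+x. \<integral>\<^sup>+y. a (x, y) * G (x, y) \<partial>M2 \<partial>M1)"
    unfolding G_def by (intro nn_integral_cong) (subst nn_integral_cmult, auto)
  also have "\<dots> = (\<integral>\<^sup>+p. a p * G p \<partial>(M1 \<Otimes>\<^sub>M M2))"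
    by (subst M2.nn_integral_fst) auto
  finally have eq: "(\<integral>\<^sup>+x. \<integral>\<^sup>+y. \<integral>\<^sup>+w. a (x, y) * (b (x, w) * c (y, w)) \<partial>M3 \<partial>M2 \<partial>M1) = \<dots>" .
  have "(\<integral>\<^sup>+p. a p * G p \<partial>(M1 \<Otimes>\<^sub>M M2))\<^sup>2 \<le> (\<integral>\<^sup>+p. (a p)\<^sup>2 \<partial>(M1 \<Otimes>\<^sub>M M2)) * (\<integral>\<^sup>+p. (G p)\<^sup>2 \<partial>(M1 \<Otimes>\<^sub>M M2))"
    by (rule Cauchy_Schwarz_nn_integral) auto
  also have "\<dots> = (\<integral>\<^sup>+x. \<integral>\<^sup>+y. (a (x, y))\<^sup>2 \<partial>M2 \<partial>M1) * (\<integral>\<^sup>+x. \<integral>\<^sup>+y. (G (x, y))\<^sup>2 \<partial>M2 \<partial>M1)"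
    by (simp add: M2.nn_integral_fst[symmetric])
  also have "\<dots> \<le> (\<integral>\<^sup>+x. \<integral>\<^sup>+y. (a (x, y))\<^sup>2 \<partial>M2 \<partial>M1) *
      ((\<integral>\<^sup>+x. \<integral>\<^sup>+w. (b (x, w))\<^sup>2 \<partial>M3 \<partial>M1) * (\<integral>\<^sup>+y. \<integral>\<^sup>+w. (c (y, w))\<^sup>2 \<partial>M3 \<partial>M2))"
    unfolding G_def fst_conv snd_conv by (intro mult_left_mono Cauchy_Schwarz_contraction sf) auto
  also have "\<dots> < \<infinity>" using fin by (simp add: ennreal_mult_less_top)
  finally show ?thesis unfolding eq
    by (auto simp: power2_eq_square ennreal_mult_less_top less_top[symmetric])
qed

section \<open>Contractions in labelled variables\<close>

text \<open>Both contractions of the product formula at once. The number \<open>e\<close>, which is \<open>0\<close> or \<open>1\<close>, counts the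
  shared variables that are not integrated, and \<open>\<pi>1\<close>, \<open>\<pi>2\<close> describe the order in which the integrated
  variables enter the two kernels; the ordinary contraction reverses it in the second kernel, the star
  contraction in the first.\<close>

definition contraction_along ::
    "nat \<Rightarrow> (nat \<Rightarrow> nat) \<Rightarrow> (nat \<Rightarrow> nat) \<Rightarrow> nat \<Rightarrow> nat \<Rightarrow> nat \<Rightarrow> kernel \<Rightarrow> kernel \<Rightarrow> kernel" where
  "contraction_along e \<pi>1 \<pi>2 n m p f g = (\<lambda>t. LINT s|orthant (p - e).
     f (\<lambda>i\<in>{..<n}. if i < n - p + e then t i else s (\<pi>1 (i - (n - p + e)))) *
     g (\<lambda>i\<in>{..<m}. if i < p - e then s (\<pi>2 i) else t (n - p + (i - (p - e)))))"

lemma contraction_eq_along: "contraction n m p f g = contraction_along 0 id (\<lambda>i. p - 1 - i) n m p f g"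
  unfolding contraction_def contraction_along_def id_apply add_0_right diff_zero ..

lemma star_contraction_eq_along:
  "star_contraction n m p f g = contraction_along 1 (\<lambda>i. p - 2 - i) id n m p f g"
  unfolding star_contraction_def contraction_along_def id_apply ..

lemma bij_betw_reverse: "bij_betw (\<lambda>i. q - 1 - i) {..<q} {..<q::nat}"
  by (rule bij_betwI[where g = "\<lambda>i. q - 1 - i"]) auto

lemma bij_betw_reverse': "bij_betw (\<lambda>i. q - 2 - i) {..<q - 1} {..<q - 1::nat}"
  by (rule bij_betwI[where g = "\<lambda>i. q - 2 - i"]) auto

text \<open>Concatenation of two labellings; it builds the labels of the arguments of each factor of a contraction.\<close>

lemma bij_betw_concat:
  fixes i j :: nat
  assumes a: "bij_betw a {..<i} A" and b: "bij_betw b {..<j} B" and dis: "A \<inter> B = {}"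
  defines "c \<equiv> \<lambda>k. if k < i then a k else b (k - i)"
  shows "bij_betw c {..<i + j} (A \<union> B)" "c ` {..<i} = A" "c ` {i..<i + j} = B"
proof -
  have shift: "bij_betw (\<lambda>k. k - i) {i..<i + j} {..<j}"
    by (rule bij_betwI[where g = "\<lambda>k. k + i"]) auto
  have 1: "bij_betw c {..<i} A" using a by (rule bij_betw_cong[THEN iffD1, rotated]) (simp add: c_def)
  have 2: "bij_betw c {i..<i + j} B"
    using bij_betw_trans[OF shift b] by (rule bij_betw_cong[THEN iffD1, rotated]) (simp add: c_def)
  have "{..<i + j} = {..<i} \<union> {i..<i + j}" by auto
  then show "bij_betw c {..<i + j} (A \<union> B)" using bij_betw_combine[OF 1 2 dis] by simp
  show "c ` {..<i} = A" "c ` {i..<i + j} = B" using 1 2 by (simp_all add: bij_betw_def)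
qed

lemma measurable_contraction_integrand:
  fixes f g :: kernel
  assumes f: "f \<in> borel_measurable (orthant n)" and g: "g \<in> borel_measurable (orthant m)"
    and p: "e \<le> p" "p \<le> n" "p \<le> m" "e \<le> 1"
    and \<pi>: "\<pi>1 ` {..<p - e} \<subseteq> {..<p - e}" "\<pi>2 ` {..<p - e} \<subseteq> {..<p - e}"
  shows "(\<lambda>(t, s). f (\<lambda>i\<in>{..<n}. if i < n - p + e then t i else s (\<pi>1 (i - (n - p + e)))) *
     g (\<lambda>i\<in>{..<m}. if i < p - e then s (\<pi>2 i) else t (n - p + (i - (p - e)))))
    \<in> borel_measurable (orthant (n + m - 2 * p + e) \<Otimes>\<^sub>M orthant (p - e))" (is "_ \<in> borel_measurable ?M")
proof -
  have 1: "(\<lambda>ts. \<lambda>i\<in>{..<n}. if i < n - p + e then fst ts i else snd ts (\<pi>1 (i - (n - p + e)))) \<in> ?M \<rightarrow>\<^sub>M orthant n"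
    unfolding orthant_def
  proof (rule measurable_restrict)
    fix i assume i: "i \<in> {..<n}"
    show "(\<lambda>ts. if i < n - p + e then fst ts i else snd ts (\<pi>1 (i - (n - p + e))))
      \<in> coords {..<n + m - 2 * p + e} \<Otimes>\<^sub>M coords {..<p - e} \<rightarrow>\<^sub>M half_line"
    proof (cases "i < n - p + e")
      case True
      then have "i \<in> {..<n + m - 2 * p + e}" using p by auto
      from measurable_compose[OF measurable_fst measurable_component_singleton[OF this]]
      show ?thesis using True by simp
    next
      case False
      then have "i - (n - p + e) \<in> {..<p - e}" using p i by auto
      then have "\<pi>1 (i - (n - p + e)) \<in> {..<p - e}" using \<pi> by blast
      from measurable_compose[OF measurable_snd measurable_component_singleton[OF this]]
      show ?thesis using False by simp
    qed
  qed
  have 2: "(\<lambda>ts. \<lambda>i\<in>{..<m}. if i < p - e then snd ts (\<pi>2 i) else fst ts (n - p + (i - (p - e)))) \<in> ?M \<rightarrow>\<^sub>M orthant m"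
    unfolding orthant_def
  proof (rule measurable_restrict)
    fix i assume i: "i \<in> {..<m}"
    show "(\<lambda>ts. if i < p - e then snd ts (\<pi>2 i) else fst ts (n - p + (i - (p - e))))
      \<in> coords {..<n + m - 2 * p + e} \<Otimes>\<^sub>M coords {..<p - e} \<rightarrow>\<^sub>M half_line"
    proof (cases "i < p - e")
      case False
      then have "n - p + (i - (p - e)) \<in> {..<n + m - 2 * p + e}" using p i by auto
      from measurable_compose[OF measurable_fst measurable_component_singleton[OF this]]
      show ?thesis using False by simp
    next
      case True
      then have "\<pi>2 i \<in> {..<p - e}" using \<pi> by blast
      from measurable_compose[OF measurable_snd measurable_component_singleton[OF this]]
      show ?thesis using True by simp
    qed
  qed
  show ?thesis
    unfolding case_prod_beta by (rule borel_measurable_times[OF measurable_compose[OF 1 f] measurable_compose[OF 2 g]])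
qed

lemma measurable_contraction_along:
  assumes "f \<in> borel_measurable (orthant n)" "g \<in> borel_measurable (orthant m)"
    "e \<le> p" "p \<le> n" "p \<le> m" "e \<le> 1"
    "\<pi>1 ` {..<p - e} \<subseteq> {..<p - e}" "\<pi>2 ` {..<p - e} \<subseteq> {..<p - e}"
  shows "contraction_along e \<pi>1 \<pi>2 n m p f g \<in> borel_measurable (orthant (n + m - 2 * p + e))"
proof -
  interpret sigma_finite_measure "orthant (p - e)"
    unfolding orthant_def by (rule sigma_finite_coords) simp
  show ?thesis unfolding contraction_along_def
    by (rule borel_measurable_lebesgue_integral) (rule measurable_contraction_integrand[OF assms])
qed

text \<open>A coordinate-free description of a contraction: label its arguments by \<open>\<tau>\<close> and choose any fresh
  labels \<open>S\<close> for the integrated variables. For symmetric kernels it only matters which labels go into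
  which kernel, not in which order, so the clauses mostly speak of ranges. The order enters where
  words are treated: the first arguments of \<open>f\<close> are those of \<open>c\<close>, the first arguments of \<open>g\<close> are the
  integrated variables, and if any variable is shared, then the very first argument of \<open>g\<close> is.\<close>

definition represents_contraction ::
    "nat \<Rightarrow> nat \<Rightarrow> nat \<Rightarrow> nat \<Rightarrow> kernel \<Rightarrow> kernel \<Rightarrow> kernel \<Rightarrow> bool" where
  "represents_contraction e n m p f g c \<longleftrightarrow>
    (\<forall>A \<tau> S. finite A \<and> inj_on \<tau> {..<n + m - 2 * p + e} \<and> \<tau> ` {..<n + m - 2 * p + e} \<subseteq> A \<and>
       finite S \<and> card S = p - e \<and> A \<inter> S = {} \<longrightarrow>
     (\<exists>\<tau>1 \<tau>2. inj_on \<tau>1 {..<n} \<and> inj_on \<tau>2 {..<m} \<and>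
       (\<forall>i<n - p + e. \<tau>1 i = \<tau> i) \<and> \<tau>1 ` {..<n} = \<tau> ` {..<n - p + e} \<union> S \<and>
       \<tau>2 ` {..<p - e} = S \<and> \<tau>2 ` {..<m} = \<tau> ` {n - p..<n + m - 2 * p + e} \<union> S \<and>
       (1 \<le> p \<longrightarrow> \<tau>2 0 \<in> \<tau>1 ` {..<n}) \<and>
       (\<forall>z\<in>space (coords A). c (pick {..<n + m - 2 * p + e} \<tau> z) =
         (LINT s|coords S. f (pick {..<n} \<tau>1 (merge A S (z, s))) * g (pick {..<m} \<tau>2 (merge A S (z, s)))))))"

lemma represents_contractionE:
  assumes "represents_contraction e n m p f g c" "N = n + m - 2 * p + e"
    and "finite A" "inj_on \<tau> {..<N}" "\<tau> ` {..<N} \<subseteq> A" "finite S" "card S = p - e" "A \<inter> S = {}"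
    and "\<tau> ` {..<n - p + e} = J1" "\<tau> ` {n - p..<N} = J2"
  obtains \<tau>1 \<tau>2 where "inj_on \<tau>1 {..<n}" "inj_on \<tau>2 {..<m}" "\<tau>1 ` {..<n} = J1 \<union> S" "\<tau>2 ` {..<m} = J2 \<union> S"
    "\<And>i. i < n - p + e \<Longrightarrow> \<tau>1 i = \<tau> i" "\<tau>2 ` {..<p - e} = S" "1 \<le> p \<Longrightarrow> \<tau>2 0 \<in> \<tau>1 ` {..<n}"
    "\<And>z. z \<in> space (coords A) \<Longrightarrow> c (pick {..<N} \<tau> z) =
         (LINT s|coords S. f (pick {..<n} \<tau>1 (merge A S (z, s))) * g (pick {..<m} \<tau>2 (merge A S (z, s))))"
proof -
  have "\<exists>\<tau>1 \<tau>2. inj_on \<tau>1 {..<n} \<and> inj_on \<tau>2 {..<m} \<and>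
       (\<forall>i<n - p + e. \<tau>1 i = \<tau> i) \<and> \<tau>1 ` {..<n} = J1 \<union> S \<and>
       \<tau>2 ` {..<p - e} = S \<and> \<tau>2 ` {..<m} = J2 \<union> S \<and>
       (1 \<le> p \<longrightarrow> \<tau>2 0 \<in> \<tau>1 ` {..<n}) \<and>
       (\<forall>z\<in>space (coords A). c (pick {..<N} \<tau> z) =
         (LINT s|coords S. f (pick {..<n} \<tau>1 (merge A S (z, s))) * g (pick {..<m} \<tau>2 (merge A S (z, s)))))"
    unfolding assms(9,10)[symmetric]
    by (rule assms(1)[unfolded represents_contraction_def, folded assms(2), rule_format]) (intro conjI assms(3-8))
  then show ?thesis by (elim exE conjE) (rule that; simp)
qed

lemma fresh_labels:
  fixes K :: "nat set" assumes "finite K"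
  obtains S :: "nat set" where "finite S" "card S = q" "K \<inter> S = {}"
proof -
  have "infinite (- K)" using assms by (simp add: Compl_eq_Diff_UNIV)
  from infinite_arbitrarily_large[OF this, of q] obtain S where "finite S" "card S = q" "S \<subseteq> - K" by blast
  then show ?thesis by (intro that[of S]) auto
qed

text \<open>The case where the arguments keep their own positions as labels.\<close>

lemma represents_contraction_orthant:
  assumes c: "represents_contraction e k l p h u c" and N: "N = k + l - 2 * p + e"
  obtains S \<rho> \<tau> where "finite S" "card S = p - e" "{..<N} \<inter> S = {}"
    "inj_on \<rho> {..<k}" "inj_on \<tau> {..<l}" "\<rho> ` {..<k} = {..<k - p + e} \<union> S" "\<tau> ` {..<l} = {k - p..<N} \<union> S"
    "\<And>i. i < k - p + e \<Longrightarrow> \<rho> i = i" "\<tau> ` {..<p - e} = S" "1 \<le> p \<Longrightarrow> \<tau> 0 \<in> \<rho> ` {..<k}"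
    "\<And>z. z \<in> space (coords {..<N}) \<Longrightarrow> c z =
       (LINT s|coords S. h (pick {..<k} \<rho> (merge {..<N} S (z, s))) * u (pick {..<l} \<tau> (merge {..<N} S (z, s))))"
proof -
  obtain S :: "nat set" where S: "finite S" "card S = p - e" "{..<N} \<inter> S = {}" using fresh_labels[OF finite_lessThan] .
  have im: "id ` {..<N} \<subseteq> {..<N}" "id ` {..<k - p + e} = {..<k - p + e}" "id ` {k - p..<N} = {k - p..<N}" by auto
  show ?thesis
  proof (rule represents_contractionE[OF c N finite_lessThan inj_on_id im(1) S im(2,3)])
    fix \<rho> \<tau> :: "nat \<Rightarrow> nat"
    assume *: "inj_on \<rho> {..<k}" "inj_on \<tau> {..<l}" "\<rho> ` {..<k} = {..<k - p + e} \<union> S" "\<tau> ` {..<l} = {k - p..<N} \<union> S"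
      "\<And>i. i < k - p + e \<Longrightarrow> \<rho> i = id i" "\<tau> ` {..<p - e} = S" "1 \<le> p \<Longrightarrow> \<tau> 0 \<in> \<rho> ` {..<k}"
      "\<And>z. z \<in> space (coords {..<N}) \<Longrightarrow> c (pick {..<N} id z) =
         (LINT s|coords S. h (pick {..<k} \<rho> (merge {..<N} S (z, s))) * u (pick {..<l} \<tau> (merge {..<N} S (z, s))))"
    show thesis by (rule that[OF S *(1-4) _ *(6,7)]) (use *(5,8) in \<open>simp_all add: pick_id\<close>)
  qed
qed

lemma represents_contraction_along:
  assumes f: "f \<in> borel_measurable (orthant n)" and g: "g \<in> borel_measurable (orthant m)"
    and p: "e \<le> p" "p \<le> n" "p \<le> m" "e \<le> 1"
    and \<pi>: "bij_betw \<pi>1 {..<p - e} {..<p - e}" "bij_betw \<pi>2 {..<p - e} {..<p - e}"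
  shows "represents_contraction e n m p f g (contraction_along e \<pi>1 \<pi>2 n m p f g)"
  unfolding represents_contraction_def
proof (intro allI impI, elim conjE)
  fix A S :: "nat set" and \<tau> :: "nat \<Rightarrow> nat"
  define N where "N = n + m - 2 * p + e"
  define q where "q = p - e"
  assume fA: "finite A" and fS: "finite S" and cS: "card S = p - e" and AS: "A \<inter> S = {}"
    and inj: "inj_on \<tau> {..<n + m - 2 * p + e}" and ran: "\<tau> ` {..<n + m - 2 * p + e} \<subseteq> A"
  obtain \<epsilon> where \<epsilon>: "bij_betw \<epsilon> {..<q} S"
    using fS cS by (metis q_def ex_bij_betw_nat_finite lessThan_atLeast0)
  define \<tau>1 where "\<tau>1 = (\<lambda>i. if i < n - p + e then \<tau> i else \<epsilon> (\<pi>1 (i - (n - p + e))))"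
  define \<tau>2 where "\<tau>2 = (\<lambda>i. if i < q then \<epsilon> (\<pi>2 i) else \<tau> (n - p + (i - q)))"
  have q: "q + e = p" "n - p + e + (m - p) = N" "n - p + e + q = n" "q + (m - p + e) = m" using p by (auto simp: q_def N_def)
  have \<epsilon>\<pi>1: "bij_betw (\<epsilon> \<circ> \<pi>1) {..<q} S" and \<epsilon>\<pi>2: "bij_betw (\<epsilon> \<circ> \<pi>2) {..<q} S"
    using \<pi> \<epsilon> by (auto simp: q_def intro: bij_betw_trans)
  have inj': "inj_on \<tau> {..<N}" and ran': "\<tau> ` {..<N} \<subseteq> A" using inj ran by (auto simp: N_def)
  have \<tau>A: "\<tau> i \<in> A" if "i < N" for i using ran' that by auto
  have \<epsilon>S: "\<epsilon> (\<pi>1 i) \<in> S" "\<epsilon> (\<pi>2 i) \<in> S" if "i < q" for i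
    using \<epsilon>\<pi>1 \<epsilon>\<pi>2 that by (auto simp: bij_betw_def)
  have \<tau>b: "bij_betw \<tau> {..<n - p + e} (\<tau> ` {..<n - p + e})"
    using inj_on_subset[OF inj'] q(2) by (auto simp: bij_betw_def)
  have \<tau>b': "bij_betw (\<lambda>k. \<tau> (n - p + k)) {..<m - p + e} (\<tau> ` {n - p..<N})"
  proof -
    have "bij_betw (\<lambda>k. n - p + k) {..<m - p + e} {n - p..<N}"
      by (rule bij_betwI[where g = "\<lambda>k. k - (n - p)"]) (use q p in auto)
    moreover have "bij_betw \<tau> {n - p..<N} (\<tau> ` {n - p..<N})"
      by (rule inj_on_imp_bij_betw, rule inj_on_subset[OF inj']) auto
    ultimately show ?thesis by (rule bij_betw_trans[unfolded comp_def])
  qed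
  have dis: "\<tau> ` {..<n - p + e} \<inter> S = {}" "S \<inter> \<tau> ` {n - p..<N} = {}"
  proof -
    have "\<tau> ` {..<n - p + e} \<subseteq> A" "\<tau> ` {n - p..<N} \<subseteq> A" using q(2) by (auto intro!: \<tau>A)
    then show "\<tau> ` {..<n - p + e} \<inter> S = {}" "S \<inter> \<tau> ` {n - p..<N} = {}" using AS by auto
  qed
  note c1 = bij_betw_concat[OF \<tau>b \<epsilon>\<pi>1 dis(1), unfolded comp_def, folded \<tau>1_def, unfolded q(3)]
  note c2 = bij_betw_concat[OF \<epsilon>\<pi>2 \<tau>b' dis(2), unfolded comp_def, folded \<tau>2_def, unfolded q(4)]
  have inj1: "inj_on \<tau>1 {..<n}" and range1: "\<tau>1 ` {..<n} = \<tau> ` {..<n - p + e} \<union> S"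
    using c1(1) by (auto simp: bij_betw_def)
  have inj2: "inj_on \<tau>2 {..<m}" and range2: "\<tau>2 ` {..<m} = \<tau> ` {n - p..<N} \<union> S" and image2: "\<tau>2 ` {..<q} = S"
    using c2(1,2) by (auto simp: bij_betw_def)
  have first: "\<tau>2 0 \<in> \<tau>1 ` {..<n}" if "1 \<le> p"
  proof (cases "0 < q")
    case True
    then show ?thesis using image2 range1 by blast
  next
    case False
    then have "q = 0" "e = 1" using that q p by auto
    then show ?thesis unfolding range1 by (auto simp: \<tau>2_def)
  qed
  have formula: "contraction_along e \<pi>1 \<pi>2 n m p f g (pick {..<N} \<tau> z) =
         (LINT s|coords S. f (pick {..<n} \<tau>1 (merge A S (z, s))) * g (pick {..<m} \<tau>2 (merge A S (z, s))))"
    if z: "z \<in> space (coords A)" for z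
  proof -
    define t where "t = pick {..<N} \<tau> z"
    have t: "t \<in> space (orthant N)" unfolding t_def orthant_eq_coords
      by (rule measurable_space[OF measurable_pick[OF ran'] z])
    define F where "F = (\<lambda>s. f (\<lambda>i\<in>{..<n}. if i < n - p + e then t i else s (\<pi>1 (i - (n - p + e)))) *
     g (\<lambda>i\<in>{..<m}. if i < q then s (\<pi>2 i) else t (n - p + (i - q))))"
    have F: "F \<in> borel_measurable (coords {..<q})"
      using measurable_compose[OF measurable_Pair1'[OF t[unfolded N_def]] measurable_contraction_integrand[OF f g p], of \<pi>1 \<pi>2]
        \<pi> unfolding F_def q_def by (simp add: orthant_eq_coords bij_betw_def)
    have "contraction_along e \<pi>1 \<pi>2 n m p f g t = (LINT s|coords {..<q}. F s)"
      unfolding F_def q_def by (simp add: contraction_along_def orthant_eq_coords)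
    also have "\<dots> = (LINT s|coords S. F (pick {..<q} \<epsilon> s))"
      by (rule integral_pick[OF _ \<epsilon> F, symmetric]) simp
    also have "\<dots> = (LINT s|coords S. f (pick {..<n} \<tau>1 (merge A S (z, s))) * g (pick {..<m} \<tau>2 (merge A S (z, s))))"
    proof (rule Bochner_Integration.integral_cong[OF refl])
      fix s
      have \<pi>q: "\<pi>1 i < q" "\<pi>2 i < q" if "i < q" for i using \<pi> that by (auto simp: q_def bij_betw_def)
      have "(\<lambda>i\<in>{..<n}. if i < n - p + e then t i else pick {..<q} \<epsilon> s (\<pi>1 (i - (n - p + e)))) = pick {..<n} \<tau>1 (merge A S (z, s))"
      proof
        fix i
        show "(\<lambda>i\<in>{..<n}. if i < n - p + e then t i else pick {..<q} \<epsilon> s (\<pi>1 (i - (n - p + e)))) i = pick {..<n} \<tau>1 (merge A S (z, s)) i"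
        proof (cases "i < n")
          case i: True
          show ?thesis
          proof (cases "i < n - p + e")
            case True
            then have "i < N" using q by auto
            then show ?thesis using i True AS by (simp add: pick_def \<tau>1_def t_def \<tau>A)
          next
            case False
            then have "i - (n - p + e) < q" using i q by auto
            then show ?thesis using i False AS \<pi>q \<epsilon>S by (simp add: pick_def \<tau>1_def)
          qed
        qed (simp add: pick_def)
      qed
      moreover have "(\<lambda>i\<in>{..<m}. if i < q then pick {..<q} \<epsilon> s (\<pi>2 i) else t (n - p + (i - q))) = pick {..<m} \<tau>2 (merge A S (z, s))"
      proof
        fix i
        show "(\<lambda>i\<in>{..<m}. if i < q then pick {..<q} \<epsilon> s (\<pi>2 i) else t (n - p + (i - q))) i = pick {..<m} \<tau>2 (merge A S (z, s)) i"
        proof (cases "i < m")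
          case i: True
          show ?thesis
          proof (cases "i < q")
            case False
            then have "n - p + (i - q) < N" using i q p by auto
            then show ?thesis using i False AS by (simp add: pick_def \<tau>2_def t_def \<tau>A)
          next
            case True
            then show ?thesis using i AS \<pi>q \<epsilon>S by (simp add: pick_def \<tau>2_def)
          qed
        qed (simp add: pick_def)
      qed
      ultimately show "F (pick {..<q} \<epsilon> s) = f (pick {..<n} \<tau>1 (merge A S (z, s))) * g (pick {..<m} \<tau>2 (merge A S (z, s)))"
        by (simp add: F_def)
    qed
    finally show ?thesis by (simp add: t_def)
  qed
  show "\<exists>\<tau>1 \<tau>2. inj_on \<tau>1 {..<n} \<and> inj_on \<tau>2 {..<m} \<and>
       (\<forall>i<n - p + e. \<tau>1 i = \<tau> i) \<and> \<tau>1 ` {..<n} = \<tau> ` {..<n - p + e} \<union> S \<and>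
       \<tau>2 ` {..<p - e} = S \<and> \<tau>2 ` {..<m} = \<tau> ` {n - p..<n + m - 2 * p + e} \<union> S \<and>
       (1 \<le> p \<longrightarrow> \<tau>2 0 \<in> \<tau>1 ` {..<n}) \<and>
       (\<forall>z\<in>space (coords A). contraction_along e \<pi>1 \<pi>2 n m p f g (pick {..<n + m - 2 * p + e} \<tau> z) =
         (LINT s|coords S. f (pick {..<n} \<tau>1 (merge A S (z, s))) * g (pick {..<m} \<tau>2 (merge A S (z, s)))))"
    by (rule exI[of _ \<tau>1], rule exI[of _ \<tau>2])
      (use inj1 inj2 range1 image2 range2 first formula in \<open>auto simp: \<tau>1_def N_def[symmetric] q_def[symmetric]\<close>)
qed

lemma represents_contraction_contraction:
  assumes "f \<in> borel_measurable (orthant n)" "g \<in> borel_measurable (orthant m)" "p \<le> n" "p \<le> m"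
  shows "represents_contraction 0 n m p f g (contraction n m p f g)"
  unfolding contraction_eq_along
  by (rule represents_contraction_along[OF assms(1,2) _ assms(3,4)])
    (simp_all add: bij_betw_id bij_betw_reverse[unfolded One_nat_def])

lemma represents_contraction_star:
  assumes "f \<in> borel_measurable (orthant n)" "g \<in> borel_measurable (orthant m)" "1 \<le> p" "p \<le> n" "p \<le> m"
  shows "represents_contraction 1 n m p f g (star_contraction n m p f g)"
  unfolding star_contraction_eq_along
  by (intro represents_contraction_along assms bij_betw_id bij_betw_reverse') simp_all

lemma measurable_contraction:
  assumes "f \<in> borel_measurable (orthant n)" "g \<in> borel_measurable (orthant m)" "p \<le> n" "p \<le> m"
  shows "contraction n m p f g \<in> borel_measurable (orthant (n + m - 2 * p))"
  unfolding contraction_eq_along 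
  by (rule measurable_contraction_along[OF assms(1,2) _ assms(3,4), of 0, simplified])
    (use bij_betw_reverse[of p] in \<open>simp_all add: bij_betw_def\<close>)

lemma measurable_star_contraction:
  assumes "f \<in> borel_measurable (orthant n)" "g \<in> borel_measurable (orthant m)" "1 \<le> p" "p \<le> n" "p \<le> m"
  shows "star_contraction n m p f g \<in> borel_measurable (orthant (n + m - 2 * p + 1))"
  unfolding star_contraction_eq_along using assms
  by (intro measurable_contraction_along) auto

section \<open>Square-integrability of contractions\<close>

lemma L2_kernels_iff:
  "f \<in> L2_kernels n \<longleftrightarrow> f \<in> borel_measurable (orthant n) \<and> (\<integral>\<^sup>+t. (ennreal (cmod (f t)))\<^sup>2 \<partial>orthant n) < \<infinity>"
  by (auto simp: L2_kernels_def integrable_iff_bounded ennreal_power)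

lemma L2_kernels_measurable: "f \<in> L2_kernels n \<Longrightarrow> f \<in> borel_measurable (orthant n)"
  by (simp add: L2_kernels_def)

text \<open>The Cauchy-Schwarz inequality in the integrated variables bounds the norm of the contraction by the
  product of the norms: the free variables \<open>A\<close> of \<open>f\<close> and \<open>B\<close> of \<open>g\<close> are disjoint.\<close>

lemma contraction_in_L2:
  assumes f: "f \<in> L2_kernels n" and g: "g \<in> L2_kernels m" and p: "p \<le> n" "p \<le> m"
  shows "contraction n m p f g \<in> L2_kernels (n + m - 2 * p)"
proof -
  note fm = L2_kernels_measurable[OF f] and gm = L2_kernels_measurable[OF g]
  define N where "N = n + m - 2 * p"
  define S where "S = {N..<N + p}"
  define A where "A = {..<n - p}"
  define B where "B = {n - p..<N}"
  have AB: "A \<union> B = {..<N}" "A \<inter> B = {}" "finite A" "finite B" "finite S" "{..<N} \<inter> S = {}" "A \<inter> S = {}" "B \<inter> S = {}"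
    using p by (auto simp: A_def B_def S_def N_def)
  define c where "c = contraction n m p f g"
  have cm: "c \<in> borel_measurable (orthant N)"
    unfolding c_def N_def by (rule measurable_contraction[OF fm gm p])
  from represents_contraction_contraction[OF fm gm p, folded c_def, unfolded represents_contraction_def, rule_format, of "{..<N}" id S] AB
  obtain \<tau>1 \<tau>2 where \<tau>: "inj_on \<tau>1 {..<n}" "inj_on \<tau>2 {..<m}" "\<tau>1 ` {..<n} = A \<union> S" "\<tau>2 ` {..<m} = B \<union> S"
    and cz: "\<And>z. z\<in>space (coords {..<N}) \<Longrightarrow> c (pick {..<N} id z) =
         (LINT s|coords S. f (pick {..<n} \<tau>1 (merge {..<N} S (z, s))) * g (pick {..<m} \<tau>2 (merge {..<N} S (z, s))))"
    by (auto simp: N_def[symmetric] A_def B_def S_def)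
  let ?f = "\<lambda>z. f (pick {..<n} \<tau>1 z)"
  let ?g = "\<lambda>z. g (pick {..<m} \<tau>2 z)"
  interpret S: sigma_finite_measure "coords S" by (rule sigma_finite_coords) (simp add: AB)
  have [measurable]: "pick {..<n} \<tau>1 \<in> coords (A \<union> S) \<rightarrow>\<^sub>M coords {..<n}" "pick {..<m} \<tau>2 \<in> coords (B \<union> S) \<rightarrow>\<^sub>M coords {..<m}"
    using \<tau> by (auto intro!: measurable_pick)
  have [measurable]: "f \<in> borel_measurable (coords {..<n})" "g \<in> borel_measurable (coords {..<m})"
    "c \<in> borel_measurable (coords {..<N})"
    using fm gm cm by (auto simp: orthant_eq_coords)
  define b1 where "b1 = (\<lambda>p. ennreal (cmod (?f (merge A S p))))"
  define b2 where "b2 = (\<lambda>p. ennreal (cmod (?g (merge B S p))))"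
  have bm [measurable]: "b1 \<in> borel_measurable (coords A \<Otimes>\<^sub>M coords S)" "b2 \<in> borel_measurable (coords B \<Otimes>\<^sub>M coords S)"
    unfolding b1_def b2_def by measurable
  have n1: "(\<integral>\<^sup>+x. \<integral>\<^sup>+w. (b1 (x, w))\<^sup>2 \<partial>coords S \<partial>coords A) = (\<integral>\<^sup>+t. (ennreal (cmod (f t)))\<^sup>2 \<partial>coords {..<n})"
    unfolding b1_def using AB \<tau> by (subst coords.product_nn_integral_fold[symmetric, where f = "\<lambda>u. (ennreal (cmod (?f u)))\<^sup>2"])
      (auto intro!: nn_integral_pick simp: bij_betw_def)
  have n2: "(\<integral>\<^sup>+x. \<integral>\<^sup>+w. (b2 (x, w))\<^sup>2 \<partial>coords S \<partial>coords B) = (\<integral>\<^sup>+t. (ennreal (cmod (g t)))\<^sup>2 \<partial>coords {..<m})"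
    unfolding b2_def using AB \<tau> by (subst coords.product_nn_integral_fold[symmetric, where f = "\<lambda>u. (ennreal (cmod (?g u)))\<^sup>2"])
      (auto intro!: nn_integral_pick simp: bij_betw_def)
  have le: "ennreal (cmod (c (merge A B (x, y)))) \<le> (\<integral>\<^sup>+w. b1 (x, w) * b2 (y, w) \<partial>coords S)"
    if x: "x \<in> space (coords A)" and y: "y \<in> space (coords B)" for x y
  proof -
    define z where "z = merge A B (x, y)"
    have z: "z \<in> space (coords {..<N})" using merge_in_space[OF x y] by (simp add: AB z_def)
    have 1: "pick {..<n} \<tau>1 (merge {..<N} S (z, s)) = pick {..<n} \<tau>1 (merge A S (x, s))" for s
      using \<tau>(3) AB by (intro pick_cong) (auto simp: merge_def z_def)
    have 2: "pick {..<m} \<tau>2 (merge {..<N} S (z, s)) = pick {..<m} \<tau>2 (merge B S (y, s))" for s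
    proof (rule pick_cong)
      fix i assume "i \<in> {..<m}"
      then have "\<tau>2 i \<in> B \<union> S" using \<tau>(4) by blast
      then show "merge {..<N} S (z, s) (\<tau>2 i) = merge B S (y, s) (\<tau>2 i)"
        using AB by (auto simp: merge_def z_def)
    qed
    have "c z = (LINT s|coords S. ?f (merge A S (x, s)) * ?g (merge B S (y, s)))"
      using cz[OF z] by (simp add: pick_id[OF z] 1 2)
    then have "ennreal (cmod (c z)) \<le> (\<integral>\<^sup>+s. ennreal (norm (?f (merge A S (x, s)) * ?g (merge B S (y, s)))) \<partial>coords S)"
      by (cases "integrable (coords S) (\<lambda>s. ?f (merge A S (x, s)) * ?g (merge B S (y, s)))")
        (auto simp: not_integrable_integral_eq intro: integral_norm_bound_ennreal)
    then show ?thesis by (simp add: b1_def b2_def norm_mult ennreal_mult z_def)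
  qed
  have "(\<integral>\<^sup>+t. (ennreal (cmod (c t)))\<^sup>2 \<partial>coords {..<N})
    = (\<integral>\<^sup>+x. \<integral>\<^sup>+y. (ennreal (cmod (c (merge A B (x, y)))))\<^sup>2 \<partial>coords B \<partial>coords A)"
    unfolding AB(1)[symmetric] using AB by (subst coords.product_nn_integral_fold) auto
  also have "\<dots> \<le> (\<integral>\<^sup>+x. \<integral>\<^sup>+y. (\<integral>\<^sup>+w. b1 (x, w) * b2 (y, w) \<partial>coords S)\<^sup>2 \<partial>coords B \<partial>coords A)"
    by (intro nn_integral_mono power_mono le) auto
  also have "\<dots> \<le> (\<integral>\<^sup>+t. (ennreal (cmod (f t)))\<^sup>2 \<partial>coords {..<n}) * (\<integral>\<^sup>+t. (ennreal (cmod (g t)))\<^sup>2 \<partial>coords {..<m})"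
    unfolding n1[symmetric] n2[symmetric]
    by (intro Cauchy_Schwarz_contraction sigma_finite_coords bm) (auto simp: AB)
  also have "\<dots> < \<infinity>"
    using f g by (auto simp: L2_kernels_iff orthant_eq_coords ennreal_mult_less_top)
  finally show ?thesis using cm by (simp add: L2_kernels_iff orthant_eq_coords c_def N_def)
qed

section \<open>The Fubini identity behind the covariance formula\<close>

text \<open>Four kernels in a cycle, each sharing one variable with the next. Both sides are the integral of
  their product over all four variables. It converges absolutely, since by the Cauchy-Schwarz
  inequality both inner integrals on the left are square-integrable, even with absolute values
  inside.\<close>

lemma Fubini_four_cycle:
  fixes f1 f2 g1 g2 :: "_ \<Rightarrow> complex"
  assumes sf: "sigma_finite_measure M1" "sigma_finite_measure M2" "sigma_finite_measure S" "sigma_finite_measure U"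
    and [measurable]: "f1 \<in> borel_measurable (M1 \<Otimes>\<^sub>M S)" "f2 \<in> borel_measurable (M2 \<Otimes>\<^sub>M S)"
      "g1 \<in> borel_measurable (M1 \<Otimes>\<^sub>M U)" "g2 \<in> borel_measurable (M2 \<Otimes>\<^sub>M U)"
    and fin: "(\<integral>\<^sup>+t. \<integral>\<^sup>+s. (ennreal (cmod (f1 (t, s))))\<^sup>2 \<partial>S \<partial>M1) < \<infinity>"
      "(\<integral>\<^sup>+t. \<integral>\<^sup>+s. (ennreal (cmod (f2 (t, s))))\<^sup>2 \<partial>S \<partial>M2) < \<infinity>"
      "(\<integral>\<^sup>+t. \<integral>\<^sup>+u. (ennreal (cmod (g1 (t, u))))\<^sup>2 \<partial>U \<partial>M1) < \<infinity>"
      "(\<integral>\<^sup>+t. \<integral>\<^sup>+u. (ennreal (cmod (g2 (t, u))))\<^sup>2 \<partial>U \<partial>M2) < \<infinity>"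
  shows "(LINT p|(M1 \<Otimes>\<^sub>M M2). (LINT s|S. f1 (fst p, s) * f2 (snd p, s)) * (LINT u|U. g1 (fst p, u) * g2 (snd p, u)))
       = (LINT q|(S \<Otimes>\<^sub>M U). (LINT t|M1. f1 (t, fst q) * g1 (t, snd q)) * (LINT t|M2. f2 (t, fst q) * g2 (t, snd q)))"
proof -
  interpret M1: sigma_finite_measure M1 by fact
  interpret M2: sigma_finite_measure M2 by fact
  interpret S: sigma_finite_measure S by fact
  interpret U: sigma_finite_measure U by fact
  interpret M: pair_sigma_finite M1 M2 ..
  interpret SU: pair_sigma_finite S U ..
  interpret MP: sigma_finite_measure "M1 \<Otimes>\<^sub>M M2" by (rule sigma_finite_pair_measure) fact+
  interpret SUP: sigma_finite_measure "S \<Otimes>\<^sub>M U" by (rule sigma_finite_pair_measure) fact+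
  interpret P: pair_sigma_finite "M1 \<Otimes>\<^sub>M M2" "S \<Otimes>\<^sub>M U" ..
  define \<Phi> where "\<Phi> = (\<lambda>p q. (f1 (fst p, fst q) * f2 (snd p, fst q)) * (g1 (fst p, snd q) * g2 (snd p, snd q)))"
  have [measurable]: "case_prod \<Phi> \<in> borel_measurable ((M1 \<Otimes>\<^sub>M M2) \<Otimes>\<^sub>M (S \<Otimes>\<^sub>M U))" unfolding \<Phi>_def by measurable
  define a where "a = (\<lambda>p. \<integral>\<^sup>+s. ennreal (cmod (f1 (fst p, s))) * ennreal (cmod (f2 (snd p, s))) \<partial>S)"
  define b where "b = (\<lambda>p. \<integral>\<^sup>+u. ennreal (cmod (g1 (fst p, u))) * ennreal (cmod (g2 (snd p, u))) \<partial>U)"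
  have [measurable]: "a \<in> borel_measurable (M1 \<Otimes>\<^sub>M M2)" "b \<in> borel_measurable (M1 \<Otimes>\<^sub>M M2)"
    unfolding a_def b_def by measurable
  have int: "integrable ((M1 \<Otimes>\<^sub>M M2) \<Otimes>\<^sub>M (S \<Otimes>\<^sub>M U)) (case_prod \<Phi>)"
  proof (rule integrableI_bounded)
    have "(\<integral>\<^sup>+x. ennreal (norm (case_prod \<Phi> x)) \<partial>((M1 \<Otimes>\<^sub>M M2) \<Otimes>\<^sub>M (S \<Otimes>\<^sub>M U)))
      = (\<integral>\<^sup>+p. \<integral>\<^sup>+q. ennreal (norm (\<Phi> p q)) \<partial>(S \<Otimes>\<^sub>M U) \<partial>(M1 \<Otimes>\<^sub>M M2))"
      by (subst sigma_finite_measure.nn_integral_fst[OF sigma_finite_pair_measure[OF sf(3,4)], symmetric]) auto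
    also have "\<dots> = (\<integral>\<^sup>+p. a p * b p \<partial>(M1 \<Otimes>\<^sub>M M2))"
    proof (rule nn_integral_cong)
      fix p assume p: "p \<in> space (M1 \<Otimes>\<^sub>M M2)"
      have [measurable]: "fst p \<in> space M1" "snd p \<in> space M2" using p by (auto simp: space_pair_measure)
      have "(\<integral>\<^sup>+q. ennreal (norm (\<Phi> p q)) \<partial>(S \<Otimes>\<^sub>M U)) =
         (\<integral>\<^sup>+s. \<integral>\<^sup>+u. (ennreal (cmod (f1 (fst p, s))) * ennreal (cmod (f2 (snd p, s)))) *
            (ennreal (cmod (g1 (fst p, u))) * ennreal (cmod (g2 (snd p, u)))) \<partial>U \<partial>S)"
        by (subst U.nn_integral_fst[symmetric]) (auto simp: \<Phi>_def norm_mult ennreal_mult)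
      also have "\<dots> = a p * b p"
        unfolding a_def b_def by (simp add: nn_integral_cmult nn_integral_multc)
      finally show "(\<integral>\<^sup>+q. ennreal (norm (\<Phi> p q)) \<partial>(S \<Otimes>\<^sub>M U)) = a p * b p" .
    qed
    finally have eq: "(\<integral>\<^sup>+x. ennreal (norm (case_prod \<Phi> x)) \<partial>((M1 \<Otimes>\<^sub>M M2) \<Otimes>\<^sub>M (S \<Otimes>\<^sub>M U))) = \<dots>" .
    have "(\<integral>\<^sup>+p. a p * b p \<partial>(M1 \<Otimes>\<^sub>M M2))\<^sup>2 \<le> (\<integral>\<^sup>+p. (a p)\<^sup>2 \<partial>(M1 \<Otimes>\<^sub>M M2)) * (\<integral>\<^sup>+p. (b p)\<^sup>2 \<partial>(M1 \<Otimes>\<^sub>M M2))"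
      by (rule Cauchy_Schwarz_nn_integral) auto
    also have "\<dots> = (\<integral>\<^sup>+x. \<integral>\<^sup>+y. (a (x, y))\<^sup>2 \<partial>M2 \<partial>M1) * (\<integral>\<^sup>+x. \<integral>\<^sup>+y. (b (x, y))\<^sup>2 \<partial>M2 \<partial>M1)"
      by (simp add: M2.nn_integral_fst[symmetric])
    also have "\<dots> \<le> ((\<integral>\<^sup>+t. \<integral>\<^sup>+s. (ennreal (cmod (f1 (t, s))))\<^sup>2 \<partial>S \<partial>M1) * (\<integral>\<^sup>+t. \<integral>\<^sup>+s. (ennreal (cmod (f2 (t, s))))\<^sup>2 \<partial>S \<partial>M2))
      * ((\<integral>\<^sup>+t. \<integral>\<^sup>+u. (ennreal (cmod (g1 (t, u))))\<^sup>2 \<partial>U \<partial>M1) * (\<integral>\<^sup>+t. \<integral>\<^sup>+u. (ennreal (cmod (g2 (t, u))))\<^sup>2 \<partial>U \<partial>M2))"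
      unfolding a_def b_def fst_conv snd_conv by (intro mult_mono Cauchy_Schwarz_contraction sf) auto
    also have "\<dots> < \<infinity>" using fin by (simp add: ennreal_mult_less_top)
    finally show "(\<integral>\<^sup>+x. ennreal (norm (case_prod \<Phi> x)) \<partial>((M1 \<Otimes>\<^sub>M M2) \<Otimes>\<^sub>M (S \<Otimes>\<^sub>M U))) < \<infinity>" unfolding eq
      by (auto simp: power2_eq_square ennreal_mult_less_top less_top[symmetric])
  qed simp
  have "(LINT p|(M1 \<Otimes>\<^sub>M M2). (LINT s|S. f1 (fst p, s) * f2 (snd p, s)) * (LINT u|U. g1 (fst p, u) * g2 (snd p, u)))
      = (LINT p|(M1 \<Otimes>\<^sub>M M2). LINT q|(S \<Otimes>\<^sub>M U). \<Phi> p q)"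
  proof (rule integral_cong_AE)
    from P.AE_integrable_fst[OF int]
    show "AE p in M1 \<Otimes>\<^sub>M M2. (LINT s|S. f1 (fst p, s) * f2 (snd p, s)) * (LINT u|U. g1 (fst p, u) * g2 (snd p, u))
        = (LINT q|(S \<Otimes>\<^sub>M U). \<Phi> p q)"
    proof eventually_elim
      case (elim p)
      have "(LINT q|(S \<Otimes>\<^sub>M U). \<Phi> p q) = (LINT s|S. LINT u|U. \<Phi> p (s, u))"
        using SU.integral_fst'[OF elim] by simp
      then show ?case by (simp add: \<Phi>_def)
    qed
  qed (unfold \<Phi>_def, measurable)
  also have "\<dots> = (LINT q|(S \<Otimes>\<^sub>M U). LINT p|(M1 \<Otimes>\<^sub>M M2). \<Phi> p q)"
    by (rule P.Fubini_integral[OF int, symmetric])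
  also have "\<dots> = (LINT q|(S \<Otimes>\<^sub>M U). (LINT t|M1. f1 (t, fst q) * g1 (t, snd q)) * (LINT t|M2. f2 (t, fst q) * g2 (t, snd q)))"
  proof (rule integral_cong_AE)
    from P.AE_integrable_snd[OF int]
    show "AE q in S \<Otimes>\<^sub>M U. (LINT p|(M1 \<Otimes>\<^sub>M M2). \<Phi> p q) = (LINT t|M1. f1 (t, fst q) * g1 (t, snd q)) * (LINT t|M2. f2 (t, fst q) * g2 (t, snd q))"
    proof eventually_elim
      case (elim q)
      have "(LINT p|(M1 \<Otimes>\<^sub>M M2). \<Phi> p q) = (LINT t|M1. LINT t'|M2. \<Phi> (t, t') q)"
        using M.integral_fst'[OF elim] by simp
      also have "\<dots> = (LINT t|M1. LINT t'|M2. (f1 (t, fst q) * g1 (t, snd q)) * (f2 (t', fst q) * g2 (t', snd q)))"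
        by (simp add: \<Phi>_def mult_ac)
      finally show ?case by simp
    qed
  qed (unfold \<Phi>_def, measurable)
  finally show ?thesis .
qed

lemma integral_merge_pair:
  fixes F :: "_ \<Rightarrow> complex"
  assumes "finite I" "finite J" "I \<inter> J = {}" "F \<in> borel_measurable (coords (I \<union> J))"
  shows "(LINT u|coords (I \<union> J). F u) = (LINT p|(coords I \<Otimes>\<^sub>M coords J). F (merge I J p))"
  using integral_distr[OF measurable_merge assms(4)] coords.distr_merge[OF assms(3,1,2)] by simp

section \<open>Symmetric kernels\<close>

text \<open>A symmetric kernel depends only on the set of variables that are plugged in: two labellings with
  the same range differ by a permutation.\<close>

lemma symmetric_kernel_pick:
  assumes sym: "symmetric_kernel n f" and K: "finite K" "J \<subseteq> K"
    and \<tau>: "inj_on \<tau> {..<n}" "\<tau> ` {..<n} = J" and \<tau>': "inj_on \<tau>' {..<n}" "\<tau>' ` {..<n} = J"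
  shows "AE z in coords K. f (pick {..<n} \<tau> z) = f (pick {..<n} \<tau>' z) \<and> f (pick {..<n} \<tau>' z) \<in> \<real>"
proof -
  define \<sigma> where "\<sigma> = (\<lambda>i. if i < n then the_inv_into {..<n} \<tau>' (\<tau> i) else i)"
  have \<sigma>\<tau>: "\<tau>' (\<sigma> i) = \<tau> i" "\<sigma> i < n" if "i < n" for i
  proof -
    have m: "\<tau> i \<in> \<tau>' ` {..<n}" using that \<tau> \<tau>' by blast
    show "\<tau>' (\<sigma> i) = \<tau> i" using that f_the_inv_into_f[OF \<tau>'(1) m] by (simp add: \<sigma>_def)
    show "\<sigma> i < n" using the_inv_into_into[OF \<tau>'(1) m order_refl] that by (simp add: \<sigma>_def)
  qed
  have "inj_on \<sigma> {..<n}"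
  proof (rule inj_onI)
    fix i j assume "i \<in> {..<n}" "j \<in> {..<n}" "\<sigma> i = \<sigma> j"
    then have "\<tau> i = \<tau> j" using \<sigma>\<tau>(1)[of i] \<sigma>\<tau>(1)[of j] by simp
    then show "i = j" using \<tau>(1) \<open>i \<in> _\<close> \<open>j \<in> _\<close> by (auto dest: inj_onD)
  qed
  moreover have "\<sigma> ` {..<n} \<subseteq> {..<n}" using \<sigma>\<tau> by auto
  ultimately have "bij_betw \<sigma> {..<n} {..<n}"
    by (simp add: bij_betw_def endo_inj_surj)
  then have perm: "\<sigma> permutes {..<n}"
    by (rule bij_imp_permutes) (simp add: \<sigma>_def)
  have ae: "AE t in coords {..<n}. f t = f (\<lambda>i\<in>{..<n}. t (\<sigma> i)) \<and> f t \<in> \<real>"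
    using sym perm unfolding symmetric_kernel_def orthant_eq_coords by simp
  have ae': "AE z in coords K. f (pick {..<n} \<tau>' z) = f (\<lambda>i\<in>{..<n}. pick {..<n} \<tau>' z (\<sigma> i)) \<and> f (pick {..<n} \<tau>' z) \<in> \<real>"
    by (rule AE_pick[OF K(1) \<tau>'(1) _ ae]) (use K \<tau>' in blast)
  have *: "(\<lambda>i\<in>{..<n}. pick {..<n} \<tau>' z (\<sigma> i)) = pick {..<n} \<tau> z" for z
    by (auto simp: pick_def \<sigma>\<tau> fun_eq_iff)
  from ae' show ?thesis unfolding * by eventually_elim metis
qed

section \<open>Norms of contractions as pairings of squares\<close>

lemma integrable_pick:
  fixes F :: "_ \<Rightarrow> complex"
  assumes "finite I" "bij_betw e I J" "F \<in> borel_measurable (coords I)"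
  shows "integrable (coords J) (\<lambda>z. F (pick I e z)) \<longleftrightarrow> integrable (coords I) F"
  using integrable_distr_eq[of "pick I e" "coords J" "coords I" F] assms
  by (simp add: distr_pick measurable_pick bij_betw_def)

lemma measurable_cnj_compose [measurable (raw)]:
  "f \<in> borel_measurable M \<Longrightarrow> (\<lambda>x. cnj (f x)) \<in> borel_measurable M"
  by (rule measurable_compose[OF _ borel_measurable_continuous_onI]) (auto intro: continuous_intros)

lemma integrable_mult_of_L2:
  fixes a b :: "_ \<Rightarrow> complex"
  assumes [measurable]: "a \<in> borel_measurable M" "b \<in> borel_measurable M"
    and "integrable M (\<lambda>x. (cmod (a x))\<^sup>2)" "integrable M (\<lambda>x. (cmod (b x))\<^sup>2)"
  shows "integrable M (\<lambda>x. a x * b x)"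
proof (rule Bochner_Integration.integrable_bound[OF Bochner_Integration.integrable_add[OF assms(3,4)]])
  have "cmod (a x) * cmod (b x) \<le> (cmod (a x))\<^sup>2 + (cmod (b x))\<^sup>2" for x
    using sum_squares_bound[of "cmod (a x)" "cmod (b x)"] mult_nonneg_nonneg[OF norm_ge_zero[of "a x"] norm_ge_zero[of "b x"]]
    by linarith
  then show "AE x in M. norm (a x * b x) \<le> norm ((cmod (a x))\<^sup>2 + (cmod (b x))\<^sup>2)"
    by (auto simp: norm_mult)
qed simp

lemma slice_nn_integral:
  fixes h :: kernel
  assumes h: "h \<in> L2_kernels k" and fin: "finite X" "finite T" "finite S"
    and dis: "X \<inter> (T \<union> S) = {}" "T \<inter> S = {}"
    and e: "inj_on e {..<k}" "e ` {..<k} \<subseteq> X \<union> (T \<union> S)" "T \<union> S \<subseteq> e ` {..<k}"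
  shows "AE x in coords X. (\<integral>\<^sup>+t. \<integral>\<^sup>+s. (ennreal (cmod (h (pick {..<k} e (merge X (T \<union> S) (x, merge T S (t, s)))))))\<^sup>2 \<partial>coords S \<partial>coords T) < \<infinity>"
proof -
  have [measurable]: "h \<in> borel_measurable (coords {..<k})" using h by (simp add: L2_kernels_def orthant_eq_coords)
  have m [measurable]: "pick {..<k} e \<in> coords (X \<union> (T \<union> S)) \<rightarrow>\<^sub>M coords {..<k}" using e by (intro measurable_pick) auto
  have "AE x in coords X. (\<integral>\<^sup>+v. (ennreal (cmod (h (pick {..<k} e (merge X (T \<union> S) (x, v))))))\<^sup>2 \<partial>coords (T \<union> S)) < \<infinity>"
    using h fin dis by (intro AE_slice_finite e) (auto simp: L2_kernels_iff orthant_eq_coords)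
  with AE_space show ?thesis
  proof eventually_elim
    case (elim x)
    note [measurable] = elim(1)
    show ?case using elim(2) fin dis
      by (subst (asm) coords.product_nn_integral_fold) (auto, measurable)
  qed
qed

text \<open>Here \<open>F\<close> and \<open>G\<close> are the contractions of \<open>f\<close>, respectively \<open>g\<close>, with itself that leave \<open>2r - e\<close>
  variables, and \<open>H\<close> is the contraction of \<open>f\<close> with \<open>g\<close> in which \<open>r\<close> variables meet. Split the
  variables of the left side into the \<open>e\<close> unintegrated shared ones \<open>X\<close>, the remaining arguments
  \<open>T1\<close>, \<open>T2\<close> of the two factors, and the integrated ones \<open>S\<close> of \<open>F\<close> and \<open>U\<close> of \<open>G\<close>. Up to symmetry
  the integrand is \<open>f(x,t\<^sub>1,s) f(x,t\<^sub>2,s) g(x,t\<^sub>1,u) g(x,t\<^sub>2,u)\<close>, and integrating over \<open>t\<^sub>1\<close> and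
  \<open>t\<^sub>2\<close> first gives twice the same factor \<open>H(s,x,u)\<close>, which is real.

  For \<open>e = 1\<close> the integral over all variables need not converge absolutely. Therefore Fubini's theorem
  is applied for fixed \<open>x\<close> only, where the slices of \<open>f\<close> and \<open>g\<close> are square-integrable, and the
  integral over \<open>x\<close> is compared afterwards, using that \<open>F\<close>, \<open>G\<close> and \<open>H\<close> are square-integrable.\<close>

lemma contraction_square_pairing:
  assumes f: "f \<in> L2_kernels n" "symmetric_kernel n f" and g: "g \<in> L2_kernels m" "symmetric_kernel m g"
    and r: "e \<le> 1" "e \<le> r" "r \<le> n" "r \<le> m"
    and F: "represents_contraction e n n (n - r + e) f f F" "F \<in> L2_kernels (2 * r - e)"
    and G: "represents_contraction e m m (m - r + e) g g G" "G \<in> L2_kernels (2 * r - e)"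
    and H: "represents_contraction e n m r f g H" "H \<in> L2_kernels (n + m - 2 * r + e)"
  shows "(LINT t|orthant (2 * r - e). F t * G (\<lambda>i\<in>{..<2 * r - e}. t (2 * r - e - 1 - i)))
    = complex_of_real (LINT t|orthant (n + m - 2 * r + e). (cmod (H t))\<^sup>2)"
proof -
  define a where "a = r - e"
  define k where "k = n - r"
  define l where "l = m - r"
  have nml: "r = a + e" "n = a + e + k" "m = a + e + l" "e \<le> 1" using r by (auto simp: a_def k_def l_def)
  define N where "N = a + e + a"
  have N: "2 * r - e = N" using nml by (simp add: N_def)
  define T1 where "T1 = {..<a}"
  define X where "X = {a..<a + e}"
  define T2 where "T2 = {a + e..<a + e + a}"
  define S where "S = {a + e + a..<a + e + a + k}"
  define U where "U = {a + e + a + k..<a + e + a + k + l}"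
  note intervals = T1_def X_def T2_def S_def U_def
  define B where "B = X \<union> (S \<union> U)"
  have NF: "n + n - 2 * (n - r + e) + e = N" and NG: "m + m - 2 * (m - r + e) + e = N"
    using nml by (auto simp: N_def)
  have L: "{..<N} = X \<union> (T1 \<union> T2)" by (auto simp: X_def T1_def T2_def N_def)
  have fin [simp]: "finite T1" "finite X" "finite T2" "finite S" "finite U" "finite B"
    by (auto simp: T1_def X_def T2_def S_def U_def B_def)
  have dS: "{..<N} \<inter> S = {}" "{..<N} \<inter> U = {}" by (auto simp: S_def U_def N_def)
  have dis: "T1 \<inter> T2 = {}" "X \<inter> (T1 \<union> T2) = {}" "S \<inter> U = {}" "X \<inter> (S \<union> U) = {}" "B \<inter> T1 = {}" "B \<inter> T2 = {}"
    "X \<inter> (T1 \<union> S) = {}" "X \<inter> (T2 \<union> S) = {}" "X \<inter> (T1 \<union> U) = {}" "X \<inter> (T2 \<union> U) = {}"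
    "T1 \<inter> S = {}" "T2 \<inter> S = {}" "T1 \<inter> U = {}" "T2 \<inter> U = {}"
    by (auto simp: B_def T1_def X_def T2_def S_def U_def)
  have card: "card S = n - r + e - e" "card U = m - r + e - e" "card T1 = r - e" "card T2 = r - e"
    by (auto simp: nml(1-3) S_def U_def T1_def T2_def)
  note fm = L2_kernels_measurable[OF f(1)] and gm = L2_kernels_measurable[OF g(1)]
  have [measurable]: "f \<in> borel_measurable (coords {..<n})" "g \<in> borel_measurable (coords {..<m})"
    "F \<in> borel_measurable (coords {..<N})" "G \<in> borel_measurable (coords {..<N})"
    using fm gm F(2) G(2) unfolding N by (auto simp: orthant_eq_coords L2_kernels_def)
  have X1: "{..<n - (n - r + e) + e} = T1 \<union> X" "{n - (n - r + e)..<N} = X \<union> T2"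
    "{..<m - (m - r + e) + e} = T1 \<union> X" "{m - (m - r + e)..<N} = X \<union> T2"
    unfolding nml(1-3) by (auto simp: T1_def X_def T2_def N_def)
  have idim: "id ` {..<N} \<subseteq> {..<N}" "id ` {..<n - (n - r + e) + e} = T1 \<union> X" "id ` {n - (n - r + e)..<N} = X \<union> T2"
    unfolding X1 by auto
  obtain \<alpha>1 \<alpha>2 where \<alpha>: "inj_on \<alpha>1 {..<n}" "inj_on \<alpha>2 {..<n}" "\<alpha>1 ` {..<n} = T1 \<union> X \<union> S" "\<alpha>2 ` {..<n} = X \<union> T2 \<union> S"
    and Fz: "\<And>z. z \<in> space (coords {..<N}) \<Longrightarrow> F (pick {..<N} id z) =
      (LINT s|coords S. f (pick {..<n} \<alpha>1 (merge {..<N} S (z, s))) * f (pick {..<n} \<alpha>2 (merge {..<N} S (z, s))))"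
    by (rule represents_contractionE[OF F(1) NF[symmetric] finite_lessThan inj_on_id idim(1) fin(4) card(1) dS(1) idim(2,3)])
      (rule that; assumption)
  \<comment> \<open>Reversing the arguments of \<open>G\<close> exchanges the roles of \<open>T1\<close> and \<open>T2\<close>.\<close>
  define \<rho> where "\<rho> = (\<lambda>i. N - 1 - i)"
  have \<rho>inj: "inj_on \<rho> {..<N}" "\<rho> ` {..<N} \<subseteq> {..<N}" by (auto simp: \<rho>_def inj_on_def)
  have \<rho>img: "\<rho> ` (T1 \<union> X) = X \<union> T2" "\<rho> ` (X \<union> T2) = T1 \<union> X"
  proof -
    have "T1 \<union> X = {..<r}" "X \<union> T2 = {a..<N}" unfolding nml(1) by (auto simp: T1_def X_def T2_def N_def)
    moreover have "\<rho> ` {..<r} = {a..<N}"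
    proof safe
      fix j assume "j \<in> {a..<N}"
      then have "j = \<rho> (N - 1 - j)" "N - 1 - j \<in> {..<r}" unfolding nml(1) by (auto simp: \<rho>_def N_def)
      then show "j \<in> \<rho> ` {..<r}" by blast
    qed (auto simp: nml(1) \<rho>_def N_def)
    moreover have "\<rho> ` {a..<N} = {..<r}"
    proof safe
      fix j assume "j < r"
      then have "j = \<rho> (N - 1 - j)" "N - 1 - j \<in> {a..<N}" unfolding nml(1) by (auto simp: \<rho>_def N_def)
      then show "j \<in> \<rho> ` {a..<N}" by blast
    qed (auto simp: nml(1) \<rho>_def N_def)
    ultimately show "\<rho> ` (T1 \<union> X) = X \<union> T2" "\<rho> ` (X \<union> T2) = T1 \<union> X" by auto
  qed
  have \<rho>im: "\<rho> ` {..<m - (m - r + e) + e} = X \<union> T2" "\<rho> ` {m - (m - r + e)..<N} = T1 \<union> X"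
    unfolding X1 \<rho>img by simp_all
  obtain \<beta>2 \<beta>1 where \<beta>: "inj_on \<beta>2 {..<m}" "inj_on \<beta>1 {..<m}" "\<beta>2 ` {..<m} = X \<union> T2 \<union> U" "\<beta>1 ` {..<m} = T1 \<union> X \<union> U"
    and Gz: "\<And>z. z \<in> space (coords {..<N}) \<Longrightarrow> G (pick {..<N} \<rho> z) =
      (LINT s|coords U. g (pick {..<m} \<beta>2 (merge {..<N} U (z, s))) * g (pick {..<m} \<beta>1 (merge {..<N} U (z, s))))"
    by (rule represents_contractionE[OF G(1) NG[symmetric] finite_lessThan \<rho>inj fin(5) card(2) dS(2) \<rho>im(1,2)])
      (rule that; assumption)
  define N' where "N' = k + e + l"
  have N': "n + m - 2 * r + e = N'" unfolding nml(1-3) N'_def by simp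
  have nr: "n - r + e = k + e" "n - r = k" unfolding nml(1-3) by simp_all
  define \<tau> where "\<tau> = (\<lambda>i. if i < k then a + e + a + i else if i < k + e then a + (i - k) else a + a + i)"
  have \<tau>inj: "inj_on \<tau> {..<N'}" by (auto simp: \<tau>_def inj_on_def N'_def split: if_splits)
  have \<tau>img: "\<tau> ` {..<k + e} = S \<union> X" "\<tau> ` {k..<N'} = X \<union> U"
  proof -
    have "\<tau> ` {..<k} = S"
    proof safe
      fix j assume "j \<in> S"
      then have "j = \<tau> (j - (a + e + a))" "j - (a + e + a) \<in> {..<k}" by (auto simp: \<tau>_def S_def)
      then show "j \<in> \<tau> ` {..<k}" by blast
    qed (auto simp: \<tau>_def S_def)
    moreover have "\<tau> ` {k..<k + e} = X"
    proof safe
      fix j assume "j \<in> X"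
      then have "j = \<tau> (j - a + k)" "j - a + k \<in> {k..<k + e}" by (auto simp: \<tau>_def X_def)
      then show "j \<in> \<tau> ` {k..<k + e}" by blast
    qed (auto simp: \<tau>_def X_def)
    moreover have "\<tau> ` {k + e..<N'} = U"
    proof safe
      fix j assume "j \<in> U"
      then have "j = \<tau> (j - (a + a))" "j - (a + a) \<in> {k + e..<N'}" by (auto simp: \<tau>_def U_def N'_def)
      then show "j \<in> \<tau> ` {k + e..<N'}" by blast
    qed (auto simp: \<tau>_def U_def N'_def)
    moreover have "{..<k + e} = {..<k} \<union> {k..<k + e}" "{k..<N'} = {k..<k + e} \<union> {k + e..<N'}"
      by (auto simp: N'_def)
    ultimately show "\<tau> ` {..<k + e} = S \<union> X" "\<tau> ` {k..<N'} = X \<union> U" by (simp_all add: image_Un)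
  qed
  have \<tau>ran: "\<tau> ` {..<N'} = B"
  proof -
    have "{..<N'} = {..<k + e} \<union> {k..<N'}" by (auto simp: N'_def)
    then have "\<tau> ` {..<N'} = (S \<union> X) \<union> (X \<union> U)" unfolding \<tau>img[symmetric] by (metis image_Un)
    then show ?thesis by (auto simp: B_def)
  qed
  note HH = represents_contractionE[OF H(1) N'[symmetric] fin(6) \<tau>inj equalityD1[OF \<tau>ran] _ _ _ \<tau>img[folded nr]]
  have ac: "S \<union> X \<union> T1 = T1 \<union> X \<union> S" "X \<union> U \<union> T1 = T1 \<union> X \<union> U" "S \<union> X \<union> T2 = X \<union> T2 \<union> S" "X \<union> U \<union> T2 = X \<union> T2 \<union> U"
    by auto
  obtain \<eta>1 \<eta>2 where \<eta>: "inj_on \<eta>1 {..<n}" "inj_on \<eta>2 {..<m}" "\<eta>1 ` {..<n} = T1 \<union> X \<union> S" "\<eta>2 ` {..<m} = T1 \<union> X \<union> U"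
    and H1: "\<And>y. y \<in> space (coords B) \<Longrightarrow> H (pick {..<N'} \<tau> y) =
      (LINT t|coords T1. f (pick {..<n} \<eta>1 (merge B T1 (y, t))) * g (pick {..<m} \<eta>2 (merge B T1 (y, t))))"
    by (rule HH[OF fin(1) card(3) dis(5), unfolded ac]) (rule that; assumption)
  obtain \<theta>1 \<theta>2 where \<theta>: "inj_on \<theta>1 {..<n}" "inj_on \<theta>2 {..<m}" "\<theta>1 ` {..<n} = X \<union> T2 \<union> S" "\<theta>2 ` {..<m} = X \<union> T2 \<union> U"
    and H2: "\<And>y. y \<in> space (coords B) \<Longrightarrow> H (pick {..<N'} \<tau> y) =
      (LINT t|coords T2. f (pick {..<n} \<theta>1 (merge B T2 (y, t))) * g (pick {..<m} \<theta>2 (merge B T2 (y, t))))"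
    by (rule HH[OF fin(3) card(4) dis(6), unfolded ac]) (rule that; assumption)
  let ?f1 = "\<lambda>z. f (pick {..<n} \<alpha>1 z)"
  let ?f2 = "\<lambda>z. f (pick {..<n} \<alpha>2 z)"
  let ?g1 = "\<lambda>z. g (pick {..<m} \<beta>1 z)"
  let ?g2 = "\<lambda>z. g (pick {..<m} \<beta>2 z)"
  let ?f1' = "\<lambda>z. f (pick {..<n} \<eta>1 z)"
  let ?g1' = "\<lambda>z. g (pick {..<m} \<eta>2 z)"
  let ?f2' = "\<lambda>z. f (pick {..<n} \<theta>1 z)"
  let ?g2' = "\<lambda>z. g (pick {..<m} \<theta>2 z)"
  let ?H = "\<lambda>z. H (pick {..<N'} \<tau> z)"
  have sub: "T1 \<union> X \<union> S \<subseteq> B \<union> T1" "T1 \<union> X \<union> U \<subseteq> B \<union> T1" "X \<union> T2 \<union> S \<subseteq> B \<union> T2" "X \<union> T2 \<union> U \<subseteq> B \<union> T2"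
    by (auto simp: B_def)
  have [measurable]: "pick {..<n} \<alpha>1 \<in> coords (B \<union> T1) \<rightarrow>\<^sub>M coords {..<n}" "pick {..<m} \<beta>1 \<in> coords (B \<union> T1) \<rightarrow>\<^sub>M coords {..<m}"
    "pick {..<n} \<alpha>2 \<in> coords (B \<union> T2) \<rightarrow>\<^sub>M coords {..<n}" "pick {..<m} \<beta>2 \<in> coords (B \<union> T2) \<rightarrow>\<^sub>M coords {..<m}"
    "pick {..<n} \<eta>1 \<in> coords (B \<union> T1) \<rightarrow>\<^sub>M coords {..<n}" "pick {..<m} \<eta>2 \<in> coords (B \<union> T1) \<rightarrow>\<^sub>M coords {..<m}"
    "pick {..<n} \<theta>1 \<in> coords (B \<union> T2) \<rightarrow>\<^sub>M coords {..<n}" "pick {..<m} \<theta>2 \<in> coords (B \<union> T2) \<rightarrow>\<^sub>M coords {..<m}"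
    using \<alpha> \<beta> \<eta> \<theta> sub by (auto intro!: measurable_pick)
  \<comment> \<open>The value of \<open>H\<close>, with its integrated variables labelled once by \<open>T1\<close> and once by \<open>T2\<close>.\<close>
  define h1 where "h1 = (\<lambda>y. LINT t|coords T1. ?f1 (merge B T1 (y, t)) * ?g1 (merge B T1 (y, t)))"
  define h2 where "h2 = (\<lambda>y. LINT t|coords T2. ?f2 (merge B T2 (y, t)) * ?g2 (merge B T2 (y, t)))"
  interpret T1: sigma_finite_measure "coords T1" by (rule sigma_finite_coords) simp
  interpret T2: sigma_finite_measure "coords T2" by (rule sigma_finite_coords) simp
  have hm [measurable]: "h1 \<in> borel_measurable (coords B)" "h2 \<in> borel_measurable (coords B)"
    unfolding h1_def h2_def by measurable
  have Hh1: "AE y in coords B. ?H y = h1 y"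
  proof -
    have "AE w in coords (B \<union> T1). ?f1' w = ?f1 w \<and> ?g1' w = ?g1 w"
      using symmetric_kernel_pick[OF f(2) _ sub(1) \<eta>(1,3) \<alpha>(1,3)] symmetric_kernel_pick[OF g(2) _ sub(2) \<eta>(2,4) \<beta>(2,4)]
      by simp
    from AE_merge[OF _ _ _ this] dis have "AE y in coords B. AE t in coords T1.
       ?f1' (merge B T1 (y, t)) = ?f1 (merge B T1 (y, t)) \<and>
       ?g1' (merge B T1 (y, t)) = ?g1 (merge B T1 (y, t))" by simp
    then show ?thesis
    proof (rule AE_mp[OF _ AE_I2], intro impI)
      fix y assume y [measurable]: "y \<in> space (coords B)" and ae: "AE t in coords T1.
         ?f1' (merge B T1 (y, t)) = ?f1 (merge B T1 (y, t)) \<and>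
         ?g1' (merge B T1 (y, t)) = ?g1 (merge B T1 (y, t))"
      show "?H y = h1 y"
        unfolding H1[OF y] h1_def by (rule integral_cong_AE) (measurable, use ae in auto)
    qed
  qed
  have Hh2: "AE y in coords B. cnj (?H y) = h2 y"
  proof -
    have "AE w in coords (B \<union> T2). cnj (?f2' w) = ?f2 w \<and> cnj (?g2' w) = ?g2 w"
      using symmetric_kernel_pick[OF f(2) _ sub(3) \<theta>(1,3) \<alpha>(2,4)] symmetric_kernel_pick[OF g(2) _ sub(4) \<theta>(2,4) \<beta>(1,3)]
      by (auto simp: Reals_cnj_iff)
    from AE_merge[OF _ _ _ this] dis have "AE y in coords B. AE t in coords T2.
       cnj (?f2' (merge B T2 (y, t))) = ?f2 (merge B T2 (y, t)) \<and>
       cnj (?g2' (merge B T2 (y, t))) = ?g2 (merge B T2 (y, t))" by simp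
    then show ?thesis
    proof (rule AE_mp[OF _ AE_I2], intro impI)
      fix y assume y [measurable]: "y \<in> space (coords B)" and ae: "AE t in coords T2.
         cnj (?f2' (merge B T2 (y, t))) = ?f2 (merge B T2 (y, t)) \<and>
         cnj (?g2' (merge B T2 (y, t))) = ?g2 (merge B T2 (y, t))"
      show "cnj (?H y) = h2 y"
        unfolding H2[OF y] h2_def Bochner_Integration.integral_cnj[symmetric] by (rule integral_cong_AE) (measurable, use ae in auto)
    qed
  qed
  define \<Psi> where "\<Psi> = (\<lambda>z. F z * G (pick {..<N} \<rho> z))"
  have [measurable]: "pick {..<N} \<rho> \<in> coords {..<N} \<rightarrow>\<^sub>M coords {..<N}" using \<rho>inj by (auto intro!: measurable_pick)
  have bij\<rho>: "bij_betw \<rho> {..<N} {..<N}" using \<rho>inj by (simp add: bij_betw_def endo_inj_surj)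
  have \<Psi>int: "integrable (coords {..<N}) \<Psi>"
    unfolding \<Psi>_def
  proof (rule integrable_mult_of_L2)
    show "integrable (coords {..<N}) (\<lambda>x. (cmod (F x))\<^sup>2)" using F(2) unfolding N by (simp add: L2_kernels_def orthant_eq_coords)
    have "integrable (coords {..<N}) (\<lambda>x. complex_of_real ((cmod (G x))\<^sup>2))"
      using G(2) unfolding N by (intro integrable_of_real) (simp add: L2_kernels_def orthant_eq_coords)
    then have "integrable (coords {..<N}) (\<lambda>x. complex_of_real ((cmod (G (pick {..<N} \<rho> x)))\<^sup>2))"
      by (subst integrable_pick[OF finite_lessThan bij\<rho>, where F = "\<lambda>x. complex_of_real ((cmod (G x))\<^sup>2)"]) auto
    from integrable_Re[OF this] show "integrable (coords {..<N}) (\<lambda>x. (cmod (G (pick {..<N} \<rho> x)))\<^sup>2)" by simp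
  qed measurable
  have \<Psi>m [measurable]: "\<Psi> \<in> borel_measurable (coords (X \<union> (T1 \<union> T2)))" unfolding L[symmetric] \<Psi>_def by measurable
  have Hm [measurable]: "H \<in> borel_measurable (coords {..<N'})" "pick {..<N'} \<tau> \<in> coords B \<rightarrow>\<^sub>M coords {..<N'}"
    using H(2) \<tau>ran unfolding N' by (auto simp: L2_kernels_def orthant_eq_coords intro!: measurable_pick)
  have HHint: "integrable (coords {..<N'}) (\<lambda>t. H t * cnj (H t))"
    using H(2) unfolding N' by (intro integrable_mult_of_L2) (auto simp: L2_kernels_def orthant_eq_coords)
  have bij\<tau>: "bij_betw \<tau> {..<N'} B" using \<tau>inj \<tau>ran by (simp add: bij_betw_def)
  have hm' [measurable]: "h1 \<in> borel_measurable (coords (X \<union> (S \<union> U)))" "h2 \<in> borel_measurable (coords (X \<union> (S \<union> U)))"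
    using hm by (simp_all add: B_def)
  have HHm: "(\<lambda>t. H t * cnj (H t)) \<in> borel_measurable (coords {..<N'})" by measurable
  have h12: "AE y in coords B. ?H y * cnj (?H y) = h1 y * h2 y"
    using Hh1 Hh2 by eventually_elim simp
  have hint: "integrable (coords B) (\<lambda>y. h1 y * h2 y)"
    using HHint h12 by (subst integrable_cong_AE[OF _ _ AE_symmetric[OF h12]])
      (auto simp: integrable_pick[OF finite_lessThan bij\<tau> HHm])
  have lhs: "(LINT t|orthant (2 * r - e). F t * G (\<lambda>i\<in>{..<2 * r - e}. t (2 * r - e - 1 - i)))
     = (LINT x|coords X. LINT p|(coords T1 \<Otimes>\<^sub>M coords T2). \<Psi> (merge X (T1 \<union> T2) (x, merge T1 T2 p)))"
  proof -
    have "(LINT t|orthant (2 * r - e). F t * G (\<lambda>i\<in>{..<2 * r - e}. t (2 * r - e - 1 - i))) = (LINT z|coords (X \<union> (T1 \<union> T2)). \<Psi> z)"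
      unfolding L[symmetric] N by (simp add: \<Psi>_def pick_def \<rho>_def orthant_eq_coords)
    also have "\<dots> = (LINT x|coords X. LINT y|coords (T1 \<union> T2). \<Psi> (merge X (T1 \<union> T2) (x, y)))"
      by (rule coords.product_integral_fold) (use dis \<Psi>int L in auto)
    also have "\<dots> = (LINT x|coords X. LINT p|(coords T1 \<Otimes>\<^sub>M coords T2). \<Psi> (merge X (T1 \<union> T2) (x, merge T1 T2 p)))"
    proof (rule Bochner_Integration.integral_cong[OF refl])
      fix x assume [measurable]: "x \<in> space (coords X)"
      show "(LINT y|coords (T1 \<union> T2). \<Psi> (merge X (T1 \<union> T2) (x, y))) = (LINT p|(coords T1 \<Otimes>\<^sub>M coords T2). \<Psi> (merge X (T1 \<union> T2) (x, merge T1 T2 p)))"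
        by (rule integral_merge_pair) (use dis in \<open>simp_all, measurable\<close>)
    qed
    finally show ?thesis .
  qed
  have rhs: "complex_of_real (LINT t|orthant N'. (cmod (H t))\<^sup>2)
    = (LINT x|coords X. LINT q|(coords S \<Otimes>\<^sub>M coords U). h1 (merge X (S \<union> U) (x, merge S U q)) * h2 (merge X (S \<union> U) (x, merge S U q)))"
  proof -
    have "complex_of_real (LINT t|orthant N'. (cmod (H t))\<^sup>2) = (LINT t|coords {..<N'}. H t * cnj (H t))"
      by (simp add: orthant_eq_coords complex_norm_square[symmetric] del: of_real_power)
    also have "\<dots> = (LINT y|coords B. ?H y * cnj (?H y))"
      by (rule integral_pick[OF finite_lessThan bij\<tau> HHm, symmetric])
    also have "\<dots> = (LINT y|coords B. h1 y * h2 y)"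
      by (rule integral_cong_AE) (use h12 in auto)
    also have "\<dots> = (LINT x|coords X. LINT y|coords (S \<union> U). h1 (merge X (S \<union> U) (x, y)) * h2 (merge X (S \<union> U) (x, y)))"
      unfolding B_def by (rule coords.product_integral_fold) (use dis hint in \<open>auto simp: B_def\<close>)
    also have "\<dots> = (LINT x|coords X. LINT q|(coords S \<Otimes>\<^sub>M coords U). h1 (merge X (S \<union> U) (x, merge S U q)) * h2 (merge X (S \<union> U) (x, merge S U q)))"
    proof (rule Bochner_Integration.integral_cong[OF refl])
      fix x assume [measurable]: "x \<in> space (coords X)"
      show "(LINT y|coords (S \<union> U). h1 (merge X (S \<union> U) (x, y)) * h2 (merge X (S \<union> U) (x, y)))
        = (LINT q|(coords S \<Otimes>\<^sub>M coords U). h1 (merge X (S \<union> U) (x, merge S U q)) * h2 (merge X (S \<union> U) (x, merge S U q)))"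
        by (rule integral_merge_pair) (use dis in \<open>simp_all, measurable\<close>)
    qed
    finally show ?thesis .
  qed
  have key: "AE x in coords X. (LINT p|(coords T1 \<Otimes>\<^sub>M coords T2). \<Psi> (merge X (T1 \<union> T2) (x, merge T1 T2 p)))
    = (LINT q|(coords S \<Otimes>\<^sub>M coords U). h1 (merge X (S \<union> U) (x, merge S U q)) * h2 (merge X (S \<union> U) (x, merge S U q)))"
  proof -
    define fs where "fs = (\<lambda>\<alpha> T x p. f (pick {..<n} \<alpha> (merge X (T \<union> S) (x, merge T S p))))"
    define gs where "gs = (\<lambda>\<beta> T x p. g (pick {..<m} \<beta> (merge X (T \<union> U) (x, merge T U p))))"
    have 1: "AE x in coords X. (\<integral>\<^sup>+t. \<integral>\<^sup>+s. (ennreal (cmod (fs \<alpha>1 T1 x (t, s))))\<^sup>2 \<partial>coords S \<partial>coords T1) < \<infinity>"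
      unfolding fs_def by (rule slice_nn_integral) (use f dis \<alpha> in auto)
    have 2: "AE x in coords X. (\<integral>\<^sup>+t. \<integral>\<^sup>+s. (ennreal (cmod (fs \<alpha>2 T2 x (t, s))))\<^sup>2 \<partial>coords S \<partial>coords T2) < \<infinity>"
      unfolding fs_def by (rule slice_nn_integral) (use f dis \<alpha> in auto)
    have 3: "AE x in coords X. (\<integral>\<^sup>+t. \<integral>\<^sup>+s. (ennreal (cmod (gs \<beta>1 T1 x (t, s))))\<^sup>2 \<partial>coords U \<partial>coords T1) < \<infinity>"
      unfolding gs_def by (rule slice_nn_integral) (use g dis \<beta> in auto)
    have 4: "AE x in coords X. (\<integral>\<^sup>+t. \<integral>\<^sup>+s. (ennreal (cmod (gs \<beta>2 T2 x (t, s))))\<^sup>2 \<partial>coords U \<partial>coords T2) < \<infinity>"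
      unfolding gs_def by (rule slice_nn_integral) (use g dis \<beta> in auto)
    from 1 2 3 4 AE_space show ?thesis
    proof eventually_elim
      case (elim x)
      note x [measurable] = elim(5)
      have [measurable]: "pick {..<n} \<alpha>1 \<in> coords (X \<union> (T1 \<union> S)) \<rightarrow>\<^sub>M coords {..<n}" "pick {..<m} \<beta>1 \<in> coords (X \<union> (T1 \<union> U)) \<rightarrow>\<^sub>M coords {..<m}"
        "pick {..<n} \<alpha>2 \<in> coords (X \<union> (T2 \<union> S)) \<rightarrow>\<^sub>M coords {..<n}" "pick {..<m} \<beta>2 \<in> coords (X \<union> (T2 \<union> U)) \<rightarrow>\<^sub>M coords {..<m}"
        using \<alpha> \<beta> by (auto intro!: measurable_pick)
      have "(LINT p|(coords T1 \<Otimes>\<^sub>M coords T2). \<Psi> (merge X (T1 \<union> T2) (x, merge T1 T2 p)))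
        = (LINT p|(coords T1 \<Otimes>\<^sub>M coords T2). (LINT s|coords S. fs \<alpha>1 T1 x (fst p, s) * fs \<alpha>2 T2 x (snd p, s)) *
             (LINT u|coords U. gs \<beta>1 T1 x (fst p, u) * gs \<beta>2 T2 x (snd p, u)))"
      proof (rule Bochner_Integration.integral_cong[OF refl])
        fix p assume p: "p \<in> space (coords T1 \<Otimes>\<^sub>M coords T2)"
        define z where "z = merge X (T1 \<union> T2) (x, merge T1 T2 p)"
        have "merge T1 T2 (fst p, snd p) \<in> space (coords (T1 \<union> T2))"
          by (rule merge_in_space) (use p in \<open>auto simp: space_pair_measure\<close>)
        then have z: "z \<in> space (coords {..<N})" unfolding L z_def using x by (intro merge_in_space) auto
        have a1: "pick {..<n} \<alpha>1 (merge {..<N} S (z, s)) = pick {..<n} \<alpha>1 (merge X (T1 \<union> S) (x, merge T1 S (fst p, s)))" for s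
          by (rule pick_cong, drule imageI[of _ _ \<alpha>1], unfold \<alpha>(3) L z_def) (auto simp: merge_def case_prod_beta intervals)
        have a2: "pick {..<n} \<alpha>2 (merge {..<N} S (z, s)) = pick {..<n} \<alpha>2 (merge X (T2 \<union> S) (x, merge T2 S (snd p, s)))" for s
          by (rule pick_cong, drule imageI[of _ _ \<alpha>2], unfold \<alpha>(4) L z_def) (auto simp: merge_def case_prod_beta intervals)
        have b1: "pick {..<m} \<beta>1 (merge {..<N} U (z, s)) = pick {..<m} \<beta>1 (merge X (T1 \<union> U) (x, merge T1 U (fst p, s)))" for s
          by (rule pick_cong, drule imageI[of _ _ \<beta>1], unfold \<beta>(4) L z_def) (auto simp: merge_def case_prod_beta intervals)
        have b2: "pick {..<m} \<beta>2 (merge {..<N} U (z, s)) = pick {..<m} \<beta>2 (merge X (T2 \<union> U) (x, merge T2 U (snd p, s)))" for s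
          by (rule pick_cong, drule imageI[of _ _ \<beta>2], unfold \<beta>(3) L z_def) (auto simp: merge_def case_prod_beta intervals)
        show "\<Psi> (merge X (T1 \<union> T2) (x, merge T1 T2 p)) = (LINT s|coords S. fs \<alpha>1 T1 x (fst p, s) * fs \<alpha>2 T2 x (snd p, s)) *
             (LINT u|coords U. gs \<beta>1 T1 x (fst p, u) * gs \<beta>2 T2 x (snd p, u))"
          unfolding z_def[symmetric] \<Psi>_def Gz[OF z] Fz[OF z, unfolded pick_id[OF z id_apply]] a1 a2 b1 b2 fs_def gs_def
          by (simp add: mult.commute)
      qed
      also have "\<dots> = (LINT q|(coords S \<Otimes>\<^sub>M coords U). (LINT t|coords T1. fs \<alpha>1 T1 x (t, fst q) * gs \<beta>1 T1 x (t, snd q)) *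
           (LINT t|coords T2. fs \<alpha>2 T2 x (t, fst q) * gs \<beta>2 T2 x (t, snd q)))"
        by (rule Fubini_four_cycle[OF _ _ _ _ _ _ _ _ elim(1-4)])
          (auto intro: sigma_finite_coords, unfold fs_def gs_def, measurable)
      also have "\<dots> = (LINT q|(coords S \<Otimes>\<^sub>M coords U). h1 (merge X (S \<union> U) (x, merge S U q)) * h2 (merge X (S \<union> U) (x, merge S U q)))"
      proof (rule Bochner_Integration.integral_cong[OF refl])
        fix q :: "(nat \<Rightarrow> real) \<times> (nat \<Rightarrow> real)"
        define y where "y = merge X (S \<union> U) (x, merge S U q)"
        have a1: "pick {..<n} \<alpha>1 (merge B T1 (y, t)) = pick {..<n} \<alpha>1 (merge X (T1 \<union> S) (x, merge T1 S (t, fst q)))" for t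
          by (rule pick_cong, drule imageI[of _ _ \<alpha>1], unfold \<alpha>(3) B_def y_def) (auto simp: merge_def case_prod_beta intervals)
        have a2: "pick {..<n} \<alpha>2 (merge B T2 (y, t)) = pick {..<n} \<alpha>2 (merge X (T2 \<union> S) (x, merge T2 S (t, fst q)))" for t
          by (rule pick_cong, drule imageI[of _ _ \<alpha>2], unfold \<alpha>(4) B_def y_def) (auto simp: merge_def case_prod_beta intervals)
        have b1: "pick {..<m} \<beta>1 (merge B T1 (y, t)) = pick {..<m} \<beta>1 (merge X (T1 \<union> U) (x, merge T1 U (t, snd q)))" for t
          by (rule pick_cong, drule imageI[of _ _ \<beta>1], unfold \<beta>(4) B_def y_def) (auto simp: merge_def case_prod_beta intervals)
        have b2: "pick {..<m} \<beta>2 (merge B T2 (y, t)) = pick {..<m} \<beta>2 (merge X (T2 \<union> U) (x, merge T2 U (t, snd q)))" for t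
          by (rule pick_cong, drule imageI[of _ _ \<beta>2], unfold \<beta>(3) B_def y_def) (auto simp: merge_def case_prod_beta intervals)
        show "(LINT t|coords T1. fs \<alpha>1 T1 x (t, fst q) * gs \<beta>1 T1 x (t, snd q)) *
           (LINT t|coords T2. fs \<alpha>2 T2 x (t, fst q) * gs \<beta>2 T2 x (t, snd q)) = h1 (merge X (S \<union> U) (x, merge S U q)) * h2 (merge X (S \<union> U) (x, merge S U q))"
          unfolding y_def[symmetric] h1_def h2_def a1 a2 b1 b2 fs_def gs_def ..
      qed
      finally show ?case .
    qed
  qed
  interpret T12: sigma_finite_measure "coords T1 \<Otimes>\<^sub>M coords T2"
    by (rule sigma_finite_pair_measure) (auto intro: sigma_finite_coords)
  interpret SU: sigma_finite_measure "coords S \<Otimes>\<^sub>M coords U"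
    by (rule sigma_finite_pair_measure) (auto intro: sigma_finite_coords)
  show ?thesis unfolding lhs rhs[folded N']
    by (rule integral_cong_AE) (use key in \<open>auto, measurable\<close>)
qed

section \<open>Separated kernels\<close>

text \<open>Three kernels in a triangle: \<open>h\<close> and \<open>v\<close> share \<open>S1\<close>, \<open>h\<close> and \<open>w\<close> share \<open>S2\<close>, \<open>v\<close> and \<open>w\<close> share
  \<open>R\<close>. For almost every choice of the free variables the product is integrable over \<open>S1\<close>, \<open>S2\<close> and \<open>R\<close>
  together, so the integral over \<open>S1\<close>, which vanishes, may be taken first.\<close>

lemma iterated_contraction_null:
  fixes h v w :: kernel
  assumes h: "h \<in> L2_kernels k" "inj_on \<rho> {..<k}" "\<rho> ` {..<k} \<subseteq> A \<union> (S1 \<union> S2)" "S1 \<union> S2 \<subseteq> \<rho> ` {..<k}"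
    and v: "v \<in> L2_kernels l" "inj_on \<tau>1 {..<l}" "\<tau>1 ` {..<l} \<subseteq> A \<union> (S1 \<union> R)" "S1 \<union> R \<subseteq> \<tau>1 ` {..<l}"
    and w: "w \<in> L2_kernels m" "inj_on \<tau>2 {..<m}" "\<tau>2 ` {..<m} \<subseteq> A \<union> (S2 \<union> R)" "S2 \<union> R \<subseteq> \<tau>2 ` {..<m}"
    and fin: "finite A" "finite S1" "finite S2" "finite R"
    and dis: "A \<inter> S1 = {}" "A \<inter> S2 = {}" "A \<inter> R = {}" "S1 \<inter> S2 = {}" "S1 \<inter> R = {}" "S2 \<inter> R = {}"
    and null: "AE y in coords (A \<union> (S2 \<union> R)). (LINT s|coords S1. h (pick {..<k} \<rho> (merge (A \<union> (S2 \<union> R)) S1 (y, s))) *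
        v (pick {..<l} \<tau>1 (merge (A \<union> (S2 \<union> R)) S1 (y, s)))) = 0"
  shows "AE z in coords A. (LINT s|coords (S1 \<union> S2). h (pick {..<k} \<rho> (merge A (S1 \<union> S2) (z, s))) *
      (LINT r|coords R. v (pick {..<l} \<tau>1 (merge (A \<union> (S1 \<union> S2)) R (merge A (S1 \<union> S2) (z, s), r))) *
         w (pick {..<m} \<tau>2 (merge (A \<union> (S1 \<union> S2)) R (merge A (S1 \<union> S2) (z, s), r))))) = 0"
proof -
  let ?h = "\<lambda>z. h (pick {..<k} \<rho> z)"
  let ?v = "\<lambda>z. v (pick {..<l} \<tau>1 z)"
  let ?w = "\<lambda>z. w (pick {..<m} \<tau>2 z)"
  have \<rho>r: "\<rho> i \<in> A \<or> \<rho> i \<in> S1 \<or> \<rho> i \<in> S2" if "i < k" for i using h(3) that by auto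
  have \<tau>1r: "\<tau>1 i \<in> A \<or> \<tau>1 i \<in> S1 \<or> \<tau>1 i \<in> R" if "i < l" for i using v(3) that by auto
  have \<tau>2r: "\<tau>2 i \<in> A \<or> \<tau>2 i \<in> S2 \<or> \<tau>2 i \<in> R" if "i < m" for i using w(3) that by auto
  have D: "j \<in> S1 \<Longrightarrow> j \<notin> A" "j \<in> S2 \<Longrightarrow> j \<notin> A" "j \<in> R \<Longrightarrow> j \<notin> A" "j \<in> S2 \<Longrightarrow> j \<notin> S1" "j \<in> R \<Longrightarrow> j \<notin> S1" "j \<in> R \<Longrightarrow> j \<notin> S2" for j
    using dis by auto
  have [measurable]: "h \<in> borel_measurable (coords {..<k})" "v \<in> borel_measurable (coords {..<l})" "w \<in> borel_measurable (coords {..<m})"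
    using h v w by (auto simp: L2_kernels_def orthant_eq_coords)
  define V where "V = S1 \<union> (S2 \<union> R)"
  have V: "V = (S1 \<union> S2) \<union> R" "V = (S2 \<union> R) \<union> S1" "V = S1 \<union> (S2 \<union> R)" "finite V" using fin by (auto simp: V_def)
  have [measurable]: "pick {..<k} \<rho> \<in> coords (A \<union> V) \<rightarrow>\<^sub>M coords {..<k}" "pick {..<l} \<tau>1 \<in> coords (A \<union> V) \<rightarrow>\<^sub>M coords {..<l}"
     "pick {..<m} \<tau>2 \<in> coords (A \<union> V) \<rightarrow>\<^sub>M coords {..<m}"
     "pick {..<k} \<rho> \<in> coords (A \<union> (S1 \<union> S2)) \<rightarrow>\<^sub>M coords {..<k}" "pick {..<l} \<tau>1 \<in> coords (A \<union> (S1 \<union> R)) \<rightarrow>\<^sub>M coords {..<l}"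
     "pick {..<m} \<tau>2 \<in> coords (A \<union> (S2 \<union> R)) \<rightarrow>\<^sub>M coords {..<m}"
    using h(3) v(3) w(3) by (auto simp: V_def intro!: measurable_pick)
  have sf: "sigma_finite_measure (coords S1)" "sigma_finite_measure (coords S2)" "sigma_finite_measure (coords R)"
    using fin by (auto intro: sigma_finite_coords)
  have 1: "AE z in coords A. (\<integral>\<^sup>+s1. \<integral>\<^sup>+s2. (ennreal (cmod (?h (merge A (S1 \<union> S2) (z, merge S1 S2 (s1, s2))))))\<^sup>2 \<partial>coords S2 \<partial>coords S1) < \<infinity>"
    by (rule slice_nn_integral) (use h fin dis in auto)
  have 2: "AE z in coords A. (\<integral>\<^sup>+s1. \<integral>\<^sup>+r. (ennreal (cmod (?v (merge A (S1 \<union> R) (z, merge S1 R (s1, r))))))\<^sup>2 \<partial>coords R \<partial>coords S1) < \<infinity>"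
    by (rule slice_nn_integral) (use v fin dis in auto)
  have 3: "AE z in coords A. (\<integral>\<^sup>+s2. \<integral>\<^sup>+r. (ennreal (cmod (?w (merge A (S2 \<union> R) (z, merge S2 R (s2, r))))))\<^sup>2 \<partial>coords R \<partial>coords S2) < \<infinity>"
    by (rule slice_nn_integral) (use w fin dis in auto)
  have disA: "A \<inter> (S2 \<union> R) = {}" using dis by auto
  have 4: "AE z in coords A. AE y in coords (S2 \<union> R). (LINT s|coords S1. ?h (merge (A \<union> (S2 \<union> R)) S1 (merge A (S2 \<union> R) (z, y), s)) *
        ?v (merge (A \<union> (S2 \<union> R)) S1 (merge A (S2 \<union> R) (z, y), s))) = 0"
    by (rule AE_merge[OF _ _ disA null]) (use fin in auto)
  from 1 2 3 4 AE_space show ?thesis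
  proof eventually_elim
    case (elim z)
    note z [measurable] = elim(5)
    define \<Psi> where "\<Psi> = (\<lambda>x. ?h (merge A V (z, x)) * (?v (merge A V (z, x)) * ?w (merge A V (z, x))))"
    have \<Psi>m [measurable]: "\<Psi> \<in> borel_measurable (coords V)" unfolding \<Psi>_def by measurable
    have \<Psi>int: "integrable (coords V) \<Psi>"
    proof (rule integrableI_bounded[OF \<Psi>m])
      define a where "a = (\<lambda>p. ennreal (cmod (?h (merge A (S1 \<union> S2) (z, merge S1 S2 p)))))"
      define b where "b = (\<lambda>p. ennreal (cmod (?v (merge A (S1 \<union> R) (z, merge S1 R p)))))"
      define c where "c = (\<lambda>p. ennreal (cmod (?w (merge A (S2 \<union> R) (z, merge S2 R p)))))"
      have abc [measurable]: "a \<in> borel_measurable (coords S1 \<Otimes>\<^sub>M coords S2)" "b \<in> borel_measurable (coords S1 \<Otimes>\<^sub>M coords R)"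
        "c \<in> borel_measurable (coords S2 \<Otimes>\<^sub>M coords R)"
        unfolding a_def b_def c_def by measurable
      have \<Psi>m' [measurable]: "\<Psi> \<in> borel_measurable (coords (S1 \<union> (S2 \<union> R)))" using \<Psi>m by (simp add: V_def)
      have "(\<integral>\<^sup>+x. ennreal (norm (\<Psi> x)) \<partial>coords V) = (\<integral>\<^sup>+s1. \<integral>\<^sup>+y. ennreal (norm (\<Psi> (merge S1 (S2 \<union> R) (s1, y)))) \<partial>coords (S2 \<union> R) \<partial>coords S1)"
        unfolding V(3) using fin dis by (subst coords.product_nn_integral_fold) auto
      also have "\<dots> = (\<integral>\<^sup>+s1. \<integral>\<^sup>+s2. \<integral>\<^sup>+r. a (s1, s2) * (b (s1, r) * c (s2, r)) \<partial>coords R \<partial>coords S2 \<partial>coords S1)"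
      proof (rule nn_integral_cong)
        fix s1 assume s1 [measurable]: "s1 \<in> space (coords S1)"
        have fold: "(\<integral>\<^sup>+y. ennreal (norm (\<Psi> (merge S1 (S2 \<union> R) (s1, y)))) \<partial>coords (S2 \<union> R))
          = (\<integral>\<^sup>+s2. \<integral>\<^sup>+r. ennreal (norm (\<Psi> (merge S1 (S2 \<union> R) (s1, merge S2 R (s2, r))))) \<partial>coords R \<partial>coords S2)"
          using fin dis by (subst coords.product_nn_integral_fold) auto
        have abc_eq: "ennreal (norm (\<Psi> (merge S1 (S2 \<union> R) (s1, merge S2 R (s2, r))))) = a (s1, s2) * (b (s1, r) * c (s2, r))" for s2 r
        proof -
          have "pick {..<k} \<rho> (merge A V (z, merge S1 (S2 \<union> R) (s1, merge S2 R (s2, r)))) = pick {..<k} \<rho> (merge A (S1 \<union> S2) (z, merge S1 S2 (s1, s2)))"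
            by (rule pick_cong, drule lessThan_iff[THEN iffD1], drule \<rho>r, elim disjE; simp add: merge_def V_def D)
          moreover have "pick {..<l} \<tau>1 (merge A V (z, merge S1 (S2 \<union> R) (s1, merge S2 R (s2, r)))) = pick {..<l} \<tau>1 (merge A (S1 \<union> R) (z, merge S1 R (s1, r)))"
            by (rule pick_cong, drule lessThan_iff[THEN iffD1], drule \<tau>1r, elim disjE; simp add: merge_def V_def D)
          moreover have "pick {..<m} \<tau>2 (merge A V (z, merge S1 (S2 \<union> R) (s1, merge S2 R (s2, r)))) = pick {..<m} \<tau>2 (merge A (S2 \<union> R) (z, merge S2 R (s2, r)))"
            by (rule pick_cong, drule lessThan_iff[THEN iffD1], drule \<tau>2r, elim disjE; simp add: merge_def V_def D)
          ultimately show ?thesis by (simp add: \<Psi>_def a_def b_def c_def norm_mult ennreal_mult)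
        qed
        show "(\<integral>\<^sup>+y. ennreal (norm (\<Psi> (merge S1 (S2 \<union> R) (s1, y)))) \<partial>coords (S2 \<union> R)) = (\<integral>\<^sup>+s2. \<integral>\<^sup>+r. a (s1, s2) * (b (s1, r) * c (s2, r)) \<partial>coords R \<partial>coords S2)"
          unfolding fold abc_eq ..
      qed
      also have "\<dots> < \<infinity>"
        by (rule Cauchy_Schwarz_triangle[OF sf abc]) (use elim(1-3) in \<open>simp_all add: a_def b_def c_def\<close>)
      finally show "(\<integral>\<^sup>+x. ennreal (norm (\<Psi> x)) \<partial>coords V) < \<infinity>" .
    qed
    have "(LINT s|coords (S1 \<union> S2). ?h (merge A (S1 \<union> S2) (z, s)) *
      (LINT r|coords R. ?v (merge (A \<union> (S1 \<union> S2)) R (merge A (S1 \<union> S2) (z, s), r)) *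
         ?w (merge (A \<union> (S1 \<union> S2)) R (merge A (S1 \<union> S2) (z, s), r))))
      = (LINT s|coords (S1 \<union> S2). LINT r|coords R. \<Psi> (merge (S1 \<union> S2) R (s, r)))"
    proof (rule Bochner_Integration.integral_cong[OF refl])
      fix s
      have "\<Psi> (merge (S1 \<union> S2) R (s, r)) = ?h (merge A (S1 \<union> S2) (z, s)) *
         (?v (merge (A \<union> (S1 \<union> S2)) R (merge A (S1 \<union> S2) (z, s), r)) *
         ?w (merge (A \<union> (S1 \<union> S2)) R (merge A (S1 \<union> S2) (z, s), r)))" for r
      proof -
        have "pick {..<k} \<rho> (merge A V (z, merge (S1 \<union> S2) R (s, r))) = pick {..<k} \<rho> (merge A (S1 \<union> S2) (z, s))"
          by (rule pick_cong, drule lessThan_iff[THEN iffD1], drule \<rho>r, elim disjE; simp add: merge_def V_def D)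
        moreover have "merge A V (z, merge (S1 \<union> S2) R (s, r)) = merge (A \<union> (S1 \<union> S2)) R (merge A (S1 \<union> S2) (z, s), r)"
          by (auto simp: merge_def V_def fun_eq_iff)
        ultimately show ?thesis by (simp add: \<Psi>_def)
      qed
      then show "?h (merge A (S1 \<union> S2) (z, s)) *
      (LINT r|coords R. ?v (merge (A \<union> (S1 \<union> S2)) R (merge A (S1 \<union> S2) (z, s), r)) *
         ?w (merge (A \<union> (S1 \<union> S2)) R (merge A (S1 \<union> S2) (z, s), r)))
       = (LINT r|coords R. \<Psi> (merge (S1 \<union> S2) R (s, r)))" by simp
    qed
    also have "\<dots> = (LINT x|coords V. \<Psi> x)"
      unfolding V(1) by (rule coords.product_integral_fold[symmetric]) (use fin dis \<Psi>int in \<open>auto simp: V(1)\<close>)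
    also have "\<dots> = (LINT y|coords (S2 \<union> R). LINT s|coords S1. \<Psi> (merge (S2 \<union> R) S1 (y, s)))"
      unfolding V(2) by (rule coords.product_integral_fold) (use fin dis \<Psi>int in \<open>auto simp: V(2)[symmetric]\<close>)
    also have "\<dots> = 0"
    proof (rule integral_eq_zero_AE)
      from elim(4) show "AE y in coords (S2 \<union> R). (LINT s|coords S1. \<Psi> (merge (S2 \<union> R) S1 (y, s))) = 0"
      proof eventually_elim
        case (elim y)
        have "\<Psi> (merge (S2 \<union> R) S1 (y, s)) = ?w (merge A (S2 \<union> R) (z, y)) *
          (?h (merge (A \<union> (S2 \<union> R)) S1 (merge A (S2 \<union> R) (z, y), s)) *
           ?v (merge (A \<union> (S2 \<union> R)) S1 (merge A (S2 \<union> R) (z, y), s)))" for s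
        proof -
          have "pick {..<m} \<tau>2 (merge A V (z, merge (S2 \<union> R) S1 (y, s))) = pick {..<m} \<tau>2 (merge A (S2 \<union> R) (z, y))"
            by (rule pick_cong, drule lessThan_iff[THEN iffD1], drule \<tau>2r, elim disjE; simp add: merge_def V_def D)
          moreover have "merge A V (z, merge (S2 \<union> R) S1 (y, s)) = merge (A \<union> (S2 \<union> R)) S1 (merge A (S2 \<union> R) (z, y), s)"
            by (auto simp: merge_def V_def fun_eq_iff)
          ultimately show ?thesis by (simp add: \<Psi>_def)
        qed
        then show ?case using elim by simp
      qed
    qed
    finally show ?case .
  qed
qed

text \<open>Every way to identify a nonempty set of arguments of \<open>h\<close> with arguments of \<open>u\<close>, and to integrate
  them out, gives zero. The positions of these arguments are arbitrary and the label set \<open>A\<close> may be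
  larger than necessary, which is what makes the property stable under contractions.\<close>

definition separated :: "nat \<Rightarrow> kernel \<Rightarrow> nat \<Rightarrow> kernel \<Rightarrow> bool" where
  "separated k h l u \<longleftrightarrow>
    (\<forall>A S \<rho> \<tau>. finite A \<and> finite S \<and> A \<inter> S = {} \<and> S \<noteq> {} \<and>
       inj_on \<rho> {..<k} \<and> inj_on \<tau> {..<l} \<and> \<rho> ` {..<k} \<subseteq> A \<union> S \<and> \<tau> ` {..<l} \<subseteq> A \<union> S \<and>
       \<rho> ` {..<k} \<inter> \<tau> ` {..<l} = S \<longrightarrow>
     (AE z in coords A. (LINT s|coords S. h (pick {..<k} \<rho> (merge A S (z, s))) * u (pick {..<l} \<tau> (merge A S (z, s)))) = 0))"

lemma separatedD:
  assumes "separated k h l u" "finite A" "finite S" "A \<inter> S = {}" "S \<noteq> {}"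
    "inj_on \<rho> {..<k}" "inj_on \<tau> {..<l}" "\<rho> ` {..<k} \<subseteq> A \<union> S" "\<tau> ` {..<l} \<subseteq> A \<union> S"
    "\<rho> ` {..<k} \<inter> \<tau> ` {..<l} = S"
  shows "AE z in coords A. (LINT s|coords S. h (pick {..<k} \<rho> (merge A S (z, s))) * u (pick {..<l} \<tau> (merge A S (z, s)))) = 0"
  by (rule assms(1)[unfolded separated_def, rule_format]) (intro conjI assms(2-))

lemma separated_commute:
  assumes "separated k h l u" shows "separated l u k h"
  unfolding separated_def
proof (intro allI impI, elim conjE)
  fix A S :: "nat set" and \<rho> \<tau> :: "nat \<Rightarrow> nat"
  assume *: "finite A" "finite S" "A \<inter> S = {}" "S \<noteq> {}"
       "inj_on \<rho> {..<l}" "inj_on \<tau> {..<k}" "\<rho> ` {..<l} \<subseteq> A \<union> S" "\<tau> ` {..<k} \<subseteq> A \<union> S"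
       "\<rho> ` {..<l} \<inter> \<tau> ` {..<k} = S"
  have "AE z in coords A. (LINT s|coords S. h (pick {..<k} \<tau> (merge A S (z, s))) * u (pick {..<l} \<rho> (merge A S (z, s)))) = 0"
    by (rule separatedD[OF assms *(1-4) *(6,5,8,7)]) (use *(9) in auto)
  then show "AE z in coords A. (LINT s|coords S. u (pick {..<l} \<rho> (merge A S (z, s))) * h (pick {..<k} \<tau> (merge A S (z, s)))) = 0"
    by (simp only: mult.commute)
qed

text \<open>Let \<open>S\<close> be the variables that \<open>h\<close> shares with the contraction \<open>u\<close> of \<open>u1\<close> and \<open>u2\<close>. They split
  into those that sit in \<open>u1\<close> and those that sit in \<open>u2\<close>. As soon as one of the two parts is nonempty
  and integrates to zero against \<open>h\<close>, \<open>iterated_contraction_null\<close> applies. The case distinction keeps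
  the hypothesis on \<open>u2\<close> out of the way when the shared variables reach into \<open>u1\<close>, as they do for a
  word whose first letter is \<open>u1\<close>.\<close>

lemma contraction_step:
  assumes h: "h \<in> L2_kernels k" and u1: "u1 \<in> L2_kernels l1" and u2: "u2 \<in> L2_kernels l2"
    and q: "q \<le> l1" "q \<le> l2"
    and u: "represents_contraction 0 l1 l2 q u1 u2 u"
    and A: "finite A" "finite S" "A \<inter> S = {}" "S \<noteq> {}"
    and \<rho>: "inj_on \<rho> {..<k}" "\<rho> ` {..<k} \<subseteq> A \<union> S"
    and \<tau>: "inj_on \<tau> {..<l1 + l2 - 2 * q}" "\<tau> ` {..<l1 + l2 - 2 * q} \<subseteq> A \<union> S"
    and S: "\<rho> ` {..<k} \<inter> \<tau> ` {..<l1 + l2 - 2 * q} = S"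
    and sep1: "S \<inter> \<tau> ` {..<l1 - q} \<noteq> {} \<Longrightarrow> separated k h l1 u1"
    and sep2: "S \<inter> \<tau> ` {..<l1 - q} = {} \<Longrightarrow> separated k h l2 u2"
  shows "AE z in coords A. (LINT s|coords S. h (pick {..<k} \<rho> (merge A S (z, s))) *
    u (pick {..<l1 + l2 - 2 * q} \<tau> (merge A S (z, s)))) = 0"
proof -
  define N where "N = l1 + l2 - 2 * q"
  have N0: "N = l1 + l2 - 2 * q + 0" by (simp add: N_def)
  note \<tau> = \<tau>[folded N_def] and S = S[folded N_def]
  have fAS: "finite (A \<union> S)" using A by simp
  obtain R :: "nat set" where R: "finite R" "card R = q - 0" "(A \<union> S) \<inter> R = {}" using fresh_labels[OF fAS] .
  define J1 where "J1 = \<tau> ` {..<l1 - q}"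
  define J2 where "J2 = \<tau> ` {l1 - q..<N}"
  have J': "\<tau> ` {..<l1 - q + 0} = J1" "\<tau> ` {l1 - q..<N} = J2" by (simp_all add: J1_def J2_def)
  have split: "{..<N} = {..<l1 - q} \<union> {l1 - q..<N}" "{..<l1 - q} \<inter> {l1 - q..<N} = {}" using q by (auto simp: N_def)
  have J: "\<tau> ` {..<N} = J1 \<union> J2" "J1 \<inter> J2 = {}"
  proof -
    show "\<tau> ` {..<N} = J1 \<union> J2" unfolding J1_def J2_def split(1) by (rule image_Un)
    show "J1 \<inter> J2 = {}" unfolding J1_def J2_def
      using inj_on_image_Int[OF \<tau>(1), of "{..<l1 - q}" "{l1 - q..<N}"] split by auto
  qed
  obtain \<tau>1 \<tau>2 where t: "inj_on \<tau>1 {..<l1}" "inj_on \<tau>2 {..<l2}" "\<tau>1 ` {..<l1} = J1 \<union> R" "\<tau>2 ` {..<l2} = J2 \<union> R"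
    and uz: "\<And>z. z \<in> space (coords (A \<union> S)) \<Longrightarrow> u (pick {..<N} \<tau> z) =
         (LINT r|coords R. u1 (pick {..<l1} \<tau>1 (merge (A \<union> S) R (z, r))) * u2 (pick {..<l2} \<tau>2 (merge (A \<union> S) R (z, r))))"
    by (rule represents_contractionE[OF u N0 fAS \<tau>(1,2) R(1,2,3) J']) (rule that; assumption)
  define S1 where "S1 = S \<inter> J1"
  define S2 where "S2 = S \<inter> J2"
  have SJ: "S = S1 \<union> S2" "S1 \<inter> S2 = {}" "finite S1" "finite S2" using S J A by (auto simp: S1_def S2_def)
  have JA: "J1 \<subseteq> A \<union> S1" "J2 \<subseteq> A \<union> S2" "S1 \<subseteq> J1" "S2 \<subseteq> J2" using J \<tau>(2) by (auto simp: S1_def S2_def)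
  have \<rho>S: "S \<subseteq> \<rho> ` {..<k}" using S by auto
  have \<rho>J: "\<rho> ` {..<k} \<inter> J1 = S1" "\<rho> ` {..<k} \<inter> J2 = S2" using S J by (auto simp: S1_def S2_def)
  have dis: "A \<inter> S1 = {}" "A \<inter> S2 = {}" "A \<inter> R = {}" "S1 \<inter> R = {}" "S2 \<inter> R = {}"
    using A(3) R(3) SJ(1) by auto
  have \<rho>R: "\<rho> ` {..<k} \<inter> R = {}" using \<rho>(2) R(3) by auto
  let ?h = "\<lambda>z. h (pick {..<k} \<rho> z)"
  let ?u1 = "\<lambda>z. u1 (pick {..<l1} \<tau>1 z)"
  let ?u2 = "\<lambda>z. u2 (pick {..<l2} \<tau>2 z)"
  have eq: "AE z in coords A. (LINT s|coords S. ?h (merge A S (z, s)) * u (pick {..<N} \<tau> (merge A S (z, s))))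
     = (LINT s|coords S. ?h (merge A S (z, s)) *
      (LINT r|coords R. ?u1 (merge (A \<union> S) R (merge A S (z, s), r)) *
         ?u2 (merge (A \<union> S) R (merge A S (z, s), r))))"
  proof (rule AE_I2, rule Bochner_Integration.integral_cong[OF refl])
    fix z s assume "z \<in> space (coords A)" "s \<in> space (coords S)"
    then show "?h (merge A S (z, s)) * u (pick {..<N} \<tau> (merge A S (z, s))) =
      ?h (merge A S (z, s)) *
      (LINT r|coords R. ?u1 (merge (A \<union> S) R (merge A S (z, s), r)) *
         ?u2 (merge (A \<union> S) R (merge A S (z, s), r)))"
      by (simp add: uz[OF merge_in_space])
  qed
  have "AE z in coords A. (LINT s|coords S. ?h (merge A S (z, s)) *
      (LINT r|coords R. ?u1 (merge (A \<union> S) R (merge A S (z, s), r)) *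
         ?u2 (merge (A \<union> S) R (merge A S (z, s), r)))) = 0"
  proof (cases "S1 = {}")
    case False
    have "AE y in coords (A \<union> (S2 \<union> R)). (LINT s|coords S1. ?h (merge (A \<union> (S2 \<union> R)) S1 (y, s)) *
        ?u1 (merge (A \<union> (S2 \<union> R)) S1 (y, s))) = 0"
    proof (rule separatedD[OF sep1])
      show "S \<inter> \<tau> ` {..<l1 - q} \<noteq> {}" using False by (simp add: S1_def J1_def)
      show "\<rho> ` {..<k} \<inter> \<tau>1 ` {..<l1} = S1" using \<rho>J \<rho>R unfolding t by auto
      show "\<rho> ` {..<k} \<subseteq> A \<union> (S2 \<union> R) \<union> S1" using \<rho>(2) SJ by auto
      show "\<tau>1 ` {..<l1} \<subseteq> A \<union> (S2 \<union> R) \<union> S1" using JA unfolding t by auto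
      show "(A \<union> (S2 \<union> R)) \<inter> S1 = {}" using dis SJ by auto
    qed (use False A R SJ \<rho> t in auto)
    then have "AE z in coords A. (LINT s|coords (S1 \<union> S2). ?h (merge A (S1 \<union> S2) (z, s)) *
      (LINT r|coords R. ?u1 (merge (A \<union> (S1 \<union> S2)) R (merge A (S1 \<union> S2) (z, s), r)) *
         ?u2 (merge (A \<union> (S1 \<union> S2)) R (merge A (S1 \<union> S2) (z, s), r)))) = 0"
      using \<rho>(2) \<rho>S JA unfolding SJ(1)
      by (intro iterated_contraction_null[OF h \<rho>(1) _ _ u1 t(1) _ _ u2 t(2)] dis SJ R A) (auto simp: t)
    then show ?thesis unfolding SJ(1)[symmetric] .
  next
    case True
    have S2: "S = S2" "S2 = S2 \<union> S1" using True SJ by auto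
    have "AE y in coords (A \<union> (S1 \<union> R)). (LINT s|coords S2. ?h (merge (A \<union> (S1 \<union> R)) S2 (y, s)) *
        ?u2 (merge (A \<union> (S1 \<union> R)) S2 (y, s))) = 0"
    proof (rule separatedD[OF sep2])
      show "S \<inter> \<tau> ` {..<l1 - q} = {}" using True by (simp add: S1_def J1_def)
      show "\<rho> ` {..<k} \<inter> \<tau>2 ` {..<l2} = S2" using \<rho>J \<rho>R unfolding t by auto
      show "\<rho> ` {..<k} \<subseteq> A \<union> (S1 \<union> R) \<union> S2" using \<rho>(2) SJ by auto
      show "\<tau>2 ` {..<l2} \<subseteq> A \<union> (S1 \<union> R) \<union> S2" using JA unfolding t by auto
      show "(A \<union> (S1 \<union> R)) \<inter> S2 = {}" using dis SJ by auto
    qed (use S2 A R SJ \<rho> t in auto)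
    then have "AE z in coords A. (LINT s|coords (S2 \<union> S1). ?h (merge A (S2 \<union> S1) (z, s)) *
      (LINT r|coords R. ?u2 (merge (A \<union> (S2 \<union> S1)) R (merge A (S2 \<union> S1) (z, s), r)) *
         ?u1 (merge (A \<union> (S2 \<union> S1)) R (merge A (S2 \<union> S1) (z, s), r)))) = 0"
      using \<rho>(2) \<rho>S JA dis SJ(2) unfolding SJ(1)
      by (intro iterated_contraction_null[OF h \<rho>(1) _ _ u2 t(2) _ _ u1 t(1)] SJ R A) (auto simp: t)
    moreover have "S2 \<union> S1 = S" using SJ by auto
    ultimately show ?thesis by (simp add: mult.commute)
  qed
  then show ?thesis using eq unfolding N_def[symmetric] by eventually_elim simp
qed

lemma separated_contraction:
  assumes h: "h \<in> L2_kernels k" and u1: "u1 \<in> L2_kernels l1" and u2: "u2 \<in> L2_kernels l2"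
    and q: "q \<le> l1" "q \<le> l2" and sep: "separated k h l1 u1" "separated k h l2 u2"
  shows "separated k h (l1 + l2 - 2 * q) (contraction l1 l2 q u1 u2)"
  unfolding separated_def
proof (intro allI impI, elim conjE)
  fix A S :: "nat set" and \<rho> \<tau> :: "nat \<Rightarrow> nat"
  assume *: "finite A" "finite S" "A \<inter> S = {}" "S \<noteq> {}"
       "inj_on \<rho> {..<k}" "inj_on \<tau> {..<l1 + l2 - 2 * q}" "\<rho> ` {..<k} \<subseteq> A \<union> S" "\<tau> ` {..<l1 + l2 - 2 * q} \<subseteq> A \<union> S"
       "\<rho> ` {..<k} \<inter> \<tau> ` {..<l1 + l2 - 2 * q} = S"
  note u = represents_contraction_contraction[OF L2_kernels_measurable[OF u1] L2_kernels_measurable[OF u2] q]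
  show "AE z in coords A. (LINT s|coords S. h (pick {..<k} \<rho> (merge A S (z, s))) *
    contraction l1 l2 q u1 u2 (pick {..<l1 + l2 - 2 * q} \<tau> (merge A S (z, s)))) = 0"
    by (rule contraction_step[OF h u1 u2 q u *(1,2,3,4,5,7,6,8,9) sep])
qed

text \<open>The shared variables are the last arguments of \<open>h\<close> and the first arguments of \<open>u\<close>.\<close>

lemma separated_contraction_null:
  assumes h: "h \<in> L2_kernels k" and u: "u \<in> L2_kernels l" and p: "1 \<le> p" "p \<le> k" "p \<le> l"
    and sep: "separated k h l u"
  shows "AE t in orthant (k + l - 2 * p). contraction k l p h u t = 0"
proof -
  define N where "N = k + l - 2 * p"
  have N0: "N = k + l - 2 * p + 0" by (simp add: N_def)
  note c = represents_contraction_contraction[OF L2_kernels_measurable[OF h] L2_kernels_measurable[OF u] p(2,3)]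
  obtain S \<rho> \<tau> where S: "finite S" "card S = p - 0" "{..<N} \<inter> S = {}"
    and t: "inj_on \<rho> {..<k}" "inj_on \<tau> {..<l}" "\<rho> ` {..<k} = {..<k - p + 0} \<union> S" "\<tau> ` {..<l} = {k - p..<N} \<union> S"
    and cz: "\<And>z. z \<in> space (coords {..<N}) \<Longrightarrow> contraction k l p h u z =
         (LINT s|coords S. h (pick {..<k} \<rho> (merge {..<N} S (z, s))) * u (pick {..<l} \<tau> (merge {..<N} S (z, s))))"
    by (rule represents_contraction_orthant[OF c N0]) (rule that; assumption)
  have "S \<noteq> {}" using S p by auto
  have "AE z in coords {..<N}. (LINT s|coords S. h (pick {..<k} \<rho> (merge {..<N} S (z, s))) * u (pick {..<l} \<tau> (merge {..<N} S (z, s)))) = 0"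
    by (rule separatedD[OF sep _ S(1,3) \<open>S \<noteq> {}\<close> t(1,2)]) (use S p in \<open>auto simp: t N_def\<close>)
  with AE_space show ?thesis unfolding N_def[symmetric] orthant_eq_coords
  proof eventually_elim
    case (elim z)
    then show ?case using cz[OF elim(1)] by simp
  qed
qed

text \<open>The integrated variables start at the first argument of \<open>u1\<close>, so at least one of them sits in
  \<open>u1\<close>, and integrating over those that do already gives zero.\<close>

lemma separated_tensor_null:
  assumes h: "h \<in> L2_kernels k" and u1: "u1 \<in> L2_kernels l1" and u2: "u2 \<in> L2_kernels l2" and l1: "1 \<le> l1"
    and p: "1 \<le> p" "p \<le> k" "p \<le> l1 + l2"
    and sep: "separated k h l1 u1"
  shows "AE t in orthant (k + (l1 + l2) - 2 * p). contraction k (l1 + l2) p h (contraction l1 l2 0 u1 u2) t = 0"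
proof -
  define u where "u = contraction l1 l2 0 u1 u2"
  have u: "u \<in> L2_kernels (l1 + l2)" using contraction_in_L2[OF u1 u2, of 0] by (simp add: u_def)
  have ur: "represents_contraction 0 l1 l2 0 u1 u2 u" unfolding u_def
    by (rule represents_contraction_contraction[OF L2_kernels_measurable[OF u1] L2_kernels_measurable[OF u2]]) simp_all
  define N where "N = k + (l1 + l2) - 2 * p"
  have N0: "N = k + (l1 + l2) - 2 * p + 0" by (simp add: N_def)
  note c = represents_contraction_contraction[OF L2_kernels_measurable[OF h] L2_kernels_measurable[OF u] p(2,3)]
  obtain S \<rho> \<tau> where S: "finite S" "card S = p - 0" "{..<N} \<inter> S = {}"
    and t: "inj_on \<rho> {..<k}" "inj_on \<tau> {..<l1 + l2}" "\<rho> ` {..<k} = {..<k - p + 0} \<union> S" "\<tau> ` {..<l1 + l2} = {k - p..<N} \<union> S"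
    "\<tau> ` {..<p - 0} = S"
    and cz: "\<And>z. z \<in> space (coords {..<N}) \<Longrightarrow> contraction k (l1 + l2) p h u z =
         (LINT s|coords S. h (pick {..<k} \<rho> (merge {..<N} S (z, s))) * u (pick {..<l1 + l2} \<tau> (merge {..<N} S (z, s))))"
    by (rule represents_contraction_orthant[OF c N0]) (rule that; assumption)
  have "S \<noteq> {}" using S p by auto
  have "\<tau> 0 \<in> S" using t(5) p by auto
  then have first: "S \<inter> \<tau> ` {..<l1 - 0} \<noteq> {}" using l1 by auto
  have "AE z in coords {..<N}. (LINT s|coords S. h (pick {..<k} \<rho> (merge {..<N} S (z, s))) * u (pick {..<l1 + l2 - 2 * 0} \<tau> (merge {..<N} S (z, s)))) = 0"
    by (rule contraction_step[OF h u1 u2 _ _ ur _ S(1,3) \<open>S \<noteq> {}\<close> t(1)]) (use S p first sep t(2) in \<open>auto simp: t N_def\<close>)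
  with AE_space show ?thesis unfolding N_def[symmetric] orthant_eq_coords u_def[symmetric]
  proof eventually_elim
    case (elim z)
    then show ?case using cz[OF elim(1)] by simp
  qed
qed

text \<open>By symmetry only the number \<open>r\<close> of shared variables matters, and the integral is a value of the
  contraction of order \<open>r\<close>.\<close>

lemma separated_of_contractions_null:
  assumes f: "f \<in> L2_kernels n" "symmetric_kernel n f" and g: "g \<in> L2_kernels m" "symmetric_kernel m g"
    and null: "\<And>r. 1 \<le> r \<Longrightarrow> r \<le> n \<Longrightarrow> r \<le> m \<Longrightarrow> AE t in orthant (n + m - 2 * r). contraction n m r f g t = 0"
  shows "separated n f m g"
  unfolding separated_def
proof (intro allI impI, elim conjE)
  fix A S :: "nat set" and \<rho> \<tau> :: "nat \<Rightarrow> nat"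
  assume A: "finite A" "finite S" "A \<inter> S = {}" "S \<noteq> {}"
    and \<rho>: "inj_on \<rho> {..<n}" "\<rho> ` {..<n} \<subseteq> A \<union> S" and \<tau>: "inj_on \<tau> {..<m}" "\<tau> ` {..<m} \<subseteq> A \<union> S"
    and S: "\<rho> ` {..<n} \<inter> \<tau> ` {..<m} = S"
  define r where "r = card S"
  have Ssub: "S \<subseteq> \<rho> ` {..<n}" "S \<subseteq> \<tau> ` {..<m}" using S by auto
  have r: "1 \<le> r" "r \<le> n" "r \<le> m"
  proof -
    show "1 \<le> r" using A by (simp add: r_def Suc_le_eq card_gt_0_iff)
    show "r \<le> n" unfolding r_def using card_mono[OF _ Ssub(1)] card_image[OF \<rho>(1)] by simp
    show "r \<le> m" unfolding r_def using card_mono[OF _ Ssub(2)] card_image[OF \<tau>(1)] by simp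
  qed
  define J1 where "J1 = \<rho> ` {..<n} - S"
  define J2 where "J2 = \<tau> ` {..<m} - S"
  have J: "finite J1" "finite J2" "card J1 = n - r" "card J2 = m - r" "J1 \<inter> J2 = {}" "J1 \<subseteq> A" "J2 \<subseteq> A"
    using S \<rho> \<tau> A card_image[OF \<rho>(1)] card_image[OF \<tau>(1)] card_Diff_subset[OF A(2) Ssub(1)] card_Diff_subset[OF A(2) Ssub(2)]
    by (auto simp: J1_def J2_def r_def)
  obtain b1 where b1: "bij_betw b1 {..<n - r} J1" using J ex_bij_betw_nat_finite lessThan_atLeast0 by metis
  obtain b2 where b2: "bij_betw b2 {..<m - r} J2" using J ex_bij_betw_nat_finite lessThan_atLeast0 by metis
  define N where "N = n + m - 2 * r"
  have N0: "N = n + m - 2 * r + 0" by (simp add: N_def)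
  define \<tau>0 where "\<tau>0 = (\<lambda>i. if i < n - r then b1 i else b2 (i - (n - r)))"
  have N1: "n - r + (m - r) = N" using r by (simp add: N_def)
  note concat = bij_betw_concat[OF b1 b2 J(5), folded \<tau>0_def, unfolded N1]
  have \<tau>0inj: "inj_on \<tau>0 {..<N}" and \<tau>0im: "\<tau>0 ` {..<N} = J1 \<union> J2" using concat(1) by (auto simp: bij_betw_def)
  have im: "\<tau>0 ` {..<N} \<subseteq> A" "\<tau>0 ` {..<n - r + 0} = J1" using \<tau>0im concat(2) J by auto
  note c = represents_contraction_contraction[OF L2_kernels_measurable[OF f(1)] L2_kernels_measurable[OF g(1)] r(2,3)]
  have cS: "card S = r - 0" by (simp add: r_def)
  obtain \<tau>1 \<tau>2 where t: "inj_on \<tau>1 {..<n}" "inj_on \<tau>2 {..<m}" "\<tau>1 ` {..<n} = J1 \<union> S" "\<tau>2 ` {..<m} = J2 \<union> S"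
    and cz: "\<And>z. z \<in> space (coords A) \<Longrightarrow> contraction n m r f g (pick {..<N} \<tau>0 z) =
         (LINT s|coords S. f (pick {..<n} \<tau>1 (merge A S (z, s))) * g (pick {..<m} \<tau>2 (merge A S (z, s))))"
    by (rule represents_contractionE[OF c N0 A(1) \<tau>0inj im(1) A(2) cS A(3) im(2) concat(3)]) (rule that; assumption)
  let ?f = "\<lambda>z. f (pick {..<n} \<rho> z)"
  let ?g = "\<lambda>z. g (pick {..<m} \<tau> z)"
  let ?f1 = "\<lambda>z. f (pick {..<n} \<tau>1 z)"
  let ?g2 = "\<lambda>z. g (pick {..<m} \<tau>2 z)"
  have JS: "J1 \<union> S = \<rho> ` {..<n}" "J2 \<union> S = \<tau> ` {..<m}" using Ssub by (auto simp: J1_def J2_def)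
  note t = t[unfolded JS]
  have fAS: "finite (A \<union> S)" using A by simp
  have "AE w in coords (A \<union> S). ?f w = ?f1 w \<and> ?g w = ?g2 w"
    using symmetric_kernel_pick[OF f(2) fAS \<rho>(2,1) refl t(1,3)] symmetric_kernel_pick[OF g(2) fAS \<tau>(2,1) refl t(2,4)]
    by eventually_elim simp
  from AE_merge[OF A(1,2,3) this] have same: "AE z in coords A. AE s in coords S.
     ?f (merge A S (z, s)) = ?f1 (merge A S (z, s)) \<and>
     ?g (merge A S (z, s)) = ?g2 (merge A S (z, s))" .
  have "AE z in coords A. contraction n m r f g (pick {..<N} \<tau>0 z) = 0"
    by (rule AE_pick[OF A(1) \<tau>0inj im(1) null[OF r, folded N_def, unfolded orthant_eq_coords]])
  with same AE_space show "AE z in coords A. (LINT s|coords S. ?f (merge A S (z, s)) * ?g (merge A S (z, s))) = 0"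
  proof eventually_elim
    case (elim z)
    note [measurable] = elim(2)
    have [measurable]: "f \<in> borel_measurable (coords {..<n})" "g \<in> borel_measurable (coords {..<m})"
      using f g by (auto simp: L2_kernels_def orthant_eq_coords)
    have [measurable]: "pick {..<n} \<rho> \<in> coords (A \<union> S) \<rightarrow>\<^sub>M coords {..<n}" "pick {..<m} \<tau> \<in> coords (A \<union> S) \<rightarrow>\<^sub>M coords {..<m}"
      "pick {..<n} \<tau>1 \<in> coords (A \<union> S) \<rightarrow>\<^sub>M coords {..<n}" "pick {..<m} \<tau>2 \<in> coords (A \<union> S) \<rightarrow>\<^sub>M coords {..<m}"
      using \<rho>(2) \<tau>(2) t(3,4) by (auto intro!: measurable_pick)
    have "(LINT s|coords S. ?f (merge A S (z, s)) * ?g (merge A S (z, s)))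
      = (LINT s|coords S. ?f1 (merge A S (z, s)) * ?g2 (merge A S (z, s)))"
      by (rule integral_cong_AE) (measurable, use elim(1) in auto)
    then show ?case using cz[OF elim(2)] elim(3) by simp
  qed
qed

section \<open>Disjoint supports\<close>

definition vanishes_on :: "real set \<Rightarrow> nat \<Rightarrow> kernel \<Rightarrow> bool" where
  "vanishes_on E k h \<longleftrightarrow> (\<forall>i<k. AE t in orthant k. t i \<in> E \<longrightarrow> h t = 0)"

lemma AE_fresh_pick:
  assumes "AE t in orthant k. Pr t" "inj_on \<rho> {..<k}" "\<rho> ` {..<k} \<subseteq> {..<N} \<union> S" "finite S" "{..<N} \<inter> S = {}"
  shows "AE z in coords {..<N}. AE s in coords S. Pr (pick {..<k} \<rho> (merge {..<N} S (z, s)))"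
proof (rule AE_merge)
  show "AE u in coords ({..<N} \<union> S). Pr (pick {..<k} \<rho> u)"
    by (rule AE_pick[OF _ assms(2,3) assms(1)[unfolded orthant_eq_coords]]) (use assms in simp)
qed (use assms in auto)

text \<open>The first argument of \<open>u\<close> is shared with \<open>h\<close>. Whether its value lies in \<open>E\<close> or not, one of the two
  factors of the integrand vanishes.\<close>

lemma contraction_null_if:
  assumes c: "represents_contraction e k l p h u c" and p: "1 \<le> p" "p \<le> k" "p \<le> l" "e \<le> p"
    and h: "vanishes_on (- E) k h" and u: "AE t in orthant l. t 0 \<in> E \<longrightarrow> u t = 0"
  shows "AE t in orthant (k + l - 2 * p + e). c t = 0"
proof -
  define N where "N = k + l - 2 * p + e"
  obtain S \<rho> \<tau> where S: "finite S" "card S = p - e" "{..<N} \<inter> S = {}"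
    and t: "inj_on \<rho> {..<k}" "inj_on \<tau> {..<l}" "\<rho> ` {..<k} = {..<k - p + e} \<union> S" "\<tau> ` {..<l} = {k - p..<N} \<union> S"
     "1 \<le> p \<Longrightarrow> \<tau> 0 \<in> \<rho> ` {..<k}"
    and cz: "\<And>z. z \<in> space (coords {..<N}) \<Longrightarrow> c z =
         (LINT s|coords S. h (pick {..<k} \<rho> (merge {..<N} S (z, s))) * u (pick {..<l} \<tau> (merge {..<N} S (z, s))))"
    by (rule represents_contraction_orthant[OF c N_def]) (rule that; assumption)
  let ?h = "\<lambda>z. h (pick {..<k} \<rho> z)"
  let ?u = "\<lambda>z. u (pick {..<l} \<tau> z)"
  obtain j where j: "j < k" "\<rho> j = \<tau> 0" using t(5) p by auto
  have "AE z in coords {..<N}. AE s in coords S. pick {..<k} \<rho> (merge {..<N} S (z, s)) j \<in> - E \<longrightarrow> ?h (merge {..<N} S (z, s)) = 0"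
    by (rule AE_fresh_pick) (use h j S t(1,3) p in \<open>auto simp: vanishes_on_def N_def\<close>)
  moreover have "AE z in coords {..<N}. AE s in coords S. pick {..<l} \<tau> (merge {..<N} S (z, s)) 0 \<in> E \<longrightarrow> ?u (merge {..<N} S (z, s)) = 0"
    by (rule AE_fresh_pick) (use u S t(2,4) p in auto)
  ultimately show ?thesis using AE_space unfolding N_def[symmetric] orthant_eq_coords
  proof eventually_elim
    case (elim z)
    have "c z = (LINT s|coords S. ?h (merge {..<N} S (z, s)) * ?u (merge {..<N} S (z, s)))"
      using cz[OF elim(3)] by simp
    also have "\<dots> = 0"
    proof (rule integral_eq_zero_AE)
      from elim(1,2) show "AE s in coords S. ?h (merge {..<N} S (z, s)) * ?u (merge {..<N} S (z, s)) = 0"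
        by eventually_elim (use j p in \<open>auto simp: pick_def\<close>)
    qed
    finally show ?case .
  qed
qed

text \<open>Every argument of a contraction is an argument of one of the two factors, and the corresponding
  factor vanishes for almost all values of the integrated variables.\<close>

lemma vanishes_on_contraction:
  assumes c: "represents_contraction e k l p h u c" and p: "p \<le> k" "p \<le> l" "e \<le> p" "e \<le> 1"
    and h: "vanishes_on E k h" and u: "vanishes_on E l u"
  shows "vanishes_on E (k + l - 2 * p + e) c"
  unfolding vanishes_on_def
proof (intro allI impI)
  define N where "N = k + l - 2 * p + e"
  fix i assume "i < k + l - 2 * p + e"
  then have i: "i < N" by (simp add: N_def)
  obtain S \<rho> \<tau> where S: "finite S" "card S = p - e" "{..<N} \<inter> S = {}"
    and t: "inj_on \<rho> {..<k}" "inj_on \<tau> {..<l}" "\<rho> ` {..<k} = {..<k - p + e} \<union> S" "\<tau> ` {..<l} = {k - p..<N} \<union> S"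
    and cz: "\<And>z. z \<in> space (coords {..<N}) \<Longrightarrow> c z =
         (LINT s|coords S. h (pick {..<k} \<rho> (merge {..<N} S (z, s))) * u (pick {..<l} \<tau> (merge {..<N} S (z, s))))"
    by (rule represents_contraction_orthant[OF c N_def]) (rule that; assumption)
  let ?h = "\<lambda>z. h (pick {..<k} \<rho> z)"
  let ?u = "\<lambda>z. u (pick {..<l} \<tau> z)"
  have iS: "i \<notin> S" using S i by auto
  have "i \<in> \<rho> ` {..<k} \<or> i \<in> \<tau> ` {..<l}" unfolding t using i p by auto
  then consider j where "j < k" "\<rho> j = i" | j where "j < l" "\<tau> j = i" by auto
  then have "AE z in coords {..<N}. AE s in coords S. z i \<in> E \<longrightarrow>
    ?h (merge {..<N} S (z, s)) = 0 \<or> ?u (merge {..<N} S (z, s)) = 0"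
  proof cases
    case 1
    have "AE z in coords {..<N}. AE s in coords S. pick {..<k} \<rho> (merge {..<N} S (z, s)) j \<in> E \<longrightarrow> ?h (merge {..<N} S (z, s)) = 0"
      by (rule AE_fresh_pick) (use h 1 S t(1,3) p in \<open>auto simp: vanishes_on_def N_def\<close>)
    then show ?thesis
    proof eventually_elim
      case (elim z)
      then show ?case by eventually_elim (use 1 i iS in \<open>auto simp: pick_def merge_def\<close>)
    qed
  next
    case 2
    have "AE z in coords {..<N}. AE s in coords S. pick {..<l} \<tau> (merge {..<N} S (z, s)) j \<in> E \<longrightarrow> ?u (merge {..<N} S (z, s)) = 0"
      by (rule AE_fresh_pick) (use u 2 S t(2,4) p in \<open>auto simp: vanishes_on_def\<close>)
    then show ?thesis
    proof eventually_elim
      case (elim z)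
      then show ?case by eventually_elim (use 2 i iS in \<open>auto simp: pick_def merge_def\<close>)
    qed
  qed
  with AE_space show "AE t in orthant (k + l - 2 * p + e). t i \<in> E \<longrightarrow> c t = 0" unfolding N_def[symmetric] orthant_eq_coords
  proof eventually_elim
    case (elim z)
    show ?case
    proof
      assume E: "z i \<in> E"
      have "c z = (LINT s|coords S. ?h (merge {..<N} S (z, s)) * ?u (merge {..<N} S (z, s)))"
        using cz[OF elim(1)] by simp
      also have "\<dots> = 0"
      proof (rule integral_eq_zero_AE)
        from elim(2) show "AE s in coords S. ?h (merge {..<N} S (z, s)) * ?u (merge {..<N} S (z, s)) = 0"
          by eventually_elim (use E in auto)
      qed
      finally show "c z = 0" .
    qed
  qed
qed

text \<open>The first argument of a tensor product is the first argument of its left factor.\<close>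

lemma tensor_vanishes_first:
  assumes c: "represents_contraction 0 k l 0 h u c" and k: "1 \<le> k" and h: "vanishes_on E k h"
  shows "AE t in orthant (k + l). t 0 \<in> E \<longrightarrow> c t = 0"
proof -
  define N where "N = k + l"
  have N0: "N = k + l - 2 * 0 + 0" by (simp add: N_def)
  obtain S \<rho> \<tau> where S: "finite S" "card S = 0 - 0" "{..<N} \<inter> S = {}"
    and t: "inj_on \<rho> {..<k}" "\<rho> ` {..<k} = {..<k - 0 + 0} \<union> S" "\<And>i. i < k - 0 + 0 \<Longrightarrow> \<rho> i = i"
    and cz: "\<And>z. z \<in> space (coords {..<N}) \<Longrightarrow> c z =
         (LINT s|coords S. h (pick {..<k} \<rho> (merge {..<N} S (z, s))) * u (pick {..<l} \<tau> (merge {..<N} S (z, s))))"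
    by (rule represents_contraction_orthant[OF c N0]) (rule that; assumption)
  let ?h = "\<lambda>z. h (pick {..<k} \<rho> z)"
  let ?u = "\<lambda>z. u (pick {..<l} \<tau> z)"
  have "AE z in coords {..<N}. AE s in coords S. pick {..<k} \<rho> (merge {..<N} S (z, s)) 0 \<in> E \<longrightarrow> ?h (merge {..<N} S (z, s)) = 0"
    by (rule AE_fresh_pick) (use h k S t(1,2) in \<open>auto simp: vanishes_on_def N_def\<close>)
  with AE_space show ?thesis unfolding N_def[symmetric] orthant_eq_coords
  proof eventually_elim
    case (elim z)
    show ?case
    proof
      assume E: "z 0 \<in> E"
      have "c z = (LINT s|coords S. ?h (merge {..<N} S (z, s)) * ?u (merge {..<N} S (z, s)))"
        using cz[OF elim(1)] by simp
      also have "\<dots> = 0"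
      proof (rule integral_eq_zero_AE)
        from elim(2) show "AE s in coords S. ?h (merge {..<N} S (z, s)) * ?u (merge {..<N} S (z, s)) = 0"
          by eventually_elim (use E k t(3)[of 0] in \<open>auto simp: pick_def merge_def N_def\<close>)
      qed
      finally show "c z = 0" .
    qed
  qed
qed

text \<open>By symmetry it is enough to know this for one argument, and the arguments may carry any
  labels.\<close>

lemma symmetric_vanishes_onI:
  assumes sym: "symmetric_kernel n f" and \<tau>: "inj_on \<tau> {..<n}" "\<tau> ` {..<n} = K" and x: "x \<in> K"
    and null: "AE w in coords K. w x \<in> E \<longrightarrow> f (pick {..<n} \<tau> w) = 0"
  shows "vanishes_on E n f"
  unfolding vanishes_on_def
proof (intro allI impI)
  fix i assume i: "i < n"
  have bij\<tau>: "bij_betw \<tau> {..<n} K" using \<tau> by (simp add: bij_betw_def)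
  define \<sigma> where "\<sigma> = the_inv_into {..<n} \<tau>"
  have \<sigma>: "bij_betw \<sigma> K {..<n}" unfolding \<sigma>_def by (rule bij_betw_the_inv_into[OF bij\<tau>])
  have \<sigma>x: "\<sigma> x < n" using \<sigma> x by (auto simp: bij_betw_def)
  define e where "e = Transposition.transpose (\<sigma> x) i \<circ> \<sigma>"
  have tr: "bij_betw (Transposition.transpose (\<sigma> x) i) {..<n} {..<n}"
    using i \<sigma>x by (intro bij_betwI[where g = "Transposition.transpose (\<sigma> x) i"]) (auto simp: Transposition.transpose_def)
  have e: "bij_betw e K {..<n}" unfolding e_def by (rule bij_betw_trans[OF \<sigma> tr])
  have ex: "e x = i" by (simp add: e_def)
  have "AE t in coords {..<n}. pick K e t x \<in> E \<longrightarrow> f (pick {..<n} \<tau> (pick K e t)) = 0"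
    by (rule AE_pick[OF _ _ _ null]) (use e in \<open>auto simp: bij_betw_def\<close>)
  moreover have "pick {..<n} \<tau> (pick K e t) = pick {..<n} (e \<circ> \<tau>) t" for t
    using \<tau> by (auto simp: pick_def fun_eq_iff)
  moreover have "AE t in coords {..<n}. f (pick {..<n} (e \<circ> \<tau>) t) = f (pick {..<n} id t) \<and> f (pick {..<n} id t) \<in> \<real>"
    by (rule symmetric_kernel_pick[OF sym _ subset_refl])
       (use bij_betw_trans[OF bij\<tau> e] in \<open>auto simp: bij_betw_def\<close>)
  ultimately have "AE t in coords {..<n}. (t i \<in> E \<longrightarrow> f (pick {..<n} (e \<circ> \<tau>) t) = 0) \<and> f (pick {..<n} (e \<circ> \<tau>) t) = f (pick {..<n} id t)"
    using ex x by (auto simp: pick_def)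
  with AE_space show "AE t in orthant n. t i \<in> E \<longrightarrow> f t = 0" unfolding orthant_eq_coords
    by eventually_elim (auto simp: pick_id)
qed

text \<open>The set \<open>E\<close> consists of those \<open>x\<close> for which \<open>f\<close>, with its last variable fixed to be \<open>x\<close>, is not
  almost everywhere zero. Fubini's theorem, applied to \<open>f(t,x) g(x,r) = 0\<close>, gives \<open>g(x,r) = 0\<close> for
  such \<open>x\<close>.\<close>

lemma disjoint_supports:
  assumes f: "f \<in> L2_kernels n" "symmetric_kernel n f" and g: "g \<in> L2_kernels m" "symmetric_kernel m g"
    and nm: "1 \<le> n" "1 \<le> m"
    and null: "AE t in orthant (n + m - 2 * 1 + 1). star_contraction n m 1 f g t = 0"
  shows "\<exists>E. vanishes_on (- E) n f \<and> vanishes_on E m g"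
proof -
  define N where "N = n + m - 2 * 1 + 1"
  define x where "x = n - 1"
  define X where "X = {x}"
  define T where "T = {..<x}"
  define U where "U = {n..<N}"
  have fin [simp]: "finite X" "finite T" "finite U" by (auto simp: X_def T_def U_def)
  have sets: "{..<n} = X \<union> T" "{..<N} = (X \<union> U) \<union> T" "{x..<N} = X \<union> U" "X \<inter> T = {}" "(X \<union> U) \<inter> T = {}"
    using nm by (auto simp: X_def T_def U_def N_def x_def)
  note c = represents_contraction_star[OF L2_kernels_measurable[OF f(1)] L2_kernels_measurable[OF g(1)] order_refl nm]
  have im: "id ` {..<N} \<subseteq> {..<N}" "id ` {..<n - 1 + 1} = {..<n}" "id ` {n - 1..<N} = {x..<N}" using nm by (auto simp: x_def)
  have em: "finite ({} :: nat set)" "card ({} :: nat set) = 1 - 1" "{..<N} \<inter> ({} :: nat set) = {}" by simp_all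
  obtain \<tau>1 \<tau>2 where t: "inj_on \<tau>1 {..<n}" "inj_on \<tau>2 {..<m}" "\<tau>1 ` {..<n} = {..<n} \<union> {}" "\<tau>2 ` {..<m} = {x..<N} \<union> {}"
    and cz: "\<And>z. z \<in> space (coords {..<N}) \<Longrightarrow> star_contraction n m 1 f g (pick {..<N} id z) =
         (LINT s|coords {}. f (pick {..<n} \<tau>1 (merge {..<N} {} (z, s))) * g (pick {..<m} \<tau>2 (merge {..<N} {} (z, s))))"
    by (rule represents_contractionE[OF c N_def finite_lessThan inj_on_id im(1) em im(2,3)]) (rule that; assumption)
  note t = t[unfolded Un_empty_right sets(1) sets(3)]
  have [measurable]: "f \<in> borel_measurable (coords (X \<union> T))" "g \<in> borel_measurable (coords {..<m})"
    using f g sets(1) by (auto simp: L2_kernels_def orthant_eq_coords)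
  have [measurable]: "pick (X \<union> T) \<tau>1 \<in> coords (X \<union> T) \<rightarrow>\<^sub>M coords (X \<union> T)" "pick {..<m} \<tau>2 \<in> coords (X \<union> U) \<rightarrow>\<^sub>M coords {..<m}"
    using t by (auto intro!: measurable_pick)
  interpret T: sigma_finite_measure "coords T" by (rule sigma_finite_coords) simp
  have prod0: "AE z in coords ((X \<union> U) \<union> T). f (pick (X \<union> T) \<tau>1 z) * g (pick {..<m} \<tau>2 z) = 0"
    using AE_space null unfolding N_def[symmetric] orthant_eq_coords sets(2)
  proof eventually_elim
    case (elim z)
    have z: "z \<in> space (coords {..<N})" using elim(1) by (simp add: sets(2))
    have mz: "merge {..<N} {} (z, s) = z" for s using z by (auto simp: merge_def space_coords extensional_def fun_eq_iff)
    have "star_contraction n m 1 f g z = f (pick {..<n} \<tau>1 z) * g (pick {..<m} \<tau>2 z)"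
      using cz[OF z] by (simp add: pick_id[OF z] mz PiM_empty lebesgue_integral_count_space_finite)
    then show ?case using elim(2) by (simp add: sets(1))
  qed
  define v where "v = (\<lambda>w. \<integral>\<^sup>+s. ennreal (cmod (f (pick (X \<union> T) \<tau>1 (merge X T (w, s))))) \<partial>coords T)"
  have vm [measurable]: "v \<in> borel_measurable (coords X)" unfolding v_def by measurable
  define E where "E = {y. v (\<lambda>i\<in>X. y) \<noteq> 0}"
  have vE: "v w = v (\<lambda>i\<in>X. w x)" if "w \<in> extensional X" for w
  proof -
    have "w = (\<lambda>i\<in>X. w x)" using that by (auto simp: X_def extensional_def fun_eq_iff)
    then show ?thesis by simp
  qed
  have "vanishes_on (- E) n f"
  proof (rule symmetric_vanishes_onI[OF f(2)])
    show "inj_on \<tau>1 {..<n}" "\<tau>1 ` {..<n} = X \<union> T" using t by (auto simp: sets(1))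
    show "x \<in> X \<union> T" by (simp add: X_def)
    have ms: "(\<lambda>w. restrict w X) \<in> coords (X \<union> T) \<rightarrow>\<^sub>M coords X" by (rule measurable_restrict_subset) simp
    \<comment> \<open>The part of \<open>f\<close> outside \<open>E\<close> has integral zero.\<close>
    define F where "F = (\<lambda>w. (if v (restrict w X) = 0 then 1 else 0) * ennreal (cmod (f (pick (X \<union> T) \<tau>1 w))))"
    have vm': "(\<lambda>w. v (restrict w X)) \<in> borel_measurable (coords (X \<union> T))" by (rule measurable_compose[OF ms vm])
    have Fm [measurable]: "F \<in> borel_measurable (coords (X \<union> T))"
      unfolding F_def using vm' by measurable
    have "(\<integral>\<^sup>+w. F w \<partial>coords (X \<union> T)) = (\<integral>\<^sup>+w. \<integral>\<^sup>+s. F (merge X T (w, s)) \<partial>coords T \<partial>coords X)"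
      using sets by (subst coords.product_nn_integral_fold) auto
    also have "\<dots> = (\<integral>\<^sup>+w. 0 \<partial>coords X)"
    proof (rule nn_integral_cong)
      fix w assume w [measurable]: "w \<in> space (coords X)"
      have "restrict (merge X T (w, s)) X = w" for s using w sets by (simp add: space_coords extensional_restrict)
      then have "(\<integral>\<^sup>+s. F (merge X T (w, s)) \<partial>coords T) = (if v w = 0 then 1 else 0) * v w"
        unfolding F_def v_def by (subst nn_integral_cmult[symmetric]) auto
      then show "(\<integral>\<^sup>+s. F (merge X T (w, s)) \<partial>coords T) = 0" by auto
    qed
    finally have "(\<integral>\<^sup>+w. F w \<partial>coords (X \<union> T)) = 0" by simp
    then have "AE w in coords (X \<union> T). F w = 0" using nn_integral_0_iff_AE[OF Fm] by simp
    with AE_space show "AE w in coords (X \<union> T). w x \<in> - E \<longrightarrow> f (pick {..<n} \<tau>1 w) = 0"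
    proof eventually_elim
      case (elim w)
      have "v (restrict w X) = v (\<lambda>i\<in>X. w x)" using vE[of "restrict w X"] by (simp add: X_def)
      then show ?case using elim(2) by (auto simp: F_def E_def sets(1) split: if_splits)
    qed
  qed
  moreover have "vanishes_on E m g"
  proof (rule symmetric_vanishes_onI[OF g(2) t(2,4)])
    show "x \<in> X \<union> U" by (simp add: X_def)
    have "AE y in coords (X \<union> U). AE s in coords T. f (pick (X \<union> T) \<tau>1 (merge (X \<union> U) T (y, s))) * g (pick {..<m} \<tau>2 (merge (X \<union> U) T (y, s))) = 0"
      by (rule AE_merge[OF _ _ _ prod0]) (use sets in auto)
    with AE_space show "AE w in coords (X \<union> U). w x \<in> E \<longrightarrow> g (pick {..<m} \<tau>2 w) = 0"
    proof eventually_elim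
      case (elim y)
      have 1: "pick (X \<union> T) \<tau>1 (merge (X \<union> U) T (y, s)) = pick (X \<union> T) \<tau>1 (merge X T (restrict y X, s))" for s
      proof (rule pick_cong)
        fix i assume "i \<in> X \<union> T"
        then have "\<tau>1 i \<in> X \<or> \<tau>1 i \<in> T" using t(3) by auto
        then show "merge (X \<union> U) T (y, s) (\<tau>1 i) = merge X T (restrict y X, s) (\<tau>1 i)"
          by (auto simp: merge_def X_def T_def U_def x_def)
      qed
      have 2: "pick {..<m} \<tau>2 (merge (X \<union> U) T (y, s)) = pick {..<m} \<tau>2 y" for s
        by (rule pick_cong) (use t(4) in \<open>auto simp: merge_def\<close>)
      show ?case
      proof (intro impI, rule ccontr)
        assume E: "y x \<in> E" and g0: "g (pick {..<m} \<tau>2 y) \<noteq> 0"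
        from elim(2) have "AE s in coords T. ennreal (cmod (f (pick (X \<union> T) \<tau>1 (merge X T (restrict y X, s))))) = 0"
          unfolding 1 2 by eventually_elim (use g0 in auto)
        then have "v (restrict y X) = (\<integral>\<^sup>+s. 0 \<partial>coords T)" unfolding v_def by (rule nn_integral_cong_AE)
        then have "v (\<lambda>i\<in>X. y x) = 0" using vE[of "restrict y X"] by (simp add: X_def)
        then show False using E by (simp add: E_def)
      qed
    qed
  qed
  ultimately show ?thesis by blast
qed

section \<open>Algebra of the partial product\<close>

lemma scaleC_one: "1 *\<^sub>C x = (x::'a::complex_hilbert_space)"
  using scaleC_of_real[of 1 x] by simp

lemma scaleC_zero_left: "0 *\<^sub>C x = (0::'a::complex_hilbert_space)"
  using scaleC_of_real[of 0 x] by simp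

lemma scaleC_minus_one: "(-1) *\<^sub>C x = - (x::'a::complex_hilbert_space)"
  using scaleC_of_real[of "-1" x] by simp

lemma scaleC_diff_right: "c *\<^sub>C (x - y) = c *\<^sub>C x - c *\<^sub>C (y::'a::complex_hilbert_space)"
  using scaleC_add_right[of c "x - y" y] by (simp add: algebra_simps)

lemma cinner_zero_left: "cinner 0 (y::'a::complex_hilbert_space) = 0"
  using cinner_scaleC_left[of 0 "0::'a" y] by (simp add: scaleC_zero_left)

lemma cinner_minus_left: "cinner (- x) (y::'a::complex_hilbert_space) = - cinner x y"
  using cinner_scaleC_left[of "-1" x y] by (simp add: scaleC_minus_one)

lemma cinner_diff_left: "cinner (x - z) (y::'a::complex_hilbert_space) = cinner x y - cinner z y"
  using cinner_add_left[of x "- z" y] by (simp add: cinner_minus_left)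

lemma cinner_diff_right: "cinner (x::'a::complex_hilbert_space) (y - z) = cinner x y - cinner x z"
  unfolding cinner_commute[of x] cinner_diff_left complex_cnj_diff ..

lemma cinner_sum_left: "cinner (\<Sum>i\<in>A. x i) (y::'a::complex_hilbert_space) = (\<Sum>i\<in>A. cinner (x i) y)"
  by (induction A rule: infinite_finite_induct) (simp_all add: cinner_add_left cinner_zero_left)

lemma tendsto_scaleC:
  assumes "(x \<longlongrightarrow> a) F" shows "((\<lambda>k. c *\<^sub>C x k) \<longlongrightarrow> c *\<^sub>C (a::'a::complex_hilbert_space)) F"
  using bounded_linear.tendsto[OF blinfun.bounded_linear_right assms, of "scaleC_op c"]
  by (simp add: blinfun_apply_scaleC_op)

text \<open>If \<open>d\<close> is orthogonal to \<open>\<delta>\<close>, its distance to \<open>\<delta>\<close> is at least the norm of \<open>\<delta>\<close>; but elements of \<open>D\<close>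
  come arbitrarily close to \<open>\<delta>\<close>.\<close>

lemma eq_zero_if_orthogonal_dense:
  fixes \<delta> :: "'a::complex_hilbert_space"
  assumes D: "closure D = UNIV" and orth: "\<And>d. d \<in> D \<Longrightarrow> cinner \<delta> d = 0"
  shows "\<delta> = 0"
proof -
  obtain d where d: "\<And>k::nat. d k \<in> D" "d \<longlonglongrightarrow> \<delta>"
    using closure_sequential[of \<delta> D] D by auto
  have "(norm (\<delta> - d k))\<^sup>2 \<ge> (norm \<delta>)\<^sup>2" for k
  proof -
    have "cinner (d k) \<delta> = 0" using orth[OF d(1)] cinner_commute by (metis complex_cnj_zero)
    then have "cinner (\<delta> - d k) (\<delta> - d k) = cinner \<delta> \<delta> + cinner (d k) (d k)"
      using orth[OF d(1)[of k]] by (simp add: cinner_diff_left cinner_diff_right)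
    then have "complex_of_real ((norm (\<delta> - d k))\<^sup>2) = complex_of_real ((norm \<delta>)\<^sup>2 + (norm (d k))\<^sup>2)"
      by (simp add: cinner_self)
    then have "(norm (\<delta> - d k))\<^sup>2 = (norm \<delta>)\<^sup>2 + (norm (d k))\<^sup>2" using of_real_eq_iff by blast
    then show ?thesis by simp
  qed
  then have ge: "\<exists>N. \<forall>k\<ge>N. (norm \<delta>)\<^sup>2 \<le> (norm (\<delta> - d k))\<^sup>2" by blast
  have "(\<lambda>k. (norm (\<delta> - d k))\<^sup>2) \<longlonglongrightarrow> (norm (\<delta> - \<delta>))\<^sup>2" by (intro tendsto_intros d)
  from LIMSEQ_le_const[OF this ge] have "(norm \<delta>)\<^sup>2 \<le> (norm (\<delta> - \<delta>))\<^sup>2" .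
  then show ?thesis by simp
qed

lemma commutant_closed:
  fixes N :: "('h::complex_hilbert_space \<Rightarrow>\<^sub>L 'h) set"
  assumes N: "N \<subseteq> bounded_ops"
  shows commutant_add: "T \<in> commutant N \<Longrightarrow> U \<in> commutant N \<Longrightarrow> T + U \<in> commutant N"
    and commutant_compose: "T \<in> commutant N \<Longrightarrow> U \<in> commutant N \<Longrightarrow> T o\<^sub>L U \<in> commutant N"
    and commutant_scale: "T \<in> commutant N \<Longrightarrow> scaleC_op c o\<^sub>L T \<in> commutant N"
proof -
  have com: "U (T x) = T (U x)" if "T \<in> commutant N" "U \<in> N" for T U :: "'h \<Rightarrow>\<^sub>L 'h" and x
  proof -
    have "T o\<^sub>L U = U o\<^sub>L T" using that by (simp add: commutant_def)
    from arg_cong[OF this, of "\<lambda>S. blinfun_apply S x"] show ?thesis by simp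
  qed
  have lin: "T (c *\<^sub>C x) = c *\<^sub>C T x" if "T \<in> bounded_ops" for T :: "'h \<Rightarrow>\<^sub>L 'h" and c x
    using that by (simp add: bounded_ops_def)
  have mem: "T \<in> commutant N" if "\<And>c x. T (c *\<^sub>C x) = c *\<^sub>C T x" "\<And>U x. U \<in> N \<Longrightarrow> U (T x) = T (U x)" for T :: "'h \<Rightarrow>\<^sub>L 'h"
    using that by (auto simp: commutant_def bounded_ops_def intro!: blinfun_eqI)
  have bo: "T \<in> bounded_ops" if "T \<in> commutant N" for T :: "'h \<Rightarrow>\<^sub>L 'h" using that by (simp add: commutant_def)
  show "T + U \<in> commutant N" if "T \<in> commutant N" "U \<in> commutant N"
    by (rule mem) (simp_all add: blinfun.add_left blinfun.add_right lin[OF bo[OF that(1)]] lin[OF bo[OF that(2)]] scaleC_add_right com[OF that(1)] com[OF that(2)])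
  show "T o\<^sub>L U \<in> commutant N" if "T \<in> commutant N" "U \<in> commutant N"
    by (rule mem) (simp_all add: lin[OF bo[OF that(1)]] lin[OF bo[OF that(2)]] com[OF that(1)] com[OF that(2)])
  show "scaleC_op c o\<^sub>L T \<in> commutant N" if T: "T \<in> commutant N"
  proof (rule mem)
    show "(scaleC_op c o\<^sub>L T) (d *\<^sub>C x) = d *\<^sub>C (scaleC_op c o\<^sub>L T) x" for d x
      by (simp add: blinfun_apply_scaleC_op lin[OF bo[OF T]] scaleC_scaleC mult.commute)
    show "U ((scaleC_op c o\<^sub>L T) x) = (scaleC_op c o\<^sub>L T) (U x)" if U: "U \<in> N" for U x
      using N U by (simp add: blinfun_apply_scaleC_op lin[OF subsetD[OF N U]] com[OF T U])
  qed
qed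

locale L2_space =
  fixes M :: "('h::complex_hilbert_space \<Rightarrow>\<^sub>L 'h) set" and \<phi> :: "('h \<Rightarrow>\<^sub>L 'h) \<Rightarrow> complex"
    and \<iota> :: "('h \<Rightarrow>\<^sub>L 'h) \<Rightarrow> 'l::complex_hilbert_space"
  assumes tracial: "tracial_W_star_space M \<phi>" and completion: "L2_completion M \<phi> \<iota>"
begin

abbreviation "is_product \<equiv> L2_product M \<iota>"
abbreviation "mul \<equiv> L2_mult M \<iota>"
abbreviation "state \<equiv> L2_state \<iota>"
abbreviation "one \<equiv> \<iota> id_blinfun"

lemma
  shows M_add: "T \<in> M \<Longrightarrow> U \<in> M \<Longrightarrow> T + U \<in> M"
    and M_compose: "T \<in> M \<Longrightarrow> U \<in> M \<Longrightarrow> T o\<^sub>L U \<in> M"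
    and M_scale: "T \<in> M \<Longrightarrow> scaleC_op c o\<^sub>L T \<in> M"
    and M_linear: "T \<in> M \<Longrightarrow> T (c *\<^sub>C x) = c *\<^sub>C T x"
proof -
  have M: "commutant (commutant M) = M" "M \<subseteq> bounded_ops"
    using tracial by (auto simp: tracial_W_star_space_def von_neumann_algebra_def)
  have "commutant M \<subseteq> bounded_ops" by (auto simp: commutant_def)
  note * = commutant_closed[OF this, unfolded M]
  show "T \<in> M \<Longrightarrow> U \<in> M \<Longrightarrow> T + U \<in> M" "T \<in> M \<Longrightarrow> U \<in> M \<Longrightarrow> T o\<^sub>L U \<in> M"
    "T \<in> M \<Longrightarrow> scaleC_op c o\<^sub>L T \<in> M" by (fact *)+
  show "T \<in> M \<Longrightarrow> T (c *\<^sub>C x) = c *\<^sub>C T x" using M(2) by (auto simp: bounded_ops_def)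
qed

lemma scaleC_op_minus_one: "scaleC_op (-1) o\<^sub>L T = - (T :: 'h \<Rightarrow>\<^sub>L 'h)"
  by (rule blinfun_eqI) (simp add: blinfun_apply_scaleC_op scaleC_minus_one blinfun.minus_left)

lemma M_diff: assumes "T \<in> M" "U \<in> M" shows "T - U \<in> M"
  using M_add[OF assms(1) M_scale[OF assms(2), of "-1"]] by (simp add: scaleC_op_minus_one)

lemma \<iota>_add: "T \<in> M \<Longrightarrow> U \<in> M \<Longrightarrow> \<iota> (T + U) = \<iota> T + \<iota> U"
  and \<iota>_scale: "T \<in> M \<Longrightarrow> \<iota> (scaleC_op c o\<^sub>L T) = c *\<^sub>C \<iota> T"
  using completion by (auto simp: L2_completion_def)

lemma \<iota>_diff: assumes "T \<in> M" "U \<in> M" shows "\<iota> (T - U) = \<iota> T - \<iota> U"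
  using \<iota>_add[OF assms(1) M_scale[OF assms(2), of "-1"]] \<iota>_scale[OF assms(2), of "-1"]
  by (simp add: scaleC_op_minus_one scaleC_minus_one)

lemma dense: "closure (\<iota> ` M) = UNIV"
  using completion by (simp add: L2_completion_def)

lemma approximation:
  obtains x where "\<And>k::nat. x k \<in> M" "(\<lambda>k. \<iota> (x k)) \<longlonglongrightarrow> \<xi>"
proof -
  have "\<xi> \<in> closure (\<iota> ` M)" by (simp add: dense)
  then obtain y where y: "\<And>k::nat. y k \<in> \<iota> ` M" "y \<longlonglongrightarrow> \<xi>" unfolding closure_sequential by blast
  have "\<exists>x. \<forall>k. x k \<in> M \<and> y k = \<iota> (x k)" using y(1) by (intro choice) blast
  then obtain x where x: "\<And>k. x k \<in> M" "\<And>k. y k = \<iota> (x k)" by blast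
  show ?thesis by (rule that[of x]) (use x y(2) in \<open>simp_all add: x(2)[abs_def]\<close>)
qed

lemma productI:
  assumes "\<And>x y a. (\<And>k. x k \<in> M) \<Longrightarrow> (\<And>k. y k \<in> M) \<Longrightarrow> (\<lambda>k. \<iota> (x k)) \<longlonglongrightarrow> \<xi> \<Longrightarrow> (\<lambda>k. \<iota> (y k)) \<longlonglongrightarrow> \<eta> \<Longrightarrow> a \<in> M
     \<Longrightarrow> (\<lambda>k. cinner (\<iota> (x k o\<^sub>L y k)) (\<iota> a)) \<longlonglongrightarrow> cinner \<zeta> (\<iota> a)"
  shows "is_product \<xi> \<eta> \<zeta>"
  using assms unfolding L2_product_def by blast

lemma productD:
  assumes "is_product \<xi> \<eta> \<zeta>" "\<And>k. x k \<in> M" "\<And>k. y k \<in> M" "(\<lambda>k. \<iota> (x k)) \<longlonglongrightarrow> \<xi>" "(\<lambda>k. \<iota> (y k)) \<longlonglongrightarrow> \<eta>" "a \<in> M"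
  shows "(\<lambda>k. cinner (\<iota> (x k o\<^sub>L y k)) (\<iota> a)) \<longlonglongrightarrow> cinner \<zeta> (\<iota> a)"
  using assms unfolding L2_product_def by blast

lemma product_unique:
  assumes "is_product \<xi> \<eta> \<zeta>" "is_product \<xi> \<eta> \<zeta>'" shows "\<zeta> = \<zeta>'"
proof -
  obtain x where x: "\<And>k::nat. x k \<in> M" "(\<lambda>k. \<iota> (x k)) \<longlonglongrightarrow> \<xi>" using approximation[of \<xi>] by blast
  obtain y where y: "\<And>k::nat. y k \<in> M" "(\<lambda>k. \<iota> (y k)) \<longlonglongrightarrow> \<eta>" using approximation[of \<eta>] by blast
  have "\<zeta> - \<zeta>' = 0"
  proof (rule eq_zero_if_orthogonal_dense[OF dense])
    fix d assume "d \<in> \<iota> ` M"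
    then obtain a where a: "a \<in> M" "d = \<iota> a" by blast
    have "cinner \<zeta> d = cinner \<zeta>' d" unfolding a
      by (rule LIMSEQ_unique[OF productD[OF assms(1) x(1) y(1) x(2) y(2) a(1)] productD[OF assms(2) x(1) y(1) x(2) y(2) a(1)]])
    then show "cinner (\<zeta> - \<zeta>') d = 0" by (simp add: cinner_diff_left)
  qed
  then show ?thesis by simp
qed

lemma mult_eq: "is_product \<xi> \<eta> \<zeta> \<Longrightarrow> mul \<xi> \<eta> = \<zeta>"
  unfolding L2_mult_def by (rule the_equality) (auto dest: product_unique)

text \<open>An arbitrary sequence approximating the sum is split by subtracting a fixed approximation of the first
  summand; the rest then approximates the second summand.\<close>

lemma product_add_left:
  assumes "is_product \<xi> \<eta> \<zeta>" "is_product \<xi>' \<eta> \<zeta>'" shows "is_product (\<xi> + \<xi>') \<eta> (\<zeta> + \<zeta>')"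
proof (rule productI)
  fix x y :: "nat \<Rightarrow> 'h \<Rightarrow>\<^sub>L 'h" and a
  assume x: "\<And>k. x k \<in> M" "(\<lambda>k. \<iota> (x k)) \<longlonglongrightarrow> \<xi> + \<xi>'" and y: "\<And>k. y k \<in> M" "(\<lambda>k. \<iota> (y k)) \<longlonglongrightarrow> \<eta>" and a: "a \<in> M"
  obtain u where u: "\<And>k::nat. u k \<in> M" "(\<lambda>k. \<iota> (u k)) \<longlonglongrightarrow> \<xi>" using approximation[of \<xi>] by blast
  have "(\<lambda>k. \<iota> (x k - u k)) \<longlonglongrightarrow> \<xi>'"
    using tendsto_diff[OF x(2) u(2)] x(1) u(1) by (simp add: \<iota>_diff)
  from tendsto_add[OF productD[OF assms(1) u(1) y(1) u(2) y(2) a] productD[OF assms(2) M_diff[OF x(1) u(1)] y(1) this y(2) a]]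
  have "(\<lambda>k. cinner (\<iota> ((u k o\<^sub>L y k) + ((x k - u k) o\<^sub>L y k))) (\<iota> a)) \<longlonglongrightarrow> cinner (\<zeta> + \<zeta>') (\<iota> a)"
    using x(1) y(1) u(1) by (simp add: \<iota>_add M_compose M_diff cinner_add_left)
  moreover have "(u k o\<^sub>L y k) + ((x k - u k) o\<^sub>L y k) = x k o\<^sub>L y k" for k
    by (rule blinfun_eqI) (simp add: blinfun.add_left blinfun.diff_left)
  ultimately show "(\<lambda>k. cinner (\<iota> (x k o\<^sub>L y k)) (\<iota> a)) \<longlonglongrightarrow> cinner (\<zeta> + \<zeta>') (\<iota> a)" by simp
qed

lemma product_add_right:
  assumes "is_product \<xi> \<eta> \<zeta>" "is_product \<xi> \<eta>' \<zeta>'" shows "is_product \<xi> (\<eta> + \<eta>') (\<zeta> + \<zeta>')"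
proof (rule productI)
  fix x y :: "nat \<Rightarrow> 'h \<Rightarrow>\<^sub>L 'h" and a
  assume x: "\<And>k. x k \<in> M" "(\<lambda>k. \<iota> (x k)) \<longlonglongrightarrow> \<xi>" and y: "\<And>k. y k \<in> M" "(\<lambda>k. \<iota> (y k)) \<longlonglongrightarrow> \<eta> + \<eta>'" and a: "a \<in> M"
  obtain u where u: "\<And>k::nat. u k \<in> M" "(\<lambda>k. \<iota> (u k)) \<longlonglongrightarrow> \<eta>" using approximation[of \<eta>] by blast
  have "(\<lambda>k. \<iota> (y k - u k)) \<longlonglongrightarrow> \<eta>'"
    using tendsto_diff[OF y(2) u(2)] y(1) u(1) by (simp add: \<iota>_diff)
  from tendsto_add[OF productD[OF assms(1) x(1) u(1) x(2) u(2) a] productD[OF assms(2) x(1) M_diff[OF y(1) u(1)] x(2) this a]]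
  have "(\<lambda>k. cinner (\<iota> ((x k o\<^sub>L u k) + (x k o\<^sub>L (y k - u k)))) (\<iota> a)) \<longlonglongrightarrow> cinner (\<zeta> + \<zeta>') (\<iota> a)"
    using x(1) y(1) u(1) by (simp add: \<iota>_add M_compose M_diff cinner_add_left)
  moreover have "(x k o\<^sub>L u k) + (x k o\<^sub>L (y k - u k)) = x k o\<^sub>L y k" for k
    by (rule blinfun_eqI) (simp add: blinfun.add_left blinfun.diff_left blinfun.diff_right)
  ultimately show "(\<lambda>k. cinner (\<iota> (x k o\<^sub>L y k)) (\<iota> a)) \<longlonglongrightarrow> cinner (\<zeta> + \<zeta>') (\<iota> a)" by simp
qed

lemma product_scale_nonzero_left:
  assumes "is_product \<xi> \<eta> \<zeta>" and c: "c \<noteq> 0" shows "is_product (c *\<^sub>C \<xi>) \<eta> (c *\<^sub>C \<zeta>)"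
proof (rule productI)
  fix x y :: "nat \<Rightarrow> 'h \<Rightarrow>\<^sub>L 'h" and a
  assume x: "\<And>k. x k \<in> M" "(\<lambda>k. \<iota> (x k)) \<longlonglongrightarrow> c *\<^sub>C \<xi>" and y: "\<And>k. y k \<in> M" "(\<lambda>k. \<iota> (y k)) \<longlonglongrightarrow> \<eta>" and a: "a \<in> M"
  have lim: "(\<lambda>k. \<iota> (scaleC_op (inverse c) o\<^sub>L x k)) \<longlonglongrightarrow> \<xi>"
    using tendsto_scaleC[OF x(2), of "inverse c"] x(1) c by (simp add: \<iota>_scale scaleC_scaleC scaleC_one)
  have "(\<lambda>k. c * cinner (\<iota> ((scaleC_op (inverse c) o\<^sub>L x k) o\<^sub>L y k)) (\<iota> a)) \<longlonglongrightarrow> c * cinner \<zeta> (\<iota> a)"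
    by (intro tendsto_mult_left productD[OF assms(1) M_scale[OF x(1)] y(1) lim y(2) a])
  moreover have "c * cinner (\<iota> ((scaleC_op (inverse c) o\<^sub>L x k) o\<^sub>L y k)) (\<iota> a) = cinner (\<iota> (x k o\<^sub>L y k)) (\<iota> a)" for k
  proof -
    have "(scaleC_op (inverse c) o\<^sub>L x k) o\<^sub>L y k = scaleC_op (inverse c) o\<^sub>L (x k o\<^sub>L y k)" by (rule blinfun_eqI) simp
    then show ?thesis using c x(1) y(1) by (simp add: \<iota>_scale M_compose cinner_scaleC_left)
  qed
  ultimately show "(\<lambda>k. cinner (\<iota> (x k o\<^sub>L y k)) (\<iota> a)) \<longlonglongrightarrow> cinner (c *\<^sub>C \<zeta>) (\<iota> a)" by (simp add: cinner_scaleC_left)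
qed

lemma product_scale_left:
  assumes "is_product \<xi> \<eta> \<zeta>" shows "is_product (c *\<^sub>C \<xi>) \<eta> (c *\<^sub>C \<zeta>)"
proof (cases "c = 0")
  case True
  have "is_product 0 \<eta> 0"
    using product_add_left[OF assms product_scale_nonzero_left[OF assms, of "-1"]] by (simp add: scaleC_minus_one)
  then show ?thesis using True by (simp add: scaleC_zero_left)
qed (rule product_scale_nonzero_left[OF assms])

lemma product_scale_nonzero_right:
  assumes "is_product \<xi> \<eta> \<zeta>" and c: "c \<noteq> 0" shows "is_product \<xi> (c *\<^sub>C \<eta>) (c *\<^sub>C \<zeta>)"
proof (rule productI)
  fix x y :: "nat \<Rightarrow> 'h \<Rightarrow>\<^sub>L 'h" and a
  assume x: "\<And>k. x k \<in> M" "(\<lambda>k. \<iota> (x k)) \<longlonglongrightarrow> \<xi>" and y: "\<And>k. y k \<in> M" "(\<lambda>k. \<iota> (y k)) \<longlonglongrightarrow> c *\<^sub>C \<eta>" and a: "a \<in> M"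
  have lim: "(\<lambda>k. \<iota> (scaleC_op (inverse c) o\<^sub>L y k)) \<longlonglongrightarrow> \<eta>"
    using tendsto_scaleC[OF y(2), of "inverse c"] y(1) c by (simp add: \<iota>_scale scaleC_scaleC scaleC_one)
  have "(\<lambda>k. c * cinner (\<iota> (x k o\<^sub>L (scaleC_op (inverse c) o\<^sub>L y k))) (\<iota> a)) \<longlonglongrightarrow> c * cinner \<zeta> (\<iota> a)"
    by (intro tendsto_mult_left productD[OF assms(1) x(1) M_scale[OF y(1)] x(2) lim a])
  moreover have "c * cinner (\<iota> (x k o\<^sub>L (scaleC_op (inverse c) o\<^sub>L y k))) (\<iota> a) = cinner (\<iota> (x k o\<^sub>L y k)) (\<iota> a)" for k
  proof -
    have "x k o\<^sub>L (scaleC_op (inverse c) o\<^sub>L y k) = scaleC_op (inverse c) o\<^sub>L (x k o\<^sub>L y k)"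
      by (rule blinfun_eqI) (simp add: blinfun_apply_scaleC_op M_linear[OF x(1)])
    then show ?thesis using c x(1) y(1) by (simp add: \<iota>_scale M_compose cinner_scaleC_left)
  qed
  ultimately show "(\<lambda>k. cinner (\<iota> (x k o\<^sub>L y k)) (\<iota> a)) \<longlonglongrightarrow> cinner (c *\<^sub>C \<zeta>) (\<iota> a)" by (simp add: cinner_scaleC_left)
qed

lemma product_scale_right:
  assumes "is_product \<xi> \<eta> \<zeta>" shows "is_product \<xi> (c *\<^sub>C \<eta>) (c *\<^sub>C \<zeta>)"
proof (cases "c = 0")
  case True
  have "is_product \<xi> 0 0"
    using product_add_right[OF assms product_scale_nonzero_right[OF assms, of "-1"]] by (simp add: scaleC_minus_one)
  then show ?thesis using True by (simp add: scaleC_zero_left)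
qed (rule product_scale_nonzero_right[OF assms])

lemma product_sum:
  assumes A: "finite A" "A \<noteq> {}" and B: "finite B" "B \<noteq> {}"
    and ex: "\<And>i j. i \<in> A \<Longrightarrow> j \<in> B \<Longrightarrow> is_product (x i) (y j) (z i j)"
  shows "is_product (\<Sum>i\<in>A. x i) (\<Sum>j\<in>B. y j) (\<Sum>i\<in>A. \<Sum>j\<in>B. z i j)"
proof -
  have row: "is_product (x i) (\<Sum>j\<in>B. y j) (\<Sum>j\<in>B. z i j)" if "i \<in> A" for i
    using B ex[OF that] by (induction B rule: finite_ne_induct) (auto intro: product_add_right)
  show ?thesis
    using A row by (induction A rule: finite_ne_induct) (auto intro: product_add_left)
qed

lemma state_add: "state (\<xi> + \<eta>) = state \<xi> + state \<eta>"
  and state_scale: "state (c *\<^sub>C \<xi>) = c * state \<xi>"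
  and state_sum: "state (\<Sum>i\<in>A. x i) = (\<Sum>i\<in>A. state (x i))"
  and state_zero: "state 0 = 0"
  by (simp_all add: L2_state_def cinner_add_left cinner_scaleC_left cinner_diff_left cinner_sum_left cinner_zero_left)

end

section \<open>Kernels modulo null sets\<close>

lemma L2_kernels_scale: "f \<in> L2_kernels n \<Longrightarrow> (\<lambda>t. c * f t) \<in> L2_kernels n"
  by (auto simp: L2_kernels_def norm_mult power_mult_distrib)

lemma L2_kernels_add:
  assumes f: "f \<in> L2_kernels n" and g: "g \<in> L2_kernels n"
  shows "(\<lambda>t. f t + g t) \<in> L2_kernels n"
proof -
  note [measurable] = L2_kernels_measurable[OF f] L2_kernels_measurable[OF g]
  have "integrable (orthant n) (\<lambda>t. 2 * (cmod (f t))\<^sup>2 + 2 * (cmod (g t))\<^sup>2)"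
    using f g by (intro Bochner_Integration.integrable_add integrable_mult_right) (simp_all add: L2_kernels_def)
  then have "integrable (orthant n) (\<lambda>t. (cmod (f t + g t))\<^sup>2)"
  proof (rule Bochner_Integration.integrable_bound)
    have "(cmod (f t + g t))\<^sup>2 \<le> 2 * (cmod (f t))\<^sup>2 + 2 * (cmod (g t))\<^sup>2" for t
    proof -
      have "(cmod (f t + g t))\<^sup>2 \<le> (cmod (f t) + cmod (g t))\<^sup>2"
        by (intro power_mono norm_triangle_ineq) simp
      also have "\<dots> \<le> 2 * (cmod (f t))\<^sup>2 + 2 * (cmod (g t))\<^sup>2"
        using sum_squares_bound[of "cmod (f t)" "cmod (g t)"] by (simp add: power2_sum)
      finally show ?thesis .
    qed
    then show "AE t in orthant n. norm ((cmod (f t + g t))\<^sup>2) \<le> norm (2 * (cmod (f t))\<^sup>2 + 2 * (cmod (g t))\<^sup>2)"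
      by auto
  qed measurable
  then show ?thesis by (simp add: L2_kernels_def)
qed

lemma L2_kernels_null:
  assumes "f \<in> borel_measurable (orthant n)" "AE t in orthant n. f t = 0"
  shows "f \<in> L2_kernels n"
proof -
  have "(\<integral>\<^sup>+t. (ennreal (cmod (f t)))\<^sup>2 \<partial>orthant n) = (\<integral>\<^sup>+t. 0 \<partial>orthant n)"
    by (rule nn_integral_cong_AE) (use assms(2) in auto)
  then show ?thesis using assms(1) by (simp add: L2_kernels_iff)
qed

lemma orthant_0: "orthant 0 = count_space {\<lambda>_. undefined}"
  by (simp add: orthant_def PiM_empty)

lemma const_in_L2_kernels_0: "(\<lambda>_. c) \<in> L2_kernels 0"
  unfolding L2_kernels_iff orthant_0 by (simp add: nn_integral_count_space_finite ennreal_power)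

lemma integral_orthant_0: "(LINT s|orthant 0. F s) = (F (\<lambda>_. undefined) :: complex)"
  unfolding orthant_0 by (subst lebesgue_integral_count_space_finite) auto

lemma measure_orthant_0: "measure (orthant 0) (space (orthant 0)) = 1"
  by (simp add: orthant_0 measure_def)

lemma contraction_const:
  assumes "t \<in> space (orthant n)" shows "contraction n 0 0 f (\<lambda>_. 1) t = f t"
proof -
  have "(\<lambda>i\<in>{..<n}. if i < n then t i else undefined) = t"
    using assms by (auto simp: orthant_eq_coords space_coords extensional_def fun_eq_iff)
  then show ?thesis by (simp add: contraction_def integral_orthant_0)
qed

lemma contraction_const_left:
  assumes "t \<in> space (orthant n)" shows "contraction 0 n 0 (\<lambda>_. 1) f t = f t"
proof -
  have "(\<lambda>i\<in>{..<n}. t i) = t"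
    using assms by (auto simp: orthant_eq_coords space_coords extensional_def fun_eq_iff)
  then show ?thesis by (simp add: contraction_def measure_orthant_0)
qed

section \<open>The span of multiple integrals\<close>

locale chaos = L2_space M \<phi> \<iota>
  for M :: "('h::complex_hilbert_space \<Rightarrow>\<^sub>L 'h) set" and \<phi> and \<iota> :: "('h \<Rightarrow>\<^sub>L 'h) \<Rightarrow> 'l::complex_hilbert_space" +
  fixes K :: free_process and Z :: "real \<Rightarrow> ('h \<Rightarrow>\<^sub>L 'h)" and I :: "nat \<Rightarrow> kernel \<Rightarrow> 'l"
  assumes integrals: "multiple_integrals M \<iota> Z I" and formula: "product_formula K M \<iota> I"
begin

lemma I_add: "f \<in> L2_kernels n \<Longrightarrow> g \<in> L2_kernels n \<Longrightarrow> I n (\<lambda>t. f t + g t) = I n f + I n g"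
  by (rule integrals[unfolded multiple_integrals_def, THEN conjunct1, rule_format])

lemma I_scale: "f \<in> L2_kernels n \<Longrightarrow> I n (\<lambda>t. c * f t) = c *\<^sub>C I n f"
  by (rule integrals[unfolded multiple_integrals_def, THEN conjunct2, THEN conjunct1, rule_format])

lemma I_inner: "f \<in> L2_kernels n \<Longrightarrow> g \<in> L2_kernels n \<Longrightarrow> cinner (I n f) (I n g) = kernel_inner n f g"
  by (rule integrals[unfolded multiple_integrals_def, THEN conjunct2, THEN conjunct2, THEN conjunct2, THEN conjunct1, rule_format])

lemma I_0: "f \<in> L2_kernels 0 \<Longrightarrow> I 0 f = f (\<lambda>_. undefined) *\<^sub>C one"
  by (rule integrals[unfolded multiple_integrals_def, THEN conjunct2, THEN conjunct2, THEN conjunct2, THEN conjunct2, THEN conjunct1, rule_format])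

lemma I_orthogonal: "f \<in> L2_kernels n \<Longrightarrow> g \<in> L2_kernels m \<Longrightarrow> n \<noteq> m \<Longrightarrow> cinner (I n f) (I m g) = 0"
  by (rule integrals[unfolded multiple_integrals_def, THEN conjunct2, THEN conjunct2, THEN conjunct2, THEN conjunct2, THEN conjunct2, THEN conjunct1, rule_format])

lemma I_null:
  assumes f: "f \<in> L2_kernels n" and null: "AE t in orthant n. f t = 0"
  shows "I n f = 0"
proof -
  have "kernel_inner n f f = (LINT t|orthant n. 0)"
    unfolding kernel_inner_def
  proof (rule integral_cong_AE)
    note [measurable] = L2_kernels_measurable[OF f]
    show "(\<lambda>t. f t * cnj (f t)) \<in> borel_measurable (orthant n)" by measurable
    show "AE t in orthant n. f t * cnj (f t) = 0" using null by eventually_elim simp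
  qed simp
  then have "cinner (I n f) (I n f) = 0" using I_inner[OF f f] by simp
  then show ?thesis by (simp add: cinner_self)
qed

lemma I_cong_AE:
  assumes f: "f \<in> L2_kernels n" and g: "g \<in> L2_kernels n" and eq: "AE t in orthant n. f t = g t"
  shows "I n f = I n g"
proof -
  have g': "(\<lambda>t. (-1) * g t) \<in> L2_kernels n" by (rule L2_kernels_scale[OF g])
  have "I n (\<lambda>t. f t + (-1) * g t) = 0"
    by (rule I_null[OF L2_kernels_add[OF f g']]) (use eq in auto)
  then have "I n f + (-1) *\<^sub>C I n g = 0"
    unfolding I_add[OF f g'] I_scale[OF g] .
  then show ?thesis by (simp add: scaleC_minus_one)
qed

lemma one_eq_I: "one = I 0 (\<lambda>_. 1)"
  using I_0[OF const_in_L2_kernels_0[of 1]] by (simp add: scaleC_one)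

lemma state_one: "state one = 1"
proof -
  have "state one = kernel_inner 0 (\<lambda>_. 1) (\<lambda>_. 1)"
    unfolding L2_state_def one_eq_I by (rule I_inner[OF const_in_L2_kernels_0 const_in_L2_kernels_0])
  then show ?thesis by (simp add: kernel_inner_def measure_orthant_0)
qed

lemma state_I: "f \<in> L2_kernels n \<Longrightarrow> 1 \<le> n \<Longrightarrow> state (I n f) = 0"
  unfolding L2_state_def one_eq_I by (rule I_orthogonal[OF _ const_in_L2_kernels_0]) auto

lemma state_I_0: "f \<in> L2_kernels 0 \<Longrightarrow> state (I 0 f) = f (\<lambda>_. undefined)"
  by (simp add: I_0 state_scale state_one)

definition product_integral :: "nat \<Rightarrow> kernel \<Rightarrow> nat \<Rightarrow> kernel \<Rightarrow> 'l" where
  "product_integral n f m g = (\<Sum>p\<le>min n m. I (n + m - 2 * p) (contraction n m p f g)) +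
     (if K = Compensated_Free_Poisson
      then \<Sum>p=1..min n m. I (n + m - 2 * p + 1) (star_contraction n m p f g) else 0)"

text \<open>The pairs of kernels for which the product formula is available.\<close>

definition multipliable :: "nat \<Rightarrow> kernel \<Rightarrow> nat \<Rightarrow> kernel \<Rightarrow> bool" where
  "multipliable n f m g \<longleftrightarrow> f \<in> L2_kernels n \<and> g \<in> L2_kernels m \<and>
     (K = Compensated_Free_Poisson \<longrightarrow>
       (\<forall>p\<in>{1..min n m}. star_contraction n m p f g \<in> L2_kernels (n + m - 2 * p + 1)))"

lemma product_I: "multipliable n f m g \<Longrightarrow> is_product (I n f) (I m g) (product_integral n f m g)"
  using formula unfolding product_formula_def multipliable_def product_integral_def
  by (cases K) auto

lemma product_one_right: assumes f: "f \<in> L2_kernels n" shows "is_product (I n f) one (I n f)"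
proof -
  have "multipliable n f 0 (\<lambda>_. 1)" using f const_in_L2_kernels_0 by (simp add: multipliable_def)
  from product_I[OF this, unfolded product_integral_def] have "is_product (I n f) one (I n (contraction n 0 0 f (\<lambda>_. 1)))"
    by (cases "K = Compensated_Free_Poisson") (simp_all add: one_eq_I)
  also have "I n (contraction n 0 0 f (\<lambda>_. 1)) = I n f"
    using contraction_in_L2[OF f const_in_L2_kernels_0, of 0 1] contraction_const[of _ n f]
    by (intro I_cong_AE f) (auto intro!: AE_I2)
  finally show ?thesis .
qed

lemma product_one_left: assumes f: "f \<in> L2_kernels n" shows "is_product one (I n f) (I n f)"
proof -
  have "multipliable 0 (\<lambda>_. 1) n f" using f const_in_L2_kernels_0 by (simp add: multipliable_def)
  from product_I[OF this, unfolded product_integral_def] have "is_product one (I n f) (I n (contraction 0 n 0 (\<lambda>_. 1) f))"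
    by (cases "K = Compensated_Free_Poisson") (simp_all add: one_eq_I)
  also have "I n (contraction 0 n 0 (\<lambda>_. 1) f) = I n f"
    using contraction_in_L2[OF const_in_L2_kernels_0 f, of 0 1] contraction_const_left[of _ n f]
    by (intro I_cong_AE f) (auto intro!: AE_I2)
  finally show ?thesis .
qed

text \<open>Only an integral of order \<open>0\<close> has nonzero state, and it arises only if both orders agree and all
  variables are contracted.\<close>

lemma state_product_integral:
  assumes "multipliable n f m g"
  shows "state (product_integral n f m g) =
    (if n = m then LINT t|orthant n. f t * g (\<lambda>i\<in>{..<n}. t (n - 1 - i)) else 0)"
proof -
  have f: "f \<in> L2_kernels n" and g: "g \<in> L2_kernels m" using assms by (auto simp: multipliable_def)
  have star: "state (if K = Compensated_Free_Poisson
      then \<Sum>p=1..min n m. I (n + m - 2 * p + 1) (star_contraction n m p f g) else 0) = 0"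
    using assms by (auto simp: multipliable_def state_sum state_zero intro!: sum.neutral state_I)
  have c: "contraction n m p f g \<in> L2_kernels (n + m - 2 * p)" if "p \<le> min n m" for p
    using that by (intro contraction_in_L2 f g) auto
  have "state (product_integral n f m g) = (\<Sum>p\<le>min n m. state (I (n + m - 2 * p) (contraction n m p f g)))"
    unfolding product_integral_def state_add star by (simp add: state_sum)
  also have "\<dots> = (\<Sum>p\<le>min n m. if p = n \<and> n = m then contraction n n n f g (\<lambda>_. undefined) else 0)"
  proof (rule sum.cong[OF refl])
    fix p assume p: "p \<in> {..min n m}"
    show "state (I (n + m - 2 * p) (contraction n m p f g)) = (if p = n \<and> n = m then contraction n n n f g (\<lambda>_. undefined) else 0)"
    proof (cases "p = n \<and> n = m")
      case True
      then show ?thesis using c[of p] p by (simp add: state_I_0)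
    next
      case False
      then have "1 \<le> n + m - 2 * p" using p by auto
      then have "state (I (n + m - 2 * p) (contraction n m p f g)) = 0" using p by (intro state_I c) auto
      then show ?thesis using False by (simp only: if_False)
    qed
  qed
  also have "\<dots> = (if n = m then contraction n n n f g (\<lambda>_. undefined) else 0)"
    by (cases "n = m") auto
  also have "\<dots> = (if n = m then LINT t|orthant n. f t * g (\<lambda>i\<in>{..<n}. t (n - 1 - i)) else 0)"
  proof (cases "n = m")
    case True
    have "contraction n n n f g (\<lambda>_. undefined) = (LINT t|orthant n. f t * g (\<lambda>i\<in>{..<n}. t (n - 1 - i)))"
      unfolding contraction_def
    proof (rule Bochner_Integration.integral_cong[OF refl])
      fix s assume "s \<in> space (orthant n)"
      then have "(\<lambda>i\<in>{..<n}. if i < n - n then undefined else s (i - (n - n))) = s"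
        by (auto simp: orthant_eq_coords space_coords extensional_def fun_eq_iff)
      moreover have "(\<lambda>i\<in>{..<n}. if i < n then s (n - 1 - i) else undefined) = (\<lambda>i\<in>{..<n}. s (n - 1 - i))" by auto
      ultimately show "f (\<lambda>i\<in>{..<n}. if i < n - n then undefined else s (i - (n - n))) *
         g (\<lambda>i\<in>{..<n}. if i < n then s (n - 1 - i) else undefined) = f s * g (\<lambda>i\<in>{..<n}. s (n - 1 - i))" by simp
    qed
    then show ?thesis using True by simp
  qed simp
  finally show ?thesis .
qed

inductive_set span_I :: "(nat \<times> kernel) set \<Rightarrow> 'l set" for G where
  base: "(k, h) \<in> G \<Longrightarrow> c *\<^sub>C I k h \<in> span_I G"
| add: "\<xi> \<in> span_I G \<Longrightarrow> \<eta> \<in> span_I G \<Longrightarrow> \<xi> + \<eta> \<in> span_I G"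

lemma span_I_gen: "(k, h) \<in> G \<Longrightarrow> I k h \<in> span_I G"
  using span_I.base[of k h G 1] by (simp add: scaleC_one)

lemma span_I_scale: "\<xi> \<in> span_I G \<Longrightarrow> c *\<^sub>C \<xi> \<in> span_I G"
  by (induction rule: span_I.induct) (auto simp: scaleC_scaleC scaleC_add_right intro: span_I.intros)

lemma span_I_zero: "(k, h) \<in> G \<Longrightarrow> 0 \<in> span_I G"
  using span_I.base[of k h G 0] by (simp add: scaleC_zero_left)

lemma span_I_sum:
  assumes "(k, h) \<in> G" "\<And>i. i \<in> A \<Longrightarrow> x i \<in> span_I G" shows "(\<Sum>i\<in>A. x i) \<in> span_I G"
  using assms(2) by (induction A rule: infinite_finite_induct) (auto intro: span_I_zero[OF assms(1)] span_I.add)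

lemma span_I_mono:
  assumes "G \<subseteq> G'" "\<xi> \<in> span_I G" shows "\<xi> \<in> span_I G'"
  using assms(2) by (induction rule: span_I.induct) (use assms(1) in \<open>auto intro: span_I.intros\<close>)

text \<open>Bilinearity extends the product from the generators; in particular it exists for the elements of the
  spans.\<close>

lemma span_I_product:
  assumes ex: "\<And>k h l u. (k, h) \<in> G1 \<Longrightarrow> (l, u) \<in> G2 \<Longrightarrow> \<exists>\<zeta>\<in>span_I G3. is_product (I k h) (I l u) \<zeta>"
    and \<xi>: "\<xi> \<in> span_I G1" and \<eta>: "\<eta> \<in> span_I G2"
  shows "mul \<xi> \<eta> \<in> span_I G3 \<and> is_product \<xi> \<eta> (mul \<xi> \<eta>)"
proof -
  have right: "\<exists>\<zeta>\<in>span_I G3. is_product (I k h) \<eta> \<zeta>" if kh: "(k, h) \<in> G1" for k h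
    using \<eta>
  proof (induction rule: span_I.induct)
    case (base l u c)
    then show ?case using ex[OF kh base] by (meson product_scale_right span_I_scale)
  next
    case (add x y)
    then show ?case by (meson product_add_right span_I.add)
  qed
  have "\<exists>\<zeta>\<in>span_I G3. is_product \<xi> \<eta> \<zeta>"
    using \<xi>
  proof (induction rule: span_I.induct)
    case (base k h c)
    then show ?case using right[OF base] by (meson product_scale_left span_I_scale)
  next
    case (add x y)
    then show ?case by (meson product_add_left span_I.add)
  qed
  then show ?thesis using mult_eq by blast
qed

lemma span_I_one:
  assumes G: "\<And>k h. (k, h) \<in> G \<Longrightarrow> h \<in> L2_kernels k" and \<xi>: "\<xi> \<in> span_I G"
  shows "is_product \<xi> one \<xi>" "is_product one \<xi> \<xi>"
  using \<xi>
proof (induction rule: span_I.induct)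
  case (base k h c)
  {
    case 1 show ?case by (intro product_scale_left product_one_right G base)
  next
    case 2 show ?case by (intro product_scale_right product_one_left G base)
  }
next
  case (add x y)
  {
    case 1 show ?case using add by (intro product_add_left)
  next
    case 2 show ?case using add by (intro product_add_right)
  }
qed

lemma state_span_I:
  assumes G: "\<And>k h. (k, h) \<in> G \<Longrightarrow> 1 \<le> k \<and> h \<in> L2_kernels k" and \<xi>: "\<xi> \<in> span_I G"
  shows "state \<xi> = 0"
  using \<xi> by (induction rule: span_I.induct) (use G in \<open>auto simp: state_scale state_add state_I\<close>)

end

section \<open>Kernels generated by one integrand\<close>

text \<open>Star contractions are admitted for the Poisson process only, since for the Brownian motion they do
  not occur in the product formula and need not be square-integrable.\<close>

inductive_set chaos_kernels :: "free_process \<Rightarrow> (nat \<times> kernel) set \<Rightarrow> (nat \<times> kernel) set"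
  for K :: free_process and F :: "(nat \<times> kernel) set" where
  base: "(n, f) \<in> F \<Longrightarrow> (n, f) \<in> chaos_kernels K F"
| contraction: "\<lbrakk>(n, f) \<in> chaos_kernels K F; (m, g) \<in> chaos_kernels K F; p \<le> min n m\<rbrakk>
    \<Longrightarrow> (n + m - 2 * p, contraction n m p f g) \<in> chaos_kernels K F"
| star_contraction:
    "\<lbrakk>K = Compensated_Free_Poisson; (n, f) \<in> chaos_kernels K F; (m, g) \<in> chaos_kernels K F; 1 \<le> p; p \<le> min n m\<rbrakk>
    \<Longrightarrow> (n + m - 2 * p + 1, star_contraction n m p f g) \<in> chaos_kernels K F"

lemma chaos_kernels_mono:
  assumes "F \<subseteq> F'" "(k, h) \<in> chaos_kernels K F" shows "(k, h) \<in> chaos_kernels K F'"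
  using assms(2) by (induction rule: chaos_kernels.induct) (blast intro: chaos_kernels.intros subsetD[OF assms(1)])+

lemma chaos_kernels_generated:
  "(k, h) \<in> chaos_kernels K F \<Longrightarrow> (k, h) \<in> generated_kernels F"
  by (induction rule: chaos_kernels.induct) (blast intro: generated_kernels.intros)+

lemma chaos_kernels_L2:
  assumes F: "\<And>k h. (k, h) \<in> F \<Longrightarrow> h \<in> L2_kernels k"
    and P: "K = Compensated_Free_Poisson \<Longrightarrow> \<forall>(k, h) \<in> generated_kernels F. h \<in> L2_kernels k"
    and kh: "(k, h) \<in> chaos_kernels K F"
  shows "h \<in> L2_kernels k"
proof (cases "K = Compensated_Free_Poisson")
  case True
  then show ?thesis using P chaos_kernels_generated[OF kh] by blast
next
  case False
  show ?thesis
    using kh by (induction rule: chaos_kernels.induct) (use F False in \<open>auto intro: contraction_in_L2\<close>)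
qed

lemma chaos_kernels_separated:
  assumes F: "f \<in> L2_kernels n" and u: "u \<in> L2_kernels l" "separated n f l u"
    and kh: "(k, h) \<in> chaos_kernels Free_Brownian {(n, f)}"
  shows "h \<in> L2_kernels k \<and> separated k h l u"
  using kh
proof (induction rule: chaos_kernels.induct)
  case (base k h)
  then show ?case using F u by simp
next
  case (contraction k1 h1 k2 h2 p)
  then have "separated l u (k1 + k2 - 2 * p) (contraction k1 k2 p h1 h2)"
    by (intro separated_contraction u(1)) (auto intro: separated_commute)
  then show ?case using contraction by (auto intro: separated_commute contraction_in_L2)
qed simp

lemma chaos_kernels_vanishes_on:
  assumes L2: "\<And>k h. (k, h) \<in> chaos_kernels K {(n, f)} \<Longrightarrow> h \<in> L2_kernels k" and f: "vanishes_on E n f"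
    and kh: "(k, h) \<in> chaos_kernels K {(n, f)}"
  shows "vanishes_on E k h"
  using kh
proof (induction rule: chaos_kernels.induct)
  case (base k h)
  then show ?case using f by simp
next
  case (contraction k1 h1 k2 h2 p)
  have "represents_contraction 0 k1 k2 p h1 h2 (contraction k1 k2 p h1 h2)"
    using contraction by (intro represents_contraction_contraction) (auto intro: L2_kernels_measurable L2)
  from vanishes_on_contraction[OF this] show ?case using contraction by simp
next
  case (star_contraction k1 h1 k2 h2 p)
  have "represents_contraction 1 k1 k2 p h1 h2 (star_contraction k1 k2 p h1 h2)"
    using star_contraction by (intro represents_contraction_star) (auto intro: L2_kernels_measurable L2)
  from vanishes_on_contraction[OF this] show ?case using star_contraction by simp
qed

context chaos
begin

lemma product_integral_span:
  assumes "\<And>p. p \<le> min k l \<Longrightarrow> (k + l - 2 * p, contraction k l p h u) \<in> G"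
    and "\<And>p. K = Compensated_Free_Poisson \<Longrightarrow> 1 \<le> p \<Longrightarrow> p \<le> min k l \<Longrightarrow> (k + l - 2 * p + 1, star_contraction k l p h u) \<in> G"
  shows "product_integral k h l u \<in> span_I G"
proof -
  have G: "(k + l - 2 * 0, contraction k l 0 h u) \<in> G" by (rule assms(1)) simp
  have 1: "(\<Sum>p\<le>min k l. I (k + l - 2 * p) (contraction k l p h u)) \<in> span_I G"
    by (rule span_I_sum[OF G]) (auto intro!: span_I_gen assms(1))
  have 2: "(\<Sum>p=1..min k l. I (k + l - 2 * p + 1) (star_contraction k l p h u)) \<in> span_I G" if "K = Compensated_Free_Poisson"
    by (rule span_I_sum[OF G]) (rule span_I_gen, use assms(2) that in auto)
  show ?thesis unfolding product_integral_def
    using 1 2 span_I_zero[OF G] by (auto intro: span_I.add)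
qed

section \<open>Annihilating pairs and alternating words\<close>

definition annihilates :: "nat \<Rightarrow> kernel \<Rightarrow> nat \<Rightarrow> kernel \<Rightarrow> bool" where
  "annihilates k h l u \<longleftrightarrow> (\<forall>p. 1 \<le> p \<and> p \<le> min k l \<longrightarrow>
     (AE t in orthant (k + l - 2 * p). contraction k l p h u t = 0) \<and>
     (K = Compensated_Free_Poisson \<longrightarrow> (AE t in orthant (k + l - 2 * p + 1). star_contraction k l p h u t = 0)))"

text \<open>All terms of the product formula vanish except for the one without integrated or shared variables, the
  tensor product.\<close>

lemma product_of_annihilating:
  assumes h: "h \<in> L2_kernels k" and u: "u \<in> L2_kernels l" and ann: "annihilates k h l u"
  shows "is_product (I k h) (I l u) (I (k + l) (contraction k l 0 h u))"
proof -
  note hm = L2_kernels_measurable[OF h] and um = L2_kernels_measurable[OF u]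
  have star: "star_contraction k l p h u \<in> L2_kernels (k + l - 2 * p + 1) \<and> I (k + l - 2 * p + 1) (star_contraction k l p h u) = 0"
    if "K = Compensated_Free_Poisson" "1 \<le> p" "p \<le> min k l" for p
  proof -
    have null: "AE t in orthant (k + l - 2 * p + 1). star_contraction k l p h u t = 0"
      using ann that unfolding annihilates_def by blast
    have "star_contraction k l p h u \<in> borel_measurable (orthant (k + l - 2 * p + 1))"
      using that by (intro measurable_star_contraction hm um) auto
    then show ?thesis using L2_kernels_null null I_null by blast
  qed
  have con: "I (k + l - 2 * p) (contraction k l p h u) = 0" if "1 \<le> p" "p \<le> min k l" for p
  proof (rule I_null)
    show "contraction k l p h u \<in> L2_kernels (k + l - 2 * p)" using that by (intro contraction_in_L2 h u) auto
    show "AE t in orthant (k + l - 2 * p). contraction k l p h u t = 0" using ann that unfolding annihilates_def by blast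
  qed
  have "multipliable k h l u" using h u star by (auto simp: multipliable_def)
  from product_I[OF this] have "is_product (I k h) (I l u) (product_integral k h l u)" .
  also have "product_integral k h l u = I (k + l) (contraction k l 0 h u)"
  proof -
    have "(\<Sum>p\<le>min k l. I (k + l - 2 * p) (contraction k l p h u)) = (\<Sum>p\<in>{0}. I (k + l - 2 * p) (contraction k l p h u))"
      by (rule sum.mono_neutral_right) (use con in auto)
    moreover have "(if K = Compensated_Free_Poisson then \<Sum>p=1..min k l. I (k + l - 2 * p + 1) (star_contraction k l p h u) else 0) = 0"
      using star by (auto intro!: sum.neutral)
    ultimately show ?thesis unfolding product_integral_def by simp
  qed
  finally show ?thesis .
qed

definition closed_family :: "(nat \<times> kernel) set \<Rightarrow> bool" where
  "closed_family G \<longleftrightarrow> (\<forall>(k, h)\<in>G. h \<in> L2_kernels k) \<and>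
     (\<forall>(k, h)\<in>G. \<forall>(l, u)\<in>G. \<exists>\<zeta>\<in>span_I G. is_product (I k h) (I l u) \<zeta>)"

lemma closed_family_L2: "closed_family G \<Longrightarrow> (k, h) \<in> G \<Longrightarrow> h \<in> L2_kernels k"
  and closed_family_product: "closed_family G \<Longrightarrow> (k, h) \<in> G \<Longrightarrow> (l, u) \<in> G \<Longrightarrow> \<exists>\<zeta>\<in>span_I G. is_product (I k h) (I l u) \<zeta>"
  unfolding closed_family_def by fast+

lemma L2_pow_span:
  assumes G: "closed_family G" "(n, f) \<in> G"
  shows "L2_pow M \<iota> (I n f) (Suc j) \<in> span_I G"
proof (induction j)
  case 0
  have "mul (I n f) one = I n f" by (rule mult_eq[OF product_one_right[OF closed_family_L2[OF G]]])
  then show ?case using span_I_gen[OF G(2)] by simp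
next
  case (Suc j)
  have "mul (I n f) (L2_pow M \<iota> (I n f) (Suc j)) \<in> span_I G"
    using span_I_product[OF closed_family_product[OF G(1)] span_I_gen[OF G(2)] Suc] by blast
  then show ?case by simp
qed

definition center :: "'l \<Rightarrow> 'l" where "center \<xi> = \<xi> - state \<xi> *\<^sub>C one"

lemma center_add: "center (\<xi> + \<eta>) = center \<xi> + center \<eta>"
  by (simp add: center_def state_add scaleC_add_left)

lemma center_scale: "center (c *\<^sub>C \<xi>) = c *\<^sub>C center \<xi>"
  by (simp add: center_def state_scale scaleC_diff_right scaleC_scaleC)

lemma center_span:
  assumes G: "closed_family G" "(n, f) \<in> G" "1 \<le> n" and \<xi>: "\<xi> \<in> span_I G"
  shows "center \<xi> \<in> span_I {(k, h) \<in> G. 1 \<le> k}"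
  using \<xi>
proof (induction rule: span_I.induct)
  case (base k h c)
  note h = closed_family_L2[OF G(1) base]
  have "center (I k h) \<in> span_I {(k, h) \<in> G. 1 \<le> k}"
  proof (cases "1 \<le> k")
    case True
    then have "center (I k h) = I k h" using state_I[OF h] by (simp add: center_def scaleC_zero_left)
    then show ?thesis using base True by (auto intro: span_I_gen)
  next
    case False
    then have k: "k = 0" by simp
    have "center (I k h) = 0" using h unfolding k by (simp add: center_def state_scale state_one I_0)
    then show ?thesis using G by (auto intro: span_I_zero[of n f])
  qed
  then show ?case by (simp add: center_scale span_I_scale)
next
  case (add x y)
  then show ?case by (simp add: center_add span_I.add)
qed

text \<open>Subtracting the state from a combination of multiple integrals removes precisely the terms of order
  \<open>0\<close>, which are multiples of the unit.\<close>

lemma L2_centered_poly_span: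
  assumes G: "closed_family G" "(n, f) \<in> G" "1 \<le> n"
  shows "L2_centered_poly M \<iota> P (I n f) \<in> span_I {(k, h) \<in> G. 1 \<le> k}"
proof -
  define GP where "GP = {(k, h) \<in> G. 1 \<le> k}"
  have nf: "(n, f) \<in> GP" using G by (simp add: GP_def)
  have pow: "center (L2_pow M \<iota> (I n f) j) \<in> span_I GP" for j
  proof (cases j)
    case 0
    have "center one = 0" by (simp add: center_def state_one scaleC_one)
    then show ?thesis using 0 span_I_zero[OF nf] by simp
  next
    case (Suc i)
    then show ?thesis using center_span[OF G L2_pow_span[OF G(1,2)], of i] by (simp add: GP_def)
  qed
  have zero: "center 0 = 0" by (simp add: center_def state_zero scaleC_zero_left)
  have "center (\<Sum>j\<in>J. coeff P j *\<^sub>C L2_pow M \<iota> (I n f) j) \<in> span_I GP" for J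
    by (induction J rule: infinite_finite_induct)
      (auto simp: zero center_add center_scale intro: span_I_zero[OF nf] span_I.add span_I_scale pow)
  then show ?thesis by (simp add: L2_centered_poly_def L2_poly_def center_def GP_def)
qed

text \<open>Centred polynomials in the two elements are combinations of integrals of kernels from \<open>G 0\<close>,
  respectively \<open>G 1\<close>. The proof shows by induction, from the right, that a word whose first letter has index \<open>i\<close> lies in the span of
  \<open>W i\<close>, the kernels of positive order that are annihilated from the left by the letters with the
  other index. The hypothesis on tensor products says that \<open>W i\<close> absorbs another letter of index \<open>i\<close> on
  the left.\<close>

lemma free_of_annihilating:
  fixes G :: "nat \<Rightarrow> (nat \<times> kernel) set"
  assumes GA: "closed_family (G 0)" "(n, f) \<in> G 0" "1 \<le> n" and GB: "closed_family (G 1)" "(m, g) \<in> G 1" "1 \<le> m"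
    and ann: "\<And>i k h l u. i < 2 \<Longrightarrow> (k, h) \<in> G (1 - i) \<Longrightarrow> 1 \<le> k \<Longrightarrow> (l, u) \<in> G i \<Longrightarrow> 1 \<le> l \<Longrightarrow> annihilates k h l u"
    and tensor: "\<And>i k h l u l' u'. i < 2 \<Longrightarrow> (k, h) \<in> G (1 - i) \<Longrightarrow> 1 \<le> k \<Longrightarrow> (l, u) \<in> G i \<Longrightarrow> 1 \<le> l \<Longrightarrow> u' \<in> L2_kernels l'
        \<Longrightarrow> annihilates k h (l + l') (contraction l l' 0 u u')"
  shows "L2_free M \<iota> [I n f, I m g]"
  unfolding L2_free_def
proof (intro allI impI, elim conjE)
  fix ps :: "(complex poly \<times> nat) list"
  define X where "X = (\<lambda>i. [I n f, I m g] ! i)"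
  \<comment> \<open>The index of the other element is \<open>1 - i\<close>.\<close>
  define W where "W = (\<lambda>i. {(l, u). 1 \<le> l \<and> u \<in> L2_kernels l \<and> (\<forall>(k, h)\<in>G (1 - i). 1 \<le> k \<longrightarrow> annihilates k h l u)})"
  have G: "closed_family (G i)" if "i < 2" for i
  proof -
    have "i = 0 \<or> i = 1" using that by auto
    then show ?thesis using GA(1) GB(1) by blast
  qed
  have letter: "L2_centered_poly M \<iota> P (X i) \<in> span_I {(k, h) \<in> G i. 1 \<le> k}" if "i < 2" for i P
  proof -
    have "i = 0 \<or> i = 1" using that by auto
    then show ?thesis
      using L2_centered_poly_span[OF GA, of P] L2_centered_poly_span[OF GB, of P] by (auto simp: X_def)
  qed
  have GW: "{(k, h) \<in> G i. 1 \<le> k} \<subseteq> W i" if "i < 2" for i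
    using ann[OF that] closed_family_L2[OF G[OF that]] by (auto simp: W_def)
  have step: "\<exists>\<zeta>\<in>span_I (W i). is_product (I k h) (I l u) \<zeta>"
    if i: "i < 2" "j < 2" "i \<noteq> j" and kh: "(k, h) \<in> {(k, h) \<in> G i. 1 \<le> k}" and lu: "(l, u) \<in> W j" for i j k h l u
  proof -
    have ij: "1 - j = i" using i by auto
    have h: "h \<in> L2_kernels k" "1 \<le> k" "(k, h) \<in> G i" using kh closed_family_L2[OF G[OF i(1)]] by auto
    have u: "u \<in> L2_kernels l" "annihilates k h l u" using lu h(2,3) unfolding W_def ij by auto
    have "contraction k l 0 h u \<in> L2_kernels (k + l)" using contraction_in_L2[OF h(1) u(1), of 0] by simp
    then have "(k + l, contraction k l 0 h u) \<in> W i"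
      using tensor[OF i(1) _ _ h(3,2) u(1)] h(2) by (auto simp: W_def)
    then show ?thesis using product_of_annihilating[OF h(1) u] span_I_gen by blast
  qed
  have word: "ps \<noteq> [] \<Longrightarrow> \<forall>(P, i)\<in>set ps. i < 2 \<Longrightarrow> distinct_adj (map snd ps) \<Longrightarrow>
     foldr mul (map (\<lambda>(P, i). L2_centered_poly M \<iota> P (X i)) ps) one \<in> span_I (W (snd (hd ps)))"
  proof (induction ps)
    case (Cons p ps)
    obtain P i where p: "p = (P, i)" by (cases p)
    have i: "i < 2" using Cons.prems p by auto
    note a = letter[OF i, of P]
    show ?case
    proof (cases ps)
      case Nil
      have "mul (L2_centered_poly M \<iota> P (X i)) one = L2_centered_poly M \<iota> P (X i)"
        by (rule mult_eq[OF span_I_one(1)[OF _ a]]) (use closed_family_L2[OF G[OF i]] in auto)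
      then show ?thesis using span_I_mono[OF GW[OF i] a] Nil p by simp
    next
      case (Cons q qs)
      obtain Q j where q: "q = (Q, j)" by (cases q)
      have j: "j < 2" "i \<noteq> j" using Cons.prems Cons p q by auto
      have "foldr mul (map (\<lambda>(P, i). L2_centered_poly M \<iota> P (X i)) ps) one \<in> span_I (W j)"
        using Cons.IH Cons.prems Cons q by auto
      then have "mul (L2_centered_poly M \<iota> P (X i)) (foldr mul (map (\<lambda>(P, i). L2_centered_poly M \<iota> P (X i)) ps) one) \<in> span_I (W i)"
        using span_I_product[OF step[OF i j] a] by blast
      then show ?thesis using p by simp
    qed
  qed simp
  assume "ps \<noteq> []" "\<forall>(P, i)\<in>set ps. i < length [I n f, I m g]" "distinct_adj (map snd ps)"
  then have *: "foldr mul (map (\<lambda>(P, i). L2_centered_poly M \<iota> P (X i)) ps) one \<in> span_I (W (snd (hd ps)))"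
    by (intro word) (auto simp: numeral_2_eq_2)
  show "state (foldr mul (map (\<lambda>(P, i). L2_centered_poly M \<iota> P ([I n f, I m g] ! i)) ps) one) = 0"
    by (rule state_span_I[OF _ *[unfolded X_def]]) (auto simp: W_def)
qed

end

section \<open>The covariance of the squares\<close>

lemma sum_even_odd:
  fixes F :: "nat \<Rightarrow> 'a::comm_monoid_add"
  shows "(\<Sum>j\<le>2 * n. F j) = (\<Sum>i\<le>n. F (2 * i)) + (\<Sum>i=1..n. F (2 * i - 1))"
  by (induction n) (simp_all add: ac_simps)

context chaos
begin

text \<open>The component of order \<open>j = 2r - e\<close> of the square, with \<open>e\<close> equal to \<open>0\<close> or \<open>1\<close>: of the \<open>n\<close> variables
  of each factor, \<open>n - r + e\<close> are shared, and \<open>e\<close> of these are not integrated.\<close>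

definition square_kernel :: "nat \<Rightarrow> kernel \<Rightarrow> nat \<Rightarrow> kernel" where
  "square_kernel n f j =
    (if even j then contraction n n (n - j div 2) f f
     else if K = Compensated_Free_Poisson then star_contraction n n (n - (j + 1) div 2 + 1) f f else (\<lambda>_. 0))"

text \<open>The contraction of \<open>f\<close> with \<open>g\<close> whose norm is the contribution of order \<open>j = 2r - e\<close> to the
  covariance: \<open>r\<close> variables are shared, and \<open>e\<close> of these are not integrated.\<close>

definition mixed_kernel :: "nat \<Rightarrow> kernel \<Rightarrow> nat \<Rightarrow> kernel \<Rightarrow> nat \<Rightarrow> kernel" where
  "mixed_kernel n f m g j =
    (if even j then contraction n m (j div 2) f g
     else if K = Compensated_Free_Poisson then star_contraction n m ((j + 1) div 2) f g else (\<lambda>_. 0))"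

lemma product_integral_square:
  "product_integral n f n f = (\<Sum>j\<le>2 * n. I j (square_kernel n f j))"
proof -
  have even: "(\<Sum>p\<le>n. I (n + n - 2 * p) (contraction n n p f f)) = (\<Sum>i\<le>n. I (2 * i) (square_kernel n f (2 * i)))"
  proof (rule sum.reindex_bij_witness[of _ "\<lambda>i. n - i" "\<lambda>i. n - i"])
    fix p assume "p \<in> {..n}"
    then have "n + n - 2 * p = 2 * (n - p)" "square_kernel n f (2 * (n - p)) = contraction n n p f f"
      by (auto simp: square_kernel_def)
    then show "I (2 * (n - p)) (square_kernel n f (2 * (n - p))) = I (n + n - 2 * p) (contraction n n p f f)" by simp
  qed auto
  have odd: "(if K = Compensated_Free_Poisson
      then \<Sum>p=1..n. I (n + n - 2 * p + 1) (star_contraction n n p f f) else 0)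
      = (\<Sum>i=1..n. I (2 * i - 1) (square_kernel n f (2 * i - 1)))"
  proof (cases "K = Compensated_Free_Poisson")
    case True
    have "(\<Sum>p=1..n. I (n + n - 2 * p + 1) (star_contraction n n p f f))
        = (\<Sum>i=1..n. I (2 * i - 1) (square_kernel n f (2 * i - 1)))"
    proof (rule sum.reindex_bij_witness[of _ "\<lambda>i. n - i + 1" "\<lambda>i. n - i + 1"])
      fix p assume p: "p \<in> {1..n}"
      have "square_kernel n f (2 * (n - p + 1) - 1) = star_contraction n n (n - (2 * (n - p + 1) - 1 + 1) div 2 + 1) f f"
        unfolding square_kernel_def using True by simp
      moreover have "n - (2 * (n - p + 1) - 1 + 1) div 2 + 1 = p" "2 * (n - p + 1) - 1 = n + n - 2 * p + 1" using p by auto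
      ultimately show "I (2 * (n - p + 1) - 1) (square_kernel n f (2 * (n - p + 1) - 1)) = I (n + n - 2 * p + 1) (star_contraction n n p f f)"
        by (simp only:)
    qed auto
    then show ?thesis using True by simp
  next
    case False
    have "I (2 * i - 1) (square_kernel n f (2 * i - 1)) = 0" if "i \<in> {1..n}" for i
    proof -
      have "odd (2 * i - 1)" using that by auto
      then have sq: "square_kernel n f (2 * i - 1) = (\<lambda>_. 0)" using False by (simp add: square_kernel_def)
      show ?thesis unfolding sq by (rule I_null) (auto intro: L2_kernels_null)
    qed
    then show ?thesis using False by simp
  qed
  show ?thesis unfolding sum_even_odd product_integral_def min.idem even odd ..
qed

lemma state_square:
  assumes "\<And>j. j \<le> 2 * n \<Longrightarrow> square_kernel n f j \<in> L2_kernels j"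
  shows "state (\<Sum>j\<le>2 * n. I j (square_kernel n f j)) = square_kernel n f 0 (\<lambda>_. undefined)"
proof -
  have "state (\<Sum>j\<le>2 * n. I j (square_kernel n f j)) = (\<Sum>j\<in>{0}. state (I j (square_kernel n f j)))"
    unfolding state_sum by (rule sum.mono_neutral_right) (use assms in \<open>auto intro!: state_I\<close>)
  then show ?thesis using assms[of 0] by (simp add: state_I_0)
qed

text \<open>The product of the two expansions is paired order by order. The term of order \<open>0\<close> is the product of
  the states, which the covariance subtracts, and \<open>contraction_square_pairing\<close> evaluates the others.\<close>

lemma covariance_of_squares:
  assumes f: "f \<in> L2_kernels n" "symmetric_kernel n f" and g: "g \<in> L2_kernels m" "symmetric_kernel m g"
    and ff: "multipliable n f n f" and gg: "multipliable m g m g" and fg: "multipliable n f m g"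
    and sq: "\<And>i j. i \<le> 2 * n \<Longrightarrow> j \<le> 2 * m \<Longrightarrow> multipliable i (square_kernel n f i) j (square_kernel m g j)"
  shows "L2_cov M \<iota> (L2_pow M \<iota> (I n f) 2) (L2_pow M \<iota> (I m g) 2)
     = complex_of_real (\<Sum>j=1..2 * min n m. LINT t|orthant (n + m - j). (cmod (mixed_kernel n f m g j t))\<^sup>2)"
    and "\<exists>\<zeta>. is_product (L2_pow M \<iota> (I n f) 2) (L2_pow M \<iota> (I m g) 2) \<zeta>"
    and "\<And>j. 1 \<le> j \<Longrightarrow> j \<le> 2 * min n m \<Longrightarrow> mixed_kernel n f m g j \<in> L2_kernels (n + m - j)"
proof -
  define F2 where "F2 = L2_pow M \<iota> (I n f) 2"
  define G2 where "G2 = L2_pow M \<iota> (I m g) 2"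
  have pow2: "L2_pow M \<iota> (I k h) 2 = (\<Sum>j\<le>2 * k. I j (square_kernel k h j))" if "multipliable k h k h" for k h
  proof -
    have h: "h \<in> L2_kernels k" using that by (simp add: multipliable_def)
    have "L2_pow M \<iota> (I k h) 2 = mul (I k h) (I k h)"
      using mult_eq[OF product_one_right[OF h]] by (simp add: numeral_2_eq_2)
    then show ?thesis using mult_eq[OF product_I[OF that]] by (simp add: product_integral_square)
  qed
  have F2: "F2 = (\<Sum>j\<le>2 * n. I j (square_kernel n f j))" unfolding F2_def by (rule pow2[OF ff])
  have G2: "G2 = (\<Sum>j\<le>2 * m. I j (square_kernel m g j))" unfolding G2_def by (rule pow2[OF gg])
  have sqf: "square_kernel n f j \<in> L2_kernels j" if "j \<le> 2 * n" for j using sq[OF that, of 0] by (simp add: multipliable_def)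
  have sqg: "square_kernel m g j \<in> L2_kernels j" if "j \<le> 2 * m" for j using sq[of 0, OF _ that] by (simp add: multipliable_def)
  have prod: "is_product F2 G2 (\<Sum>i\<le>2 * n. \<Sum>j\<le>2 * m. product_integral i (square_kernel n f i) j (square_kernel m g j))"
    unfolding F2 G2 by (rule product_sum) (auto intro!: product_I sq)
  then show "\<exists>\<zeta>. is_product (L2_pow M \<iota> (I n f) 2) (L2_pow M \<iota> (I m g) 2) \<zeta>" unfolding F2_def G2_def by blast
  define pairing where "pairing = (\<lambda>j. LINT t|orthant j. square_kernel n f j t * square_kernel m g j (\<lambda>i\<in>{..<j}. t (j - 1 - i)))"
  have "state (mul F2 G2) = (\<Sum>i\<le>2 * n. \<Sum>j\<le>2 * m. if i = j then pairing i else 0)"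
    unfolding mult_eq[OF prod] state_sum pairing_def
    by (intro sum.cong refl) (simp add: state_product_integral[OF sq])
  also have "\<dots> = (\<Sum>i\<le>2 * n. if i \<le> 2 * m then pairing i else 0)"
    by (intro sum.cong refl) (simp add: sum.delta)
  also have "\<dots> = (\<Sum>i\<in>{..2 * min n m}. pairing i)"
    by (rule sum.mono_neutral_cong_right) auto
  also have "{..2 * min n m} = insert 0 {1..2 * min n m}" by auto
  also have "(\<Sum>i\<in>insert 0 {1..2 * min n m}. pairing i) = pairing 0 + (\<Sum>i=1..2 * min n m. pairing i)"
    by (rule sum.insert) auto
  finally have st: "state (mul F2 G2) = pairing 0 + (\<Sum>i=1..2 * min n m. pairing i)" .
  have "(\<lambda>i\<in>{..<0}. t (0 - 1 - i)) = (\<lambda>_. undefined)" for t :: "nat \<Rightarrow> real" by auto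
  moreover have sF: "state F2 = square_kernel n f 0 (\<lambda>_. undefined)" unfolding F2 by (rule state_square) (rule sqf)
  moreover have sG: "state G2 = square_kernel m g 0 (\<lambda>_. undefined)" unfolding G2 by (rule state_square) (rule sqg)
  ultimately have p0: "pairing 0 = state F2 * state G2"
    unfolding pairing_def sF sG by (simp only: integral_orthant_0)
  have key: "mixed_kernel n f m g j \<in> L2_kernels (n + m - j) \<and>
    pairing j = complex_of_real (LINT t|orthant (n + m - j). (cmod (mixed_kernel n f m g j t))\<^sup>2)"
    if j: "1 \<le> j" "j \<le> 2 * min n m" for j
  proof -
    note fm = L2_kernels_measurable[OF f(1)] and gm = L2_kernels_measurable[OF g(1)]
    show ?thesis
    proof (cases "even j")
      case True
      define r where "r = j div 2"
      have jr: "j = 2 * r" using True by (simp add: r_def)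
      then have r: "1 \<le> r" "r \<le> n" "r \<le> m" using j by auto
      have mk: "mixed_kernel n f m g j = contraction n m r f g" "square_kernel n f j = contraction n n (n - r) f f"
        "square_kernel m g j = contraction m m (m - r) g g"
        unfolding mixed_kernel_def square_kernel_def jr by simp_all
      have L2: "contraction n m r f g \<in> L2_kernels (n + m - 2 * r)" by (rule contraction_in_L2) (use f g r in auto)
      have "(LINT t|orthant (2 * r - 0). contraction n n (n - r) f f t * contraction m m (m - r) g g (\<lambda>i\<in>{..<2 * r - 0}. t (2 * r - 0 - 1 - i)))
        = complex_of_real (LINT t|orthant (n + m - 2 * r + 0). (cmod (contraction n m r f g t))\<^sup>2)"
      proof (rule contraction_square_pairing[OF f g])
        show "contraction n n (n - r) f f \<in> L2_kernels (2 * r - 0)" using sqf[of j] j unfolding mk unfolding jr by simp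
        show "contraction m m (m - r) g g \<in> L2_kernels (2 * r - 0)" using sqg[of j] j unfolding mk unfolding jr by simp
      qed (use r L2 in \<open>auto intro!: represents_contraction_contraction fm gm\<close>)
      then show ?thesis using L2 unfolding pairing_def mk unfolding jr by simp
    next
      case False
      define r where "r = (j + 1) div 2"
      have jr: "j = 2 * r - 1" using False by (simp add: r_def)
      have "1 \<le> r" using j by (simp add: r_def)
      then have r: "1 \<le> r" "r \<le> n" "r \<le> m" using j(2) unfolding jr by auto
      have nj: "n + m - j = n + m - 2 * r + 1" using r jr by auto
      show ?thesis
      proof (cases "K = Compensated_Free_Poisson")
        case True
        have mk: "mixed_kernel n f m g j = star_contraction n m r f g" "square_kernel n f j = star_contraction n n (n - r + 1) f f"
          "square_kernel m g j = star_contraction m m (m - r + 1) g g"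
          unfolding mixed_kernel_def square_kernel_def r_def using False True by simp_all
        have L2: "star_contraction n m r f g \<in> L2_kernels (n + m - 2 * r + 1)"
          using fg r True unfolding multipliable_def by auto
        have "(LINT t|orthant (2 * r - 1). star_contraction n n (n - r + 1) f f t * star_contraction m m (m - r + 1) g g (\<lambda>i\<in>{..<2 * r - 1}. t (2 * r - 1 - 1 - i)))
          = complex_of_real (LINT t|orthant (n + m - 2 * r + 1). (cmod (star_contraction n m r f g t))\<^sup>2)"
        proof (rule contraction_square_pairing[OF f g])
          show "represents_contraction 1 n n (n - r + 1) f f (star_contraction n n (n - r + 1) f f)"
            using r by (intro represents_contraction_star fm) auto
          show "represents_contraction 1 m m (m - r + 1) g g (star_contraction m m (m - r + 1) g g)"
            using r by (intro represents_contraction_star gm) auto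
          show "represents_contraction 1 n m r f g (star_contraction n m r f g)"
            using r by (intro represents_contraction_star fm gm) auto
          show "star_contraction n n (n - r + 1) f f \<in> L2_kernels (2 * r - 1)" using sqf[of j] j unfolding mk unfolding jr by simp
          show "star_contraction m m (m - r + 1) g g \<in> L2_kernels (2 * r - 1)" using sqg[of j] j unfolding mk unfolding jr by simp
        qed (use r L2 in auto)
        then show ?thesis using L2 unfolding pairing_def nj mk unfolding jr by simp
      next
        case K: False
        have mk: "mixed_kernel n f m g j = (\<lambda>_. 0)" "square_kernel n f j = (\<lambda>_. 0)"
          unfolding mixed_kernel_def square_kernel_def using False K by simp_all
        show ?thesis unfolding pairing_def mk by (auto intro: L2_kernels_null)
      qed
    qed
  qed
  show "mixed_kernel n f m g j \<in> L2_kernels (n + m - j)" if "1 \<le> j" "j \<le> 2 * min n m" for j using key[OF that] by simp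
  have "L2_cov M \<iota> F2 G2 = (\<Sum>i=1..2 * min n m. pairing i)"
    unfolding L2_cov_def st p0 by simp
  also have "\<dots> = complex_of_real (\<Sum>j=1..2 * min n m. LINT t|orthant (n + m - j). (cmod (mixed_kernel n f m g j t))\<^sup>2)"
    unfolding of_real_sum by (rule sum.cong[OF refl]) (use key in auto)
  finally show "L2_cov M \<iota> (L2_pow M \<iota> (I n f) 2) (L2_pow M \<iota> (I m g) 2)
     = complex_of_real (\<Sum>j=1..2 * min n m. LINT t|orthant (n + m - j). (cmod (mixed_kernel n f m g j t))\<^sup>2)"
    unfolding F2_def G2_def .
qed

text \<open>Freeness, applied to the word made of the two centred squares, is the assertion that their covariance
  vanishes, by bilinearity of the product.\<close>

lemma free_imp_squares_uncorrelated:
  assumes free: "L2_free M \<iota> [X, Y]"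
    and F2: "L2_pow M \<iota> X 2 \<in> span_I G" and G2: "L2_pow M \<iota> Y 2 \<in> span_I G" and G: "\<And>k h. (k, h) \<in> G \<Longrightarrow> h \<in> L2_kernels k"
    and prod: "is_product (L2_pow M \<iota> X 2) (L2_pow M \<iota> Y 2) \<zeta>"
  shows "L2_cov M \<iota> (L2_pow M \<iota> X 2) (L2_pow M \<iota> Y 2) = 0"
proof -
  define x where "x = L2_pow M \<iota> X 2"
  define y where "y = L2_pow M \<iota> Y 2"
  \<comment> \<open>The polynomial that squares its argument.\<close>
  define P where "P = (monom 1 2 :: complex poly)"
  have poly: "L2_poly M \<iota> P \<xi> = L2_pow M \<iota> \<xi> 2" for \<xi>
  proof -
    have "L2_poly M \<iota> P \<xi> = (\<Sum>k\<le>2. coeff P k *\<^sub>C L2_pow M \<iota> \<xi> k)" by (simp add: L2_poly_def P_def degree_monom_eq)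
    also have "\<dots> = (\<Sum>k\<in>{2}. coeff P k *\<^sub>C L2_pow M \<iota> \<xi> k)"
      by (rule sum.mono_neutral_right) (auto simp: P_def scaleC_zero_left)
    finally show ?thesis by (simp add: P_def scaleC_one)
  qed
  have cent: "L2_centered_poly M \<iota> P X = x + (- state x) *\<^sub>C one" "L2_centered_poly M \<iota> P Y = y + (- state y) *\<^sub>C one"
    using scaleC_scaleC[of "-1" _ one]
    by (simp_all add: L2_centered_poly_def poly x_def y_def scaleC_minus_one)
  have xy: "is_product x y \<zeta>" using prod by (simp add: x_def y_def)
  have x1: "is_product x one x" "is_product one y y" "is_product y one y" "is_product one one one"
    using span_I_one[OF G F2] span_I_one[OF G G2] product_one_right[OF const_in_L2_kernels_0[of 1]]
    by (simp_all add: x_def y_def one_eq_I[symmetric])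
  define a where "a = - state x"
  define b where "b = - state y"
  have "is_product (y + b *\<^sub>C one) one (y + b *\<^sub>C one)"
    by (intro product_add_left product_scale_left x1)
  then have r: "mul (y + b *\<^sub>C one) one = y + b *\<^sub>C one" by (rule mult_eq)
  have "is_product (x + a *\<^sub>C one) (y + b *\<^sub>C one) ((\<zeta> + a *\<^sub>C y) + (b *\<^sub>C x + a *\<^sub>C b *\<^sub>C one))"
    by (intro product_add_left product_add_right product_scale_left product_scale_right x1 xy)
  then have "mul (x + a *\<^sub>C one) (y + b *\<^sub>C one) = (\<zeta> + a *\<^sub>C y) + (b *\<^sub>C x + a *\<^sub>C b *\<^sub>C one)" by (rule mult_eq)
  moreover have "state (foldr mul (map (\<lambda>(P, i). L2_centered_poly M \<iota> P ([X, Y] ! i)) [(P, 0), (P, 1)]) one) = 0"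
    using free unfolding L2_free_def by (rule allE[of _ "[(P, 0), (P, 1)]"]) simp
  ultimately have "state ((\<zeta> + a *\<^sub>C y) + (b *\<^sub>C x + a *\<^sub>C b *\<^sub>C one)) = 0"
    using r by (simp add: cent a_def b_def)
  then have "state \<zeta> - state x * state y = 0"
    by (simp add: state_add state_scale state_one a_def b_def algebra_simps)
  then show ?thesis unfolding L2_cov_def x_def[symmetric] y_def[symmetric] mult_eq[OF xy] .
qed

end

section \<open>Freeness and uncorrelated squares\<close>

context chaos
begin

lemma closed_family_chaos_kernels:
  assumes F: "\<And>k h. (k, h) \<in> F \<Longrightarrow> h \<in> L2_kernels k"
    and P: "K = Compensated_Free_Poisson \<Longrightarrow> \<forall>(k, h) \<in> generated_kernels F. h \<in> L2_kernels k"
  shows multipliable_chaos_kernels: "(k, h) \<in> chaos_kernels K F \<Longrightarrow> (l, u) \<in> chaos_kernels K F \<Longrightarrow> multipliable k h l u"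
    and "closed_family (chaos_kernels K F)"
proof -
  have L2: "h \<in> L2_kernels k" if "(k, h) \<in> chaos_kernels K F" for k h
    by (rule chaos_kernels_L2[OF F P that])
  have mu: "multipliable k h l u" if kh: "(k, h) \<in> chaos_kernels K F" and lu: "(l, u) \<in> chaos_kernels K F" for k h l u
  proof -
    have "star_contraction k l p h u \<in> L2_kernels (k + l - 2 * p + 1)"
      if "K = Compensated_Free_Poisson" "p \<in> {1..min k l}" for p
      by (rule L2, rule chaos_kernels.star_contraction[OF that(1) kh lu]) (use that(2) in auto)
    then show ?thesis unfolding multipliable_def using L2[OF kh] L2[OF lu] by blast
  qed
  then show "(k, h) \<in> chaos_kernels K F \<Longrightarrow> (l, u) \<in> chaos_kernels K F \<Longrightarrow> multipliable k h l u" .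
  show "closed_family (chaos_kernels K F)"
    unfolding closed_family_def
  proof (intro conjI ballI, safe)
    fix k h assume kh: "(k, h) \<in> chaos_kernels K F"
    show "h \<in> L2_kernels k" by (rule L2[OF kh])
    fix l u assume lu: "(l, u) \<in> chaos_kernels K F"
    have "product_integral k h l u \<in> span_I (chaos_kernels K F)"
    proof (rule product_integral_span)
      show "(k + l - 2 * p, contraction k l p h u) \<in> chaos_kernels K F" if "p \<le> min k l" for p
        by (rule chaos_kernels.contraction[OF kh lu that])
      show "(k + l - 2 * p + 1, star_contraction k l p h u) \<in> chaos_kernels K F"
        if "K = Compensated_Free_Poisson" "1 \<le> p" "p \<le> min k l" for p
        by (rule chaos_kernels.star_contraction[OF that(1) kh lu that(2,3)])
    qed
    then show "\<exists>\<zeta>\<in>span_I (chaos_kernels K F). is_product (I k h) (I l u) \<zeta>"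
      using product_I[OF mu[OF kh lu]] by blast
  qed
qed

lemma square_kernel_chaos:
  assumes f: "(n, f) \<in> chaos_kernels K F" and j: "j \<le> 2 * n" and nz: "even j \<or> K = Compensated_Free_Poisson"
  shows "(j, square_kernel n f j) \<in> chaos_kernels K F"
proof (cases "even j")
  case True
  then obtain r where r: "j = 2 * r" by blast
  have "(n + n - 2 * (n - r), contraction n n (n - r) f f) \<in> chaos_kernels K F"
    by (rule chaos_kernels.contraction[OF f f]) simp
  moreover have "n + n - 2 * (n - r) = j" using r j by auto
  ultimately show ?thesis using r by (simp add: square_kernel_def)
next
  case False
  then obtain r where r: "j = 2 * r + 1" by (rule oddE)
  have "(n + n - 2 * (n - r) + 1, star_contraction n n (n - r) f f) \<in> chaos_kernels K F"
    using False nz r j by (intro chaos_kernels.star_contraction f) auto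
  moreover have "n + n - 2 * (n - r) + 1 = j" using r j by auto
  moreover have "square_kernel n f j = star_contraction n n (n - r) f f"
  proof -
    have "square_kernel n f j = star_contraction n n (n - (j + 1) div 2 + 1) f f"
      unfolding square_kernel_def using False nz by simp
    moreover have "n - (j + 1) div 2 + 1 = n - r" using r j by auto
    ultimately show ?thesis by simp
  qed
  ultimately show ?thesis by simp
qed

theorem free_iff_squares_uncorrelated:
  assumes n: "1 \<le> n" "1 \<le> m"
    and f: "f \<in> L2_kernels n" "symmetric_kernel n f" and g: "g \<in> L2_kernels m" "symmetric_kernel m g"
    and P: "K = Compensated_Free_Poisson \<Longrightarrow> \<forall>(k, h) \<in> generated_kernels {(n, f), (m, g)}. h \<in> L2_kernels k"
  shows "L2_free M \<iota> [I n f, I m g] \<longleftrightarrow> L2_cov M \<iota> (L2_pow M \<iota> (I n f) 2) (L2_pow M \<iota> (I m g) 2) = 0"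
proof -
  define F where "F = {(n, f), (m, g)}"
  have F: "h \<in> L2_kernels k" if "(k, h) \<in> F" for k h using that f g by (auto simp: F_def)
  note P' = P[folded F_def]
  have L2: "h \<in> L2_kernels k" if "(k, h) \<in> chaos_kernels K F" for k h by (rule chaos_kernels_L2[OF F P' that])
  have mu: "multipliable k h l u" if "(k, h) \<in> chaos_kernels K F" "(l, u) \<in> chaos_kernels K F" for k h l u
    by (rule multipliable_chaos_kernels[OF F P' that])
  have clo: "closed_family (chaos_kernels K F)" by (rule closed_family_chaos_kernels(2)[OF F P'])
  have nf: "(n, f) \<in> chaos_kernels K F" and mg: "(m, g) \<in> chaos_kernels K F"
    by (auto simp: F_def intro: chaos_kernels.base)
  have sq: "multipliable i (square_kernel n f i) j (square_kernel m g j)" if ij: "i \<le> 2 * n" "j \<le> 2 * m" for i j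
  proof (cases "K = Compensated_Free_Poisson")
    case True
    then show ?thesis using ij by (intro mu square_kernel_chaos nf mg) auto
  next
    case False
    have *: "square_kernel k h i \<in> L2_kernels i" if "(k, h) \<in> chaos_kernels K F" "i \<le> 2 * k" for k h i
      using L2[OF square_kernel_chaos[OF that]] False unfolding square_kernel_def by (cases "even i") (auto intro: L2_kernels_null)
    show ?thesis using False *[OF nf ij(1)] *[OF mg ij(2)] unfolding multipliable_def by simp
  qed
  note cov = covariance_of_squares[OF f g mu[OF nf nf] mu[OF mg mg] mu[OF nf mg]]
  have cov1: "L2_cov M \<iota> (L2_pow M \<iota> (I n f) 2) (L2_pow M \<iota> (I m g) 2)
     = complex_of_real (\<Sum>j=1..2 * min n m. LINT t|orthant (n + m - j). (cmod (mixed_kernel n f m g j t))\<^sup>2)"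
    by (rule cov(1)) (rule sq)
  have cov2: "\<exists>\<zeta>. is_product (L2_pow M \<iota> (I n f) 2) (L2_pow M \<iota> (I m g) 2) \<zeta>"
    by (rule cov(2)) (rule sq)
  have cov3: "mixed_kernel n f m g j \<in> L2_kernels (n + m - j)" if "1 \<le> j" "j \<le> 2 * min n m" for j
    by (rule cov(3)[OF _ that]) (rule sq)
  show ?thesis
  proof
    assume free: "L2_free M \<iota> [I n f, I m g]"
    obtain \<zeta> where "is_product (L2_pow M \<iota> (I n f) 2) (L2_pow M \<iota> (I m g) 2) \<zeta>" using cov2 by blast
    then show "L2_cov M \<iota> (L2_pow M \<iota> (I n f) 2) (L2_pow M \<iota> (I m g) 2) = 0"
      using L2_pow_span[OF clo nf, of 1] L2_pow_span[OF clo mg, of 1]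
      by (intro free_imp_squares_uncorrelated[OF free _ _ L2]) (simp_all add: numeral_2_eq_2)
  next
    assume "L2_cov M \<iota> (L2_pow M \<iota> (I n f) 2) (L2_pow M \<iota> (I m g) 2) = 0"
    then have "(\<Sum>j=1..2 * min n m. LINT t|orthant (n + m - j). (cmod (mixed_kernel n f m g j t))\<^sup>2) = 0"
      unfolding cov1 by (simp only: of_real_eq_0_iff)
    then have zero: "\<forall>j\<in>{1..2 * min n m}. (LINT t|orthant (n + m - j). (cmod (mixed_kernel n f m g j t))\<^sup>2) = 0"
      by (subst (asm) sum_nonneg_eq_0_iff) auto
    have null: "AE t in orthant (n + m - j). mixed_kernel n f m g j t = 0" if "1 \<le> j" "j \<le> 2 * min n m" for j
    proof -
      have "integrable (orthant (n + m - j)) (\<lambda>t. (cmod (mixed_kernel n f m g j t))\<^sup>2)"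
        using cov3[OF that] by (simp add: L2_kernels_def)
      from integral_nonneg_eq_0_iff_AE[OF this] show ?thesis using zero that by simp
    qed
    define G where "G = (\<lambda>i::nat. if i = 0 then chaos_kernels K {(n, f)} else chaos_kernels K {(m, g)})"
    have Gsub: "(k, h) \<in> G i \<Longrightarrow> (k, h) \<in> chaos_kernels K F" for i k h
      using chaos_kernels_mono[of "{(n, f)}" F k h K] chaos_kernels_mono[of "{(m, g)}" F k h K]
      by (auto simp: G_def F_def split: if_splits)
    have GL2: "h \<in> L2_kernels k" if "(k, h) \<in> G i" for i k h by (rule L2[OF Gsub[OF that]])
    have sub: "generated_kernels {(n, f)} \<subseteq> generated_kernels F" "generated_kernels {(m, g)} \<subseteq> generated_kernels F"
    proof -
      have "(k, h) \<in> generated_kernels F" if "(k, h) \<in> generated_kernels F'" "F' \<subseteq> F" for k h F'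
        using that by (induction rule: generated_kernels.induct) (blast intro: generated_kernels.intros)+
      then show "generated_kernels {(n, f)} \<subseteq> generated_kernels F" "generated_kernels {(m, g)} \<subseteq> generated_kernels F"
        by (auto simp: F_def)
    qed
    have clo0: "closed_family (chaos_kernels K {(n, f)})"
      by (rule closed_family_chaos_kernels(2)) (use f P' sub in auto)
    have clo1: "closed_family (chaos_kernels K {(m, g)})"
      by (rule closed_family_chaos_kernels(2)) (use g P' sub in auto)
    have G0: "closed_family (G 0)" "(n, f) \<in> G 0" and G1: "closed_family (G 1)" "(m, g) \<in> G 1"
      using clo0 clo1 by (auto simp: G_def intro: chaos_kernels.base)
    show "L2_free M \<iota> [I n f, I m g]"
    proof (cases K)
      case Free_Brownian
      have c: "AE t in orthant (n + m - 2 * r). contraction n m r f g t = 0" if "1 \<le> r" "r \<le> n" "r \<le> m" for r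
        using null[of "2 * r"] that by (simp add: mixed_kernel_def)
      have sep0: "separated n f m g" by (rule separated_of_contractions_null[OF f g c])
      have sep1: "separated n f l u" if "(l, u) \<in> G 1" for l u
        using chaos_kernels_separated[OF g(1) f(1) separated_commute[OF sep0]] that Free_Brownian
        by (auto simp: G_def intro: separated_commute)
      have sep2: "separated k h l u" if "(k, h) \<in> G 0" "(l, u) \<in> G 1" for k h l u
        using chaos_kernels_separated[OF f(1) GL2[OF that(2)] sep1[OF that(2)]] that(1) Free_Brownian by (auto simp: G_def)
      have sep: "separated k h l u" if "i < 2" "(k, h) \<in> G (1 - i)" "(l, u) \<in> G i" for i k h l u
      proof -
        have "i = 0 \<or> i = 1" using that(1) by auto
        then show ?thesis using sep2[of k h l u] sep2[of l u k h] that by (auto intro: separated_commute)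
      qed
      show ?thesis
      proof (rule free_of_annihilating[of G, OF G0 n(1) G1 n(2)])
        fix i k h l u assume *: "i < (2::nat)" "(k, h) \<in> G (1 - i)" "1 \<le> k" "(l, u) \<in> G i" "1 \<le> l"
        show "annihilates k h l u" unfolding annihilates_def
          using separated_contraction_null[OF GL2[OF *(2)] GL2[OF *(4)] _ _ _ sep[OF *(1,2,4)]] Free_Brownian by auto
        fix l' u' assume u': "u' \<in> L2_kernels l'"
        show "annihilates k h (l + l') (contraction l l' 0 u u')" unfolding annihilates_def
          using separated_tensor_null[OF GL2[OF *(2)] GL2[OF *(4)] u' *(5) _ _ _ sep[OF *(1,2,4)]] Free_Brownian by auto
      qed
    next
      case Compensated_Free_Poisson
      have mk: "mixed_kernel n f m g 1 = star_contraction n m 1 f g"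
        unfolding mixed_kernel_def using Compensated_Free_Poisson by simp
      have nm: "n + m - 1 = n + m - 2 * 1 + 1" using n by simp
      have "AE t in orthant (n + m - 2 * 1 + 1). star_contraction n m 1 f g t = 0"
        using null[of 1] n unfolding mk nm by auto
      from disjoint_supports[OF f g n this] obtain E where E: "vanishes_on (- E) n f" "vanishes_on E m g" by blast
      \<comment> \<open>The set on which the kernels of index \<open>i\<close> vanish.\<close>
      define D where "D = (\<lambda>i::nat. if i = 0 then - E else E)"
      have van: "vanishes_on (D i) k h" if "(k, h) \<in> G i" for i k h
      proof (cases "i = 0")
        case True
        have "vanishes_on (- E) k h"
          by (rule chaos_kernels_vanishes_on[OF _ E(1)]) (use that True GL2[of _ _ 0] in \<open>auto simp: G_def\<close>)
        then show ?thesis using True by (simp add: D_def)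
      next
        case False
        have "vanishes_on E k h"
          by (rule chaos_kernels_vanishes_on[OF _ E(2)]) (use that False GL2[of _ _ 1] in \<open>auto simp: G_def\<close>)
        then show ?thesis using False by (simp add: D_def)
      qed
      have D: "D (1 - i) = - D i" if "i < 2" for i
      proof -
        have "i = 0 \<or> i = 1" using that by auto
        then show ?thesis by (auto simp: D_def)
      qed
      have annP: "annihilates k h l u"
        if "i < 2" "(k, h) \<in> G (1 - i)" and u: "u \<in> L2_kernels l" "AE t in orthant l. t 0 \<in> D i \<longrightarrow> u t = 0" for i k h l u
        unfolding annihilates_def
      proof (intro allI impI conjI)
        note h = GL2[OF that(2)] and hv = van[OF that(2), unfolded D[OF that(1)]]
        fix p assume p: "1 \<le> p \<and> p \<le> min k l"
        have r0: "represents_contraction 0 k l p h u (contraction k l p h u)"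
          using p by (intro represents_contraction_contraction L2_kernels_measurable h u(1)) auto
        show "AE t in orthant (k + l - 2 * p). contraction k l p h u t = 0"
          by (rule contraction_null_if[OF r0 _ _ _ _ hv u(2), unfolded add_0_right]) (use p in auto)
        have r1: "represents_contraction 1 k l p h u (star_contraction k l p h u)"
          using p by (intro represents_contraction_star L2_kernels_measurable h u(1)) auto
        show "AE t in orthant (k + l - 2 * p + 1). star_contraction k l p h u t = 0"
          by (rule contraction_null_if[OF r1 _ _ _ _ hv u(2)]) (use p in auto)
      qed
      show ?thesis
      proof (rule free_of_annihilating[of G, OF G0 n(1) G1 n(2)])
        fix i k h l u assume *: "i < (2::nat)" "(k, h) \<in> G (1 - i)" "1 \<le> k" "(l, u) \<in> G i" "1 \<le> l"
        note u = GL2[OF *(4)] and uv = van[OF *(4)]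
        show "annihilates k h l u"
          by (rule annP[OF *(1,2) u]) (use uv *(5) in \<open>auto simp: vanishes_on_def\<close>)
        fix l' u' assume u': "u' \<in> L2_kernels l'"
        show "annihilates k h (l + l') (contraction l l' 0 u u')"
        proof (rule annP[OF *(1,2)])
          show "contraction l l' 0 u u' \<in> L2_kernels (l + l')" using contraction_in_L2[OF u u', of 0] by simp
          have "represents_contraction 0 l l' 0 u u' (contraction l l' 0 u u')"
            by (intro represents_contraction_contraction L2_kernels_measurable u u') auto
          from tensor_vanishes_first[OF this *(5) uv]
          show "AE t in orthant (l + l'). t 0 \<in> D i \<longrightarrow> contraction l l' 0 u u' t = 0" .
        qed
      qed
    qed
  qed
qed

end

theorem corollary3p8:
  fixes M :: "('h::complex_hilbert_space \<Rightarrow>\<^sub>L 'h) set"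
    and \<phi> :: "('h \<Rightarrow>\<^sub>L 'h) \<Rightarrow> complex"
    and \<iota> :: "('h \<Rightarrow>\<^sub>L 'h) \<Rightarrow> 'l::complex_hilbert_space"
    and \<F> :: "real \<Rightarrow> ('h \<Rightarrow>\<^sub>L 'h) set"
    and K :: free_process
    and Z :: "real \<Rightarrow> ('h \<Rightarrow>\<^sub>L 'h)"
    and I :: "nat \<Rightarrow> kernel \<Rightarrow> 'l"
    and n m :: nat
    and f g :: kernel
  assumes "tracial_W_star_space M \<phi>"
    and "L2_completion M \<phi> \<iota>"
    and "von_neumann_filtration M \<F>"
    and "driving_process K \<phi> \<F> Z"
    and "multiple_integrals M \<iota> Z I"
    and "product_formula K M \<iota> I"
    and "n \<ge> 1" and "m \<ge> 1"
    and "f \<in> L2_kernels n" and "symmetric_kernel n f"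
    and "g \<in> L2_kernels m" and "symmetric_kernel m g"
    and "K = Compensated_Free_Poisson \<Longrightarrow>
           \<forall>(k, h) \<in> generated_kernels {(n, f), (m, g)}. h \<in> L2_kernels k"
  shows "L2_free M \<iota> [I n f, I m g] \<longleftrightarrow>
         L2_cov M \<iota> (L2_pow M \<iota> (I n f) 2) (L2_pow M \<iota> (I m g) 2) = 0"
proof -
  interpret chaos M \<phi> \<iota> K Z I
    by unfold_locales fact+
  show ?thesis by (rule free_iff_squares_uncorrelated) fact+
qed

end
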